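(* Let $(g,L,U)$ be payoff processes and $\{\mathcal P(t,\omega)\}_{(t,\omega)\in[0,T]\times\Omega}$ a probability class such that the following properties (all defined in the context) hold: payoff regularity, integrability, adaptedness, stability under conditioning, weak stability under pasting, and path-continuity of values. Then for any $n\in\mathbb N\cup\{\infty\}$, $0\le t\le s\le T$ and $\omega\in\Omega$, $$V^n_t(\omega)\le\inf_{\mathbb P\in\mathcal P(t,\omega)}\ \inf_{\gamma\in\mathcal T^t}\ \sup_{\tau\in\mathcal T^t(n)}\mathbb E_{\mathbb P}\bigg[\mathbf 1_{\{\tau\wedge\gamma<s\}}R^{t,\omega}(\tau,\gamma)+\mathbf 1_{\{\tau\wedge\gamma\ge s\}}\Big((V^n_s)^{t,\omega}+\int_t^sg^{t,\omega}_r\,dr\Big)\bigg].$$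
   Context: **Canonical spaces.** Fix $d\in\mathbb N$, $T\in(0,\infty)$. A modulus of continuity function is a nondecreasing $\rho:[0,\infty)\to[0,\infty)$ with $\rho(0)=\lim_{x\downarrow0}\rho(x)=0$. For $t\in[0,T]$ let $\Omega^t=\{\omega\in C([t,T];\mathbb R^d):\omega(t)=0\}$, $\|\omega\|_{t,s}=\sup_{r\in[t,s]}|\omega(r)|$, $B^t$ the canonical process on $\Omega^t$, $\mathcal F^t_s=\sigma(B^t_r:r\in[t,s])$, $\mathbf F^t=\{\mathcal F^t_s\}_{s\in[t,T]}$ (raw filtration), $\mathcal T^t$ the set of all $\mathbf F^t$-stopping times (with values in $[t,T]$), $\mathcal T^t_s=\{\tau\in\mathcal T^t:\tau\ge s \text{ everywhere}\}$, and $\mathfrak P_t$ the set of all probabilities on $(\Omega^t,\mathcal F^t_T)$. For $n\in\mathbb N$, $\mathcal T^t(n)$ is the set of $\tau\in\mathcal T^t$ with values in $\{t\vee(i2^{-n}T)\}_{i=0}^{2^n}$, and $\mathcal T^t_s(n)=\mathcal T^t(n)\cap\mathcal T^t_s$; put $\mathcal T^t(\infty)=\mathcal T^t$, $\mathcal T^t_s(\infty)=\mathcal T^t_s$. The superscript $t$ is dropped when $t=0$; $\mathbf 0\in\Omega$ is the null path. For $\omega\in\Omega^t$, $\delta>0$: $O^s_\delta(\omega)=\{\omega'\in\Omega^t:\|\omega'-\omega\|_{t,s}<\delta\}$. $\mathbb S(\mathbf F^t,\mathbb P)$ is the set of real-valued $\mathbf F^t$-adapted processes $X$ on $[t,T]$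 with all paths continuous and $\mathbb E_{\mathbb P}[\sup_{s\in[t,T]}|X_s|]<\infty$. **Shifts.** For $t\le s$, $\omega\in\Omega^t$, $\tilde\omega\in\Omega^s$: $(\omega\otimes_s\tilde\omega)(r)=\omega(r)\mathbf 1_{\{r<s\}}+(\omega(s)+\tilde\omega(r))\mathbf 1_{\{r\ge s\}}$, $r\in[t,T]$. For a random variable $\xi$ (resp. process $X$) on $\Omega^t$: $\xi^{s,\omega}(\tilde\omega)=\xi(\omega\otimes_s\tilde\omega)$, $X^{s,\omega}_r(\tilde\omega)=X_r(\omega\otimes_s\tilde\omega)$, $r\in[s,T]$. For $\mathbb P\in\mathfrak P_t$, $\mathbb P^{s,\omega}\in\mathfrak P_s$ is defined by $\mathbb P^{s,\omega}(A)=\mathbb P^\omega_s(\omega\otimes_sA)$, $A\in\mathcal F^s_T$, where $\{\mathbb P^\omega_s\}_{\omega\in\Omega^t}$ is the regular conditional probability distribution of $\mathbb P$ given $\mathcal F^t_s$ with $\mathbb P^\omega_s(\omega\otimes_s\Omega^s)=1$ for all $\omega$. **Payoff regularity.** $g,L,U$ are real-valued processes on $[0,T]\times\Omega$ with $L\le U$ everywhere, and there is a modulus of continuity function $\rho_0$ such that each $X\in\{g,L,U\}$ satisfies $|X_{t_1}(\omega_1)-X_{t_2}(\omega_2)|\le\rho_0\big(|t_1-t_2|+\|\omega_1(\cdot\wedge t_1)-\omega_2(\cdot\wedge t_2)\|_{0,T}\big)$ for all $(t_i,\omega_i)\in[0,T]\times\Omega$. Put $\Psi_t=(-L_t)\vee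 U_t\vee0$ and, for $\tau,\gamma\in\mathcal T^t$, $R^{t,\omega}(\tau,\gamma)=\int_t^{\tau\wedge\gamma}g^{t,\omega}_s\,ds+\mathbf 1_{\{\tau\le\gamma\}}L^{t,\omega}_\tau+\mathbf 1_{\{\gamma<\tau\}}U^{t,\omega}_\gamma$. **Integrability.** For every $t\in[0,T]$ the set $\widehat{\mathfrak P}_t=\{\mathbb P\in\mathfrak P_t:\Psi^{t,\mathbf 0}\in\mathbb S(\mathbf F^t,\mathbb P),\ \mathbb E_{\mathbb P}\int_t^T|g^{t,\mathbf 0}_s|ds<\infty\}$ is nonempty. **Adaptedness.** For all $(t,\omega)$, $\mathcal P(t,\omega)$ is a nonempty subset of $\widehat{\mathfrak P}_t$, and $\mathcal P(t,\omega_1)=\mathcal P(t,\omega_2)$ if $\omega_1|_{[0,t]}=\omega_2|_{[0,t]}$. **Stability under conditioning.** For all $0\le t<s\le T$, $\omega\in\Omega$, $\mathbb P\in\mathcal P(t,\omega)$ there exist an extension $(\Omega^t,\mathcal F',\mathbb P')$ of $(\Omega^t,\mathcal F^t_T,\mathbb P)$ (i.e. $\mathcal F^t_T\subset\mathcal F'$, $\mathbb P'|_{\mathcal F^t_T}=\mathbb P$) and $\Omega'\in\mathcal F'$ with $\mathbb P'(\Omega')=1$ such that $\mathbb P^{s,\tilde\omega}\in\mathcal P(s,\omega\otimes_t\tilde\omega)$ for all $\tilde\omega\in\Omega'$. **Weak stability under pasting.** There is a modulus of continuity function $\widehat\rho_0$ such that for all $0\le t<s\le T$, $\omega\in\Omega$,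 $\mathbb P\in\mathcal P(t,\omega)$, $\delta\in\mathbb Q_+$ (positive rational), $\lambda\in\mathbb N$, every $\mathcal F^t_s$-measurable partition $\{\mathcal A_j\}_{j=0}^\lambda$ of $\Omega^t$ such that for $j=1,\dots,\lambda$, $\mathcal A_j\subset O^s_{\delta_j}(\tilde\omega_j)$ for some $\delta_j\in((0,\delta]\cap\mathbb Q)\cup\{\delta\}$, $\tilde\omega_j\in\Omega^t$, and all $\mathbb P_j\in\mathcal P(s,\omega\otimes_t\tilde\omega_j)$, $j=1,\dots,\lambda$, there is $\widehat{\mathbb P}\in\mathcal P(t,\omega)$ with: (i) $\widehat{\mathbb P}(A\cap\mathcal A_0)=\mathbb P(A\cap\mathcal A_0)$ for all $A\in\mathcal F^t_T$; (ii) $\widehat{\mathbb P}(A\cap\mathcal A_j)=\mathbb P(A\cap\mathcal A_j)$ for all $j=1,\dots,\lambda$, $A\in\mathcal F^t_s$; (iii) for any $n\in\mathbb N\cup\{\infty\}$ and $\wp\in\mathcal T^s$ there exist $\wp^n_j\in\mathcal T^t_s$, $j=1,\dots,\lambda$, such that for any $A\in\mathcal F^t_s$ and $\tau\in\mathcal T^t_s(n)$, $$\sum_{j=1}^\lambda\mathbb E_{\widehat{\mathbb P}}\big[\mathbf 1_{A\cap\mathcal A_j}R^{t,\omega}(\tau,\wp^n_j)\big]\le\sum_{j=1}^\lambda\mathbb E_{\mathbb P}\Big[\mathbf 1_{\{\tilde\omega\in A\cap\mathcal A_j\}}\Big(\sup_{\varsigma\in\mathcal T^s(n)}\mathbb E_{\mathbb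 P_j}\big[R^{s,\omega\otimes_t\tilde\omega}(\varsigma,\wp)\big]+\int_t^sg^{t,\omega}_r(\tilde\omega)dr\Big)\Big]+\widehat\rho_0(\delta).$$ **Values.** For $n\in\mathbb N\cup\{\infty\}$, $V^n_t(\omega)=\inf_{\mathbb P\in\mathcal P(t,\omega)}\inf_{\gamma\in\mathcal T^t}\sup_{\tau\in\mathcal T^t(n)}\mathbb E_{\mathbb P}[R^{t,\omega}(\tau,\gamma)]$. **Path-continuity of values.** There is a modulus of continuity function $\rho_1\ge\rho_0$ such that $|V^n_t(\omega_1)-V^n_t(\omega_2)|\le\rho_1(\|\omega_1-\omega_2\|_{0,t})$ for all $n\in\mathbb N\cup\{\infty\}$, $t\in[0,T]$, $\omega_1,\omega_2\in\Omega$. *)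

theory Defs
  imports "HOL-Probability.Probability" "HOL-Probability.Stopping_Time" "HOL-Library.Extended_Nat"
begin

section \<open>Canonical path spaces\<close>

type_synonym 'd path = "real \<Rightarrow> real ^ 'd"

definition modulus_of_continuity :: "(real \<Rightarrow> real) \<Rightarrow> bool" where
  "modulus_of_continuity \<rho> \<longleftrightarrow>
     (\<forall>x\<ge>0. 0 \<le> \<rho> x) \<and> mono_on {0..} \<rho> \<and> \<rho> 0 = 0 \<and> (\<rho> \<longlongrightarrow> 0) (at_right 0)"

text \<open>A path on the interval from \<open>t\<close> to \<open>T\<close> is a function that is \<open>undefined\<close> off that
  interval, so that equality of paths is equality on the interval.\<close>

definition paths :: "real \<Rightarrow> real \<Rightarrow> ('d::finite) path set" where
  "paths T t = {w \<in> extensional {t..T}. continuous_on {t..T} w \<and> w t = 0}"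

definition null_path :: "real \<Rightarrow> ('d::finite) path" where
  "null_path T = restrict (\<lambda>_. 0) {0..T}"

definition sup_norm :: "real \<Rightarrow> real \<Rightarrow> ('d::finite) path \<Rightarrow> real" where
  "sup_norm t s w = (SUP r\<in>{t..s}. norm (w r))"

definition path_ball :: "real \<Rightarrow> real \<Rightarrow> real \<Rightarrow> real \<Rightarrow> ('d::finite) path \<Rightarrow> 'd path set" where
  "path_ball T t s \<delta> w = {w' \<in> paths T t. sup_norm t s (\<lambda>r. w' r - w r) < \<delta>}"

text \<open>The raw filtration. It is indexed by all real \<open>s\<close>: it is trivial for \<open>s < t\<close>, and
  constant for \<open>s \<ge> T\<close>, because all paths have the same value at a point beyond \<open>T\<close>.\<close>

definition raw_filtration :: "real \<Rightarrow> real \<Rightarrow> real \<Rightarrow> ('d::finite) path measure" where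
  "raw_filtration T t s =
     sigma (paths T t) {(\<lambda>w. w r) -` A \<inter> paths T t | r A. r \<in> {t..s} \<and> A \<in> sets borel}"

definition stopping_times :: "real \<Rightarrow> real \<Rightarrow> (('d::finite) path \<Rightarrow> real) set" where
  "stopping_times T t =
     {\<tau>. stopping_time (raw_filtration T t) \<tau> \<and> (\<forall>w\<in>paths T t. \<tau> w \<in> {t..T})}"

text \<open>The index \<open>\<infinity>\<close> stands for no restriction on the values.\<close>

definition stopping_times_n :: "real \<Rightarrow> real \<Rightarrow> enat \<Rightarrow> (('d::finite) path \<Rightarrow> real) set" where
  "stopping_times_n T t n = {\<tau> \<in> stopping_times T t.
     case n of
       enat k \<Rightarrow> \<forall>w\<in>paths T t. \<tau> w \<in> (\<lambda>i. max t (real i * T / 2 ^ k)) ` {0..2 ^ k}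
     | \<infinity> \<Rightarrow> True}"

definition stopping_times_from ::
  "real \<Rightarrow> real \<Rightarrow> real \<Rightarrow> enat \<Rightarrow> (('d::finite) path \<Rightarrow> real) set" where
  "stopping_times_from T t s n = {\<tau> \<in> stopping_times_n T t n. \<forall>w\<in>paths T t. s \<le> \<tau> w}"

definition path_probs :: "real \<Rightarrow> real \<Rightarrow> ('d::finite) path measure set" where
  "path_probs T t = {P. prob_space P \<and> sets P = sets (raw_filtration T t T)}"

text \<open>\<open>S_space T t P\<close>: continuous adapted processes whose running supremum is \<open>P\<close>-integrable.\<close>

definition S_space ::
  "real \<Rightarrow> real \<Rightarrow> ('d::finite) path measure \<Rightarrow> (real \<Rightarrow> 'd path \<Rightarrow> real) set" where
  "S_space T t P = {X.
     (\<forall>s\<in>{t..T}. X s \<in> borel_measurable (raw_filtration T t s)) \<and>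
     (\<forall>w\<in>paths T t. continuous_on {t..T} (\<lambda>s. X s w)) \<and>
     (\<integral>\<^sup>+ w. (SUP s\<in>{t..T}. ennreal \<bar>X s w\<bar>) \<partial>P) < \<infinity>}"

section \<open>Shifts\<close>

text \<open>\<open>splice T t s w v\<close> concatenates at time \<open>s\<close> the path \<open>w\<close>, which starts at time \<open>t\<close>, and
  the path \<open>v\<close>, which starts at time \<open>s\<close>.\<close>

definition splice :: "real \<Rightarrow> real \<Rightarrow> real \<Rightarrow> ('d::finite) path \<Rightarrow> 'd path \<Rightarrow> 'd path" where
  "splice T t s w v = restrict (\<lambda>r. if r < s then w r else w s + v r) {t..T}"

definition shift_process ::
  "real \<Rightarrow> real \<Rightarrow> real \<Rightarrow> ('d::finite) path \<Rightarrow> (real \<Rightarrow> 'd path \<Rightarrow> real) \<Rightarrow> real \<Rightarrow> 'd path \<Rightarrow> real" where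
  "shift_process T t s w X r v = X r (splice T t s w v)"

text \<open>\<open>\<kappa>\<close> is a version of the regular conditional probability distribution of \<open>P\<close> given the
  \<open>\<sigma>\<close>-algebra at time \<open>s\<close>, under which every path \<open>w\<close> is almost surely followed up to time \<open>s\<close>.
  An \<open>emeasure\<close> that equals 1 forces its argument to be measurable.\<close>

definition is_rcpd ::
  "real \<Rightarrow> real \<Rightarrow> real \<Rightarrow> ('d::finite) path measure \<Rightarrow> ('d path \<Rightarrow> 'd path measure) \<Rightarrow> bool" where
  "is_rcpd T t s P \<kappa> \<longleftrightarrow>
     (\<forall>w\<in>paths T t. \<kappa> w \<in> path_probs T t) \<and>
     (\<forall>A\<in>sets (raw_filtration T t T).
        (\<lambda>w. measure (\<kappa> w) A) \<in> borel_measurable (raw_filtration T t s) \<and>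
        (AE w in P. measure (\<kappa> w) A = real_cond_exp P (raw_filtration T t s) (indicator A) w)) \<and>
     (\<forall>w\<in>paths T t. emeasure (\<kappa> w) (splice T t s w ` paths T s) = 1)"

text \<open>The shifted conditional probability, for a given version \<open>\<kappa>\<close> of the regular conditional
  probability distribution.\<close>

definition shifted_rcpd ::
  "real \<Rightarrow> real \<Rightarrow> real \<Rightarrow> (('d::finite) path \<Rightarrow> 'd path measure) \<Rightarrow> 'd path \<Rightarrow> 'd path measure" where
  "shifted_rcpd T t s \<kappa> w =
     measure_of (paths T s) (sets (raw_filtration T s T))
       (\<lambda>A. emeasure (\<kappa> w) (splice T t s w ` A))"

section \<open>Payoffs and values\<close>

definition Psi ::
  "(real \<Rightarrow> ('d::finite) path \<Rightarrow> real) \<Rightarrow> (real \<Rightarrow> 'd path \<Rightarrow> real) \<Rightarrow> real \<Rightarrow> 'd path \<Rightarrow> real" where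
  "Psi L U t w = max (max (- L t w) (U t w)) 0"

definition payoff ::
  "real \<Rightarrow> (real \<Rightarrow> ('d::finite) path \<Rightarrow> real) \<Rightarrow> (real \<Rightarrow> 'd path \<Rightarrow> real) \<Rightarrow> (real \<Rightarrow> 'd path \<Rightarrow> real)
   \<Rightarrow> real \<Rightarrow> 'd path \<Rightarrow> ('d path \<Rightarrow> real) \<Rightarrow> ('d path \<Rightarrow> real) \<Rightarrow> 'd path \<Rightarrow> real" where
  "payoff T g L U t w \<tau> \<gamma> v =
     (LINT s:{t..min (\<tau> v) (\<gamma> v)}|lborel. shift_process T 0 t w g s v) +
     (if \<tau> v \<le> \<gamma> v then shift_process T 0 t w L (\<tau> v) v
      else shift_process T 0 t w U (\<gamma> v) v)"

text \<open>Under the standing assumptions all the integrals below exist, and the suprema and infima are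
  finite (bounded below by the payoff for \<open>\<tau> = t\<close>), so real-valued operations suffice.\<close>

definition game_value ::
  "real \<Rightarrow> (real \<Rightarrow> ('d::finite) path \<Rightarrow> real) \<Rightarrow> (real \<Rightarrow> 'd path \<Rightarrow> real) \<Rightarrow> (real \<Rightarrow> 'd path \<Rightarrow> real)
   \<Rightarrow> (real \<Rightarrow> 'd path \<Rightarrow> 'd path measure set) \<Rightarrow> enat \<Rightarrow> real \<Rightarrow> 'd path \<Rightarrow> real" where
  "game_value T g L U \<P> n t w =
     (INF P\<in>\<P> t w. INF \<gamma>\<in>stopping_times T t. SUP \<tau>\<in>stopping_times_n T t n.
        (\<integral>v. payoff T g L U t w \<tau> \<gamma> v \<partial>P))"

section \<open>Standing assumptions\<close>

definition payoff_regular ::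
  "real \<Rightarrow> (real \<Rightarrow> ('d::finite) path \<Rightarrow> real) \<Rightarrow> (real \<Rightarrow> 'd path \<Rightarrow> real) \<Rightarrow> (real \<Rightarrow> 'd path \<Rightarrow> real)
   \<Rightarrow> (real \<Rightarrow> real) \<Rightarrow> bool" where
  "payoff_regular T g L U \<rho>0 \<longleftrightarrow>
     modulus_of_continuity \<rho>0 \<and>
     (\<forall>t\<in>{0..T}. \<forall>w\<in>paths T 0. L t w \<le> U t w) \<and>
     (\<forall>X\<in>{g, L, U}. \<forall>t1\<in>{0..T}. \<forall>t2\<in>{0..T}. \<forall>w1\<in>paths T 0. \<forall>w2\<in>paths T 0.
        \<bar>X t1 w1 - X t2 w2\<bar>
          \<le> \<rho>0 (\<bar>t1 - t2\<bar> + sup_norm 0 T (\<lambda>r. w1 (min r t1) - w2 (min r t2))))"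

definition integrable_probs ::
  "real \<Rightarrow> (real \<Rightarrow> ('d::finite) path \<Rightarrow> real) \<Rightarrow> (real \<Rightarrow> 'd path \<Rightarrow> real) \<Rightarrow> (real \<Rightarrow> 'd path \<Rightarrow> real)
   \<Rightarrow> real \<Rightarrow> 'd path measure set" where
  "integrable_probs T g L U t = {P \<in> path_probs T t.
     shift_process T 0 t (null_path T) (Psi L U) \<in> S_space T t P \<and>
     (\<integral>\<^sup>+ v. (\<integral>\<^sup>+ s\<in>{t..T}. ennreal \<bar>shift_process T 0 t (null_path T) g s v\<bar> \<partial>lborel) \<partial>P) < \<infinity>}"

definition integrability_condition ::
  "real \<Rightarrow> (real \<Rightarrow> ('d::finite) path \<Rightarrow> real) \<Rightarrow> (real \<Rightarrow> 'd path \<Rightarrow> real) \<Rightarrow> (real \<Rightarrow> 'd path \<Rightarrow> real)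
   \<Rightarrow> bool" where
  "integrability_condition T g L U \<longleftrightarrow> (\<forall>t\<in>{0..T}. integrable_probs T g L U t \<noteq> {})"

definition adapted_class ::
  "real \<Rightarrow> (real \<Rightarrow> ('d::finite) path \<Rightarrow> real) \<Rightarrow> (real \<Rightarrow> 'd path \<Rightarrow> real) \<Rightarrow> (real \<Rightarrow> 'd path \<Rightarrow> real)
   \<Rightarrow> (real \<Rightarrow> 'd path \<Rightarrow> 'd path measure set) \<Rightarrow> bool" where
  "adapted_class T g L U \<P> \<longleftrightarrow>
     (\<forall>t\<in>{0..T}. \<forall>w\<in>paths T 0. \<P> t w \<noteq> {} \<and> \<P> t w \<subseteq> integrable_probs T g L U t) \<and>
     (\<forall>t\<in>{0..T}. \<forall>w1\<in>paths T 0. \<forall>w2\<in>paths T 0. (\<forall>r\<in>{0..t}. w1 r = w2 r) \<longrightarrow> \<P> t w1 = \<P> t w2)"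

text \<open>A regular conditional probability distribution is determined up to a \<open>P\<close>-null set, which can
  be removed from \<open>\<Omega>'\<close>; hence the condition does not depend on the version \<open>\<kappa>\<close>.\<close>

definition stable_under_conditioning ::
  "real \<Rightarrow> (real \<Rightarrow> ('d::finite) path \<Rightarrow> 'd path measure set) \<Rightarrow> bool" where
  "stable_under_conditioning T \<P> \<longleftrightarrow>
     (\<forall>t s. \<forall>w\<in>paths T 0. \<forall>P\<in>\<P> t w. 0 \<le> t \<longrightarrow> t < s \<longrightarrow> s \<le> T \<longrightarrow>
        (\<exists>\<kappa> P' \<Omega>'. is_rcpd T t s P \<kappa> \<and>
           prob_space P' \<and> space P' = paths T t \<and> sets P \<subseteq> sets P' \<and>
           (\<forall>A\<in>sets P. emeasure P' A = emeasure P A) \<and>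
           \<Omega>' \<in> sets P' \<and> emeasure P' \<Omega>' = 1 \<and>
           (\<forall>v\<in>\<Omega>'. shifted_rcpd T t s \<kappa> v \<in> \<P> s (splice T 0 t w v))))"

text \<open>\<open>n\<close> and \<open>l\<close> range over indices at least 1. Blocks of a partition may be empty.\<close>

definition weakly_stable_under_pasting ::
  "real \<Rightarrow> (real \<Rightarrow> ('d::finite) path \<Rightarrow> real) \<Rightarrow> (real \<Rightarrow> 'd path \<Rightarrow> real) \<Rightarrow> (real \<Rightarrow> 'd path \<Rightarrow> real)
   \<Rightarrow> (real \<Rightarrow> 'd path \<Rightarrow> 'd path measure set) \<Rightarrow> bool" where
  "weakly_stable_under_pasting T g L U \<P> \<longleftrightarrow>
     (\<exists>\<rho>h. modulus_of_continuity \<rho>h \<and>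
       (\<forall>t s \<delta>. \<forall>w\<in>paths T 0. \<forall>P\<in>\<P> t w.
          \<forall>l::nat. \<forall>\<A> :: nat \<Rightarrow> 'd path set. \<forall>\<delta>s :: nat \<Rightarrow> real.
          \<forall>ws :: nat \<Rightarrow> 'd path. \<forall>Q :: nat \<Rightarrow> 'd path measure.
          0 \<le> t \<longrightarrow> t < s \<longrightarrow> s \<le> T \<longrightarrow> 0 < \<delta> \<longrightarrow> \<delta> \<in> \<rat> \<longrightarrow> 1 \<le> l \<longrightarrow>
          (\<forall>j\<in>{0..l}. \<A> j \<in> sets (raw_filtration T t s)) \<longrightarrow>
          disjoint_family_on \<A> {0..l} \<longrightarrow> (\<Union>j\<in>{0..l}. \<A> j) = paths T t \<longrightarrow>
          (\<forall>j\<in>{1..l}. \<delta>s j \<in> ({0<..\<delta>} \<inter> \<rat>) \<union> {\<delta>} \<and> ws j \<in> paths T t \<and>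
             \<A> j \<subseteq> path_ball T t s (\<delta>s j) (ws j) \<and> Q j \<in> \<P> s (splice T 0 t w (ws j))) \<longrightarrow>
          (\<exists>Ph\<in>\<P> t w.
             (\<forall>A\<in>sets (raw_filtration T t T). emeasure Ph (A \<inter> \<A> 0) = emeasure P (A \<inter> \<A> 0)) \<and>
             (\<forall>j\<in>{1..l}. \<forall>A\<in>sets (raw_filtration T t s).
                emeasure Ph (A \<inter> \<A> j) = emeasure P (A \<inter> \<A> j)) \<and>
             (\<forall>n::enat. 1 \<le> n \<longrightarrow> (\<forall>p\<in>stopping_times T s.
                \<exists>q :: nat \<Rightarrow> 'd path \<Rightarrow> real.
                  (\<forall>j\<in>{1..l}. q j \<in> stopping_times_from T t s \<infinity>) \<and>
                  (\<forall>A\<in>sets (raw_filtration T t s). \<forall>\<tau>\<in>stopping_times_from T t s n.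
                     (\<Sum>j=1..l. \<integral>v. indicator (A \<inter> \<A> j) v * payoff T g L U t w \<tau> (q j) v \<partial>Ph)
                     \<le> (\<Sum>j=1..l. \<integral>v. indicator (A \<inter> \<A> j) v *
                           ((SUP \<sigma>\<in>stopping_times_n T s n.
                               \<integral>u. payoff T g L U s (splice T 0 t w v) \<sigma> p u \<partial>Q j)
                            + (LINT r:{t..s}|lborel. shift_process T 0 t w g r v)) \<partial>P)
                       + \<rho>h \<delta>))))))"

definition path_continuous_values ::
  "real \<Rightarrow> (real \<Rightarrow> ('d::finite) path \<Rightarrow> real) \<Rightarrow> (real \<Rightarrow> 'd path \<Rightarrow> real) \<Rightarrow> (real \<Rightarrow> 'd path \<Rightarrow> real)
   \<Rightarrow> (real \<Rightarrow> 'd path \<Rightarrow> 'd path measure set) \<Rightarrow> (real \<Rightarrow> real) \<Rightarrow> bool" where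
  "path_continuous_values T g L U \<P> \<rho>0 \<longleftrightarrow>
     (\<exists>\<rho>1. modulus_of_continuity \<rho>1 \<and> (\<forall>x\<ge>0. \<rho>0 x \<le> \<rho>1 x) \<and>
       (\<forall>n::enat. 1 \<le> n \<longrightarrow> (\<forall>t\<in>{0..T}. \<forall>w1\<in>paths T 0. \<forall>w2\<in>paths T 0.
          \<bar>game_value T g L U \<P> n t w1 - game_value T g L U \<P> n t w2\<bar>
            \<le> \<rho>1 (sup_norm 0 t (\<lambda>r. w1 r - w2 r)))))"

end

theory Submission
  imports Defs
begin

text \<open>
  Fix \<open>P \<in> \<P> t w\<close>, \<open>\<gamma>\<close> and \<open>\<epsilon> > 0\<close>. For every path \<open>v\<close> choose a near-optimal measure and
  stopping time for the game that starts at time \<open>s\<close> from the spliced path, partition \<open>{\<gamma> \<ge> s}\<close>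
  into small blocks, and paste the choices made at one point of each block: the pasted pair is
  nearly as good as stopping at \<open>s\<close> with payoff \<open>V s\<close>.

  The pasting condition admits only one stopping time for all blocks, so it has to be applied once
  for each stopping time in use, and each application costs the error \<open>\<rho>h \<delta>\<close>. The number of
  different stopping times must therefore not depend on the mesh \<open>\<delta>\<close> of the partition. This is
  arranged by taking all of them from one countable family that is near-optimal against every
  measure: stopping times with values on a grid whose level sets lie in countable algebras that
  generate the filtration. A delay of at most \<open>h\<close> of the stopping time of the minimising player
  raises the payoff by at most the oscillation of \<open>a \<mapsto> \<integral> g + U a\<close> over \<open>h\<close>, which is why
  approximation from above suffices. Up to a set of small measure only finitely many members,
  say the first \<open>M\<close>, are used; then \<open>\<delta>\<close> is chosen with \<open>M * \<rho>h \<delta> \<le> \<epsilon>\<close>.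
\<close>

section \<open>Measure-theoretic preliminaries\<close>

text \<open>Besides the repeated error \<open>\<rho>h \<delta>\<close> the obstacle is
  measurability. The measure and the index picked for a path come from the axiom of choice, while
  the blocks of a partition must be events at time \<open>s\<close>. So the set of paths with index
  below \<open>M\<close> is enlarged to its closure, a countable intersection of unions of small
  cells known at time \<open>s\<close>. Every cell that meets the closure contains a path with index
  below \<open>M\<close>, and passing from that path to the others in the cell costs only the moduli
  \<open>\<rho>0\<close> and \<open>\<rho>1\<close>. The same cells show that each sigma-algebra of
  the raw filtration is countably generated, which the countable family of stopping times rests on.

  The maximising player may also stop before \<open>s\<close>, where the pasting inequality is
  silent. On a pasted block this happens on an event known at \<open>s\<close>, and the payoff there
  is known at \<open>s\<close> as well, because the minimising player stops at \<open>s\<close> or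
  later. The agreement of the pasted measure with \<open>P\<close> at time \<open>s\<close> then
  settles this part, and the inequality is applied to the rest only.\<close>

lemma countable_generated_algebra:
  assumes "countable G" "G \<subseteq> Pow \<Omega>"
  shows "\<exists>A. countable A \<and> algebra \<Omega> A \<and> G \<subseteq> A \<and> A \<subseteq> sigma_sets \<Omega> G"
proof -
  \<comment> \<open>One round of closing under complements and binary unions. Countably many rounds
    preserve countability, and the union of all rounds is an algebra because any two members already
    occur in a common round.\<close>
  define step where "step S = S \<union> (\<lambda>a. \<Omega> - a) ` S \<union> (\<lambda>(a, b). a \<union> b) ` (S \<times> S)" for S
  define A where "A n = (step ^^ n) (insert {} G)" for n
  have A_Suc: "A (Suc n) = step (A n)" for n by (simp add: A_def)
  have cnt: "countable (A n)" for n
    by (induction n) (use assms in \<open>auto simp: A_def step_def\<close>)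
  have sub: "A n \<subseteq> sigma_sets \<Omega> G" for n
  proof (induction n)
    case 0
    then show ?case by (auto simp: A_def intro: sigma_sets.intros)
  next
    case (Suc n)
    then show ?case
      unfolding A_Suc step_def by (auto intro!: sigma_sets.Compl sigma_sets_Un)
  qed
  have mono: "m \<le> n \<Longrightarrow> A m \<subseteq> A n" for m n
    by (rule lift_Suc_mono_le[of A]) (auto simp: A_Suc step_def)
  have "algebra \<Omega> (\<Union>n. A n)"
    unfolding algebra_iff_Un
  proof (intro conjI ballI)
    show "(\<Union>n. A n) \<subseteq> Pow \<Omega>"
      using sub sigma_sets_into_sp[OF assms(2)] by blast
    show "{} \<in> (\<Union>n. A n)" by (auto simp: A_def intro!: exI[of _ 0])
    fix a assume "a \<in> (\<Union>n. A n)"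
    then obtain m where m: "a \<in> A m" by auto
    then have "\<Omega> - a \<in> A (Suc m)" by (auto simp: A_Suc step_def)
    then show "\<Omega> - a \<in> (\<Union>n. A n)" by blast
    fix b assume "b \<in> (\<Union>n. A n)"
    then obtain k where k: "b \<in> A k" by auto
    have "a \<in> A (max m k)" "b \<in> A (max m k)"
      using m k mono[of m "max m k"] mono[of k "max m k"] by auto
    then have "a \<union> b \<in> A (Suc (max m k))" by (auto simp: A_Suc step_def)
    then show "a \<union> b \<in> (\<Union>n. A n)" by blast
  qed
  moreover have "G \<subseteq> (\<Union>n. A n)" by (auto simp: A_def intro!: exI[of _ 0])
  ultimately show ?thesis using cnt sub by (intro exI[of _ "\<Union>n. A n"]) auto
qed

text \<open>The sets that can be approximated by \<open>A\<close> are closed under complements and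
  countable unions, so induction over \<open>sigma_sets\<close> applies. It will replace level sets
  of stopping times by members of countable algebras.\<close>

lemma (in finite_measure) approx_by_algebra:
  assumes alg: "algebra (space M) A" and sub: "A \<subseteq> sets M"
    and B: "B \<in> sigma_sets (space M) A" and "0 < e"
  shows "\<exists>a\<in>A. measure M ((a - B) \<union> (B - a)) < e"
  using B \<open>0 < e\<close>
proof (induction arbitrary: e)
  case (Basic a)
  then show ?case by (auto intro!: bexI[of _ a])
next
  case Empty
  interpret algebra "space M" A by fact
  show ?case using Empty by (auto intro!: bexI[of _ "{}"])
next
  case (Compl B)
  interpret algebra "space M" A by fact
  obtain a where a: "a \<in> A" "measure M ((a - B) \<union> (B - a)) < e" using Compl by blast
  have "B \<subseteq> space M" using Compl.hyps sigma_sets_into_sp[OF space_closed] by blast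
  then have "((space M - a) - (space M - B)) \<union> ((space M - B) - (space M - a)) = (a - B) \<union> (B - a)"
    using a sets_into_space by auto
  then show ?case using a by (intro bexI[of _ "space M - a"]) auto
next
  case (Union B)
  interpret A: algebra "space M" A by fact
  have sgm: "sigma_sets (space M) A \<subseteq> sets M" by (rule sets.sigma_sets_subset[OF sub])
  have Bm: "B i \<in> sets M" for i using Union.hyps sgm by auto
  \<comment> \<open>\<open>D n\<close> is what the first \<open>n\<close> sets miss of the union.
    Once it is small, a finite union of approximations suffices, and an algebra contains it.\<close>
  define D where "D n = (\<Union>i. B i) - (\<Union>i<n. B i)" for n :: nat
  have Dm: "D n \<in> sets M" for n using Bm by (auto simp: D_def)
  have "(\<lambda>n. measure M (D n)) \<longlonglongrightarrow> measure M (\<Inter>n. D n)"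
    by (intro finite_Lim_measure_decseq) (use Dm in \<open>auto simp: D_def decseq_def\<close>)
  moreover have "(\<Inter>n. D n) = {}" by (auto simp: D_def)
  ultimately have "(\<lambda>n. measure M (D n)) \<longlonglongrightarrow> 0" by simp
  then have "\<forall>\<^sub>F n in sequentially. measure M (D n) < e / 2"
    using Union.prems by (intro order_tendstoD) auto
  then obtain n where n: "measure M (D n) < e / 2" by (auto simp: eventually_sequentially)
  \<comment> \<open>Half of \<open>e\<close> goes to the tail, the other half to the
    \<open>n\<close> approximations; \<open>n + 1\<close> keeps the denominator positive for
    \<open>n = 0\<close>.\<close>
  have "\<exists>a\<in>A. measure M ((a - B i) \<union> (B i - a)) < e / (2 * (real n + 1))" for i
    using Union.IH Union.prems by simp
  then obtain a where a: "\<And>i. a i \<in> A"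
    "\<And>i. measure M ((a i - B i) \<union> (B i - a i)) < e / (2 * (real n + 1))" by metis
  have am: "a i \<in> sets M" for i using a sub by auto
  let ?a = "\<Union>i<n. a i"
  have "measure M ((?a - (\<Union>i. B i)) \<union> ((\<Union>i. B i) - ?a))
      \<le> measure M (D n \<union> (\<Union>i<n. (a i - B i) \<union> (B i - a i)))"
    using am Bm Dm by (intro finite_measure_mono) (auto simp: D_def)
  also have "\<dots> \<le> measure M (D n) + measure M (\<Union>i<n. (a i - B i) \<union> (B i - a i))"
    using am Bm Dm by (intro measure_subadditive) auto
  also have "measure M (\<Union>i<n. (a i - B i) \<union> (B i - a i))
      \<le> (\<Sum>i<n. measure M ((a i - B i) \<union> (B i - a i)))"
    using am Bm by (intro finite_measure_subadditive_finite) auto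
  also have "\<dots> \<le> (\<Sum>i<n. e / (2 * (real n + 1)))"
    by (intro sum_mono less_imp_le a)
  also have "\<dots> \<le> e / 2" using Union.prems by (simp add: field_simps)
  finally have "measure M ((?a - (\<Union>i. B i)) \<union> ((\<Union>i. B i) - ?a)) < e" using n by simp
  moreover have "?a \<in> A" using a by (intro A.finite_UN) auto
  ultimately show ?case by blast
qed

text \<open>Rounding \<open>\<tau>\<close> up to a grid of mesh \<open>1 / (k + 1)\<close>, capped
  at \<open>b\<close>, gives times with countably many values, and continuity in time lets the
  sampled values converge. Applied with \<open>b = s\<close> it yields measurability already at time
  \<open>s\<close>.\<close>

lemma borel_measurable_eval_process:
  fixes X :: "real \<Rightarrow> 'a \<Rightarrow> real"
  assumes X: "\<And>r. r \<in> {a..b} \<Longrightarrow> X r \<in> borel_measurable M"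
    and cont: "\<And>v. v \<in> space M \<Longrightarrow> continuous_on {a..b} (\<lambda>r. X r v)"
    and \<tau>[measurable]: "\<tau> \<in> borel_measurable M" and \<tau>_in: "\<And>v. v \<in> space M \<Longrightarrow> \<tau> v \<in> {a..b}"
  shows "(\<lambda>v. X (\<tau> v) v) \<in> borel_measurable M"
proof (cases "a \<le> b")
  case False
  then have "space M = {}" using \<tau>_in by force
  then show ?thesis by (simp add: measurable_def)
next
  case True
  define c where "c k v = nat \<lceil>(\<tau> v - a) * (real k + 1)\<rceil>" for k v
  define h where "h k i = min b (a + real i / (real k + 1))" for k i :: nat
  have h_in: "h k i \<in> {a..b}" for k i using True by (auto simp: h_def)
  show ?thesis
  proof (rule borel_measurable_LIMSEQ_real)
    fix k
    have "c k \<in> M \<rightarrow>\<^sub>M count_space UNIV" unfolding c_def by measurable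
    then show "(\<lambda>v. X (h k (c k v)) v) \<in> borel_measurable M"
      by (intro measurable_compose_countable[where f="\<lambda>i v. X (h k i) v" and g="c k"] X h_in)
  next
    fix v assume v: "v \<in> space M"
    have bd: "\<bar>h k (c k v) - \<tau> v\<bar> \<le> 1 / (real k + 1)" for k
    proof -
      let ?x = "(\<tau> v - a) * (real k + 1)"
      have x: "0 \<le> ?x" using \<tau>_in[OF v] by auto
      have c: "?x \<le> real (c k v)" "real (c k v) < ?x + 1"
        using x unfolding c_def by linarith+
      have "\<tau> v - a \<le> real (c k v) / (real k + 1)"
        using c(1) by (simp add: pos_le_divide_eq)
      moreover have "real (c k v) / (real k + 1) \<le> (?x + 1) / (real k + 1)"
        using c(2) by (intro divide_right_mono) auto
      moreover have "(?x + 1) / (real k + 1) = \<tau> v - a + 1 / (real k + 1)"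
        by (simp add: add_divide_distrib)
      ultimately show ?thesis using \<tau>_in[OF v] by (auto simp: h_def min_def abs_le_iff)
    qed
    have "(\<lambda>k. 1 / (real k + 1)) \<longlonglongrightarrow> 0"
      using LIMSEQ_inverse_real_of_nat by (simp add: field_simps)
    then have "(\<lambda>k. h k (c k v) - \<tau> v) \<longlonglongrightarrow> 0"
      by (rule Lim_null_comparison[rotated]) (use bd in auto)
    then have "(\<lambda>k. h k (c k v)) \<longlonglongrightarrow> \<tau> v" by (simp add: LIM_zero_iff)
    then show "(\<lambda>k. X (h k (c k v)) v) \<longlonglongrightarrow> X (\<tau> v) v"
      using cont[OF v] \<tau>_in[OF v] h_in by (auto simp: continuous_on_sequentially o_def)
  qed
qed

text \<open>Restricted to \<open>B\<close> and to the sigma-algebra of \<open>F\<close>, the two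
  measures are the same measure, so the integrals agree whether or not \<open>f\<close> is
  integrable. This turns the agreement clauses of the pasting condition, each about one block and
  one sigma-algebra, into equalities of integrals.\<close>

lemma integral_indicator_cong_subalgebra:
  fixes f :: "'a \<Rightarrow> real"
  assumes "sets M = sets N" and sub: "subalgebra M F" and B: "B \<in> sets F"
    and eq: "\<And>A. A \<in> sets F \<Longrightarrow> emeasure M (A \<inter> B) = emeasure N (A \<inter> B)"
    and f[measurable]: "f \<in> borel_measurable F"
  shows "(\<integral>x. indicator B x * f x \<partial>M) = (\<integral>x. indicator B x * f x \<partial>N)"
proof -
  have subN: "subalgebra N F"
    using sub assms(1) sets_eq_imp_space_eq[OF assms(1)] by (auto simp: subalgebra_def)
  have g: "(\<lambda>x. indicator B x * f x) \<in> borel_measurable F" using B by measurable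
  have *: "(\<integral>x. indicator B x * f x \<partial>K) = (\<integral>x. f x \<partial>restrict_space (restr_to_subalg K F) B)"
    if "subalgebra K F" for K
  proof -
    have "B \<inter> space (restr_to_subalg K F) \<in> sets (restr_to_subalg K F)"
      using B that by (auto simp: sets_restr_to_subalg space_restr_to_subalg subalgebra_def)
    then show ?thesis
      using integral_subalgebra2[OF that g] by (subst integral_restrict_space) auto
  qed
  have "restrict_space (restr_to_subalg M F) B = restrict_space (restr_to_subalg N F) B"
  proof (rule measure_eqI)
    show "sets (restrict_space (restr_to_subalg M F) B) = sets (restrict_space (restr_to_subalg N F) B)"
      by (simp add: sets_restrict_space sets_restr_to_subalg sub subN)
    fix A assume "A \<in> sets (restrict_space (restr_to_subalg M F) B)"
    then obtain C where C: "C \<in> sets F" "A = C \<inter> B"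
      by (auto simp: sets_restrict_space sets_restr_to_subalg sub)
    then have "A \<in> sets F" using B by auto
    moreover have "B \<subseteq> space F" using B by (rule sets.sets_into_space)
    ultimately show "emeasure (restrict_space (restr_to_subalg M F) B) A
        = emeasure (restrict_space (restr_to_subalg N F) B) A"
      using C B eq[OF C(1)] sub subN
      by (subst (1 2) emeasure_restrict_space)
        (auto simp: emeasure_restr_to_subalg sets_restr_to_subalg space_restr_to_subalg subalgebra_def Int_absorb2)
  qed
  then show ?thesis using *[OF sub] *[OF subN] by simp
qed

section \<open>The canonical path space\<close>

lemma space_raw_filtration [simp]: "space (raw_filtration T t s) = paths T t"
  unfolding raw_filtration_def by (rule space_measure_of) auto

lemma sets_raw_filtration:
  "sets (raw_filtration T t s) =
    sigma_sets (paths T t) {(\<lambda>w. w r) -` A \<inter> paths T t | r A. r \<in> {t..s} \<and> A \<in> sets borel}"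
  unfolding raw_filtration_def by (rule sets_measure_of) auto

lemma sets_raw_filtration_mono:
  "s \<le> s' \<Longrightarrow> sets (raw_filtration T t s) \<subseteq> sets (raw_filtration T t s')"
  unfolding sets_raw_filtration by (rule sigma_sets_mono') force

lemma borel_measurable_raw_filtration_mono:
  "f \<in> borel_measurable (raw_filtration T t s) \<Longrightarrow> s \<le> s' \<Longrightarrow>
    f \<in> borel_measurable (raw_filtration T t s')"
  using sets_raw_filtration_mono[of s s' T t] by (auto simp: measurable_def)

lemma borel_measurable_coordinate:
  assumes "r \<in> {t..s}"
  shows "(\<lambda>v. v r) \<in> borel_measurable (raw_filtration T t s)"
proof (rule measurableI)
  fix A :: "(real ^ 'b) set" assume "A \<in> sets borel"
  then show "(\<lambda>v. v r) -` A \<inter> space (raw_filtration T t s) \<in> sets (raw_filtration T t s)"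
    using assms by (auto simp: sets_raw_filtration)
qed auto

lemma path_probsD:
  assumes "P \<in> path_probs T t"
  shows "prob_space P" "space P = paths T t" "sets P = sets (raw_filtration T t T)"
  using assms sets_eq_imp_space_eq[of P "raw_filtration T t T"] by (auto simp: path_probs_def)

text \<open>Levels below \<open>t\<close> give the empty set and levels from \<open>T\<close> on the
  whole space; only those in between carry information.\<close>

lemma stopping_timesI:
  assumes "\<And>r. t \<le> r \<Longrightarrow> r < T \<Longrightarrow> {v \<in> paths T t. \<tau> v \<le> r} \<in> sets (raw_filtration T t r)"
    and "\<And>v. v \<in> paths T t \<Longrightarrow> \<tau> v \<in> {t..T}"
  shows "\<tau> \<in> stopping_times T t"
proof -
  have "{v \<in> paths T t. \<tau> v \<le> r} \<in> sets (raw_filtration T t r)" for r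
  proof -
    consider "r < t" | "T \<le> r" | "t \<le> r" "r < T" by linarith
    then show ?thesis
    proof cases
      case 1
      then have empty: "{v \<in> paths T t. \<tau> v \<le> r} = {}" using assms(2) by force
      show ?thesis unfolding empty by simp
    next
      case 2
      then have "{v \<in> paths T t. \<tau> v \<le> r} = space (raw_filtration T t r)" using assms(2) by force
      then show ?thesis by (simp only: sets.top)
    qed (use assms in auto)
  qed
  then show ?thesis using assms(2)
    by (auto simp: stopping_times_def stopping_time_def pred_def)
qed

lemma stopping_times_le:
  assumes "\<tau> \<in> stopping_times T t" "r \<le> s"
  shows "{v \<in> paths T t. \<tau> v \<le> r} \<in> sets (raw_filtration T t s)"
  using assms sets_raw_filtration_mono[of r s]
  by (auto simp: stopping_times_def stopping_time_def pred_def)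

lemma stopping_times_in:
  "\<tau> \<in> stopping_times T t \<Longrightarrow> v \<in> paths T t \<Longrightarrow> \<tau> v \<in> {t..T}"
  by (auto simp: stopping_times_def)

text \<open>A level \<open>r < s\<close> of the capped time is the event
  \<open>\<tau> \<le> r\<close>, known at \<open>r\<close>; every level from \<open>s\<close> on is
  the whole space.\<close>

lemma borel_measurable_min_stopping_time:
  assumes "\<tau> \<in> stopping_times T t"
  shows "(\<lambda>v. min (\<tau> v) s) \<in> borel_measurable (raw_filtration T t s)"
proof (rule borel_measurableI_le)
  fix r
  show "{v \<in> space (raw_filtration T t s). min (\<tau> v) s \<le> r} \<in> sets (raw_filtration T t s)"
  proof (cases "s \<le> r")
    case True
    then have "{v \<in> space (raw_filtration T t s). min (\<tau> v) s \<le> r} = space (raw_filtration T t s)"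
      by auto
    then show ?thesis by (simp only: sets.top)
  next
    case False
    then show ?thesis using stopping_times_le[OF assms, of r s] by (auto simp: min_le_iff_disj)
  qed
qed

lemma borel_measurable_stopping_time:
  assumes "\<tau> \<in> stopping_times T t"
  shows "\<tau> \<in> borel_measurable (raw_filtration T t T)"
  using borel_measurable_min_stopping_time[OF assms, of T] stopping_times_in[OF assms]
  by (subst measurable_cong[of _ _ "\<lambda>v. min (\<tau> v) T"]) auto

lemma stopping_times_less:
  assumes "\<tau> \<in> stopping_times T t"
  shows "{v \<in> paths T t. \<tau> v < s} \<in> sets (raw_filtration T t s)"
proof -
  have "{v \<in> space (raw_filtration T t s). min (\<tau> v) s < s} \<in> sets (raw_filtration T t s)"
    using borel_measurable_min_stopping_time[OF assms, of s] by measurable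
  moreover have "{v \<in> space (raw_filtration T t s). min (\<tau> v) s < s} = {v \<in> paths T t. \<tau> v < s}"
    by auto
  ultimately show ?thesis by simp
qed

lemma stopping_times_const:
  assumes "r \<in> {t..T}"
  shows "(\<lambda>_. r) \<in> stopping_times T t"
proof (rule stopping_timesI)
  fix q
  show "{v \<in> paths T t. r \<le> q} \<in> sets (raw_filtration T t q)"
    using sets.top[of "raw_filtration T t q"] by (cases "r \<le> q") auto
qed (use assms in auto)

section \<open>Countable partitions of the path space into small cells\<close>

lemma countable_uniformly_dense:
  fixes a b :: real
  shows "\<exists>D :: nat \<Rightarrow> real \<Rightarrow> 'b::{metric_space, second_countable_topology}.
    \<forall>f. continuous_on {a..b} f \<longrightarrow> (\<forall>e>0. \<exists>i. \<forall>r\<in>{a..b}. dist (f r) (D i r) < e)"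
proof -
  obtain C :: "'b set" where C: "countable C" "\<And>X. open X \<Longrightarrow> X \<noteq> {} \<Longrightarrow> \<exists>d\<in>C. d \<in> X"
    by (rule countable_dense_setE) blast
  \<comment> \<open>Step functions on a grid with \<open>N\<close> pieces per unit length and values
    in a countable dense set. Coding the values by a finite list keeps the family countable.\<close>
  define F where "F = (\<lambda>(N::nat, xs :: 'b list) r. xs ! nat \<lfloor>(r - a) * real N\<rfloor>)"
  let ?S = "F ` (UNIV \<times> lists C)"
  have cS: "countable ?S" using C(1) by auto
  have neS: "?S \<noteq> {}" by auto
  have "\<exists>i. \<forall>r\<in>{a..b}. dist (f r) (from_nat_into ?S i r) < e"
    if f: "continuous_on {a..b} f" and e: "0 < e" for f e
  proof -
    have "uniformly_continuous_on {a..b} f" using f by (intro compact_uniformly_continuous) auto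
    then obtain d where d: "0 < d" "\<And>x y. x \<in> {a..b} \<Longrightarrow> y \<in> {a..b} \<Longrightarrow> dist x y < d \<Longrightarrow>
        dist (f x) (f y) < e / 2"
      using e unfolding uniformly_continuous_on_def by (metis half_gt_zero dist_commute)
    obtain N0 :: nat where "inverse (real (Suc N0)) < d" using reals_Archimedean[OF d(1)] by blast
    then obtain N :: nat where N: "0 < N" "1 / real N < d"
      by (intro that[of "Suc N0"]) (auto simp: inverse_eq_divide)
    have "\<exists>c\<in>C. dist (f (min b (a + real i / real N))) c < e / 2" for i
      using C(2)[of "ball (f (min b (a + real i / real N))) (e / 2)"] e by (auto simp: ball_eq_empty)
    then obtain c where c: "\<And>i. c i \<in> C" "\<And>i. dist (f (min b (a + real i / real N))) (c i) < e / 2"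
      by metis
    \<comment> \<open>The largest grid index is attained at \<open>r = b\<close>, hence the
      additional entry.\<close>
    define xs where "xs = map c [0..<nat \<lfloor>(b - a) * real N\<rfloor> + 1]"
    have "F (N, xs) \<in> ?S" using c by (intro imageI) (auto simp: xs_def)
    then obtain i where i: "from_nat_into ?S i = F (N, xs)"
      using cS by (metis from_nat_into_surj)
    have "dist (f r) (F (N, xs) r) < e" if r: "r \<in> {a..b}" for r
    proof -
      define j where "j = nat \<lfloor>(r - a) * real N\<rfloor>"
      have "(r - a) * real N \<le> (b - a) * real N" using r by (intro mult_right_mono) auto
      then have "j < nat \<lfloor>(b - a) * real N\<rfloor> + 1"
        unfolding j_def using floor_mono nat_mono by (metis less_add_one le_imp_less_Suc Suc_eq_plus1)
      then have Fj: "F (N, xs) r = c j"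
        by (simp add: F_def j_def[symmetric] xs_def del: upt_Suc)
      have "0 \<le> (r - a) * real N" using r by auto
      then have "real j \<le> (r - a) * real N" "(r - a) * real N < real j + 1"
        unfolding j_def by linarith+
      then have "real j / real N \<le> r - a" "r - a < (real j + 1) / real N"
        using N(1) by (auto simp: field_simps)
      then have jr: "a + real j / real N \<le> r" "r - (a + real j / real N) < 1 / real N"
        by (auto simp: add_divide_distrib)
      then have "dist (f r) (f (a + real j / real N)) < e / 2"
        using r N by (intro d(2)) (auto simp: dist_real_def)
      moreover have "dist (f (a + real j / real N)) (c j) < e / 2"
        using c(2)[of j] jr r by (simp add: min_absorb2)
      ultimately show ?thesis
        unfolding Fj using dist_triangle[of "f r" "c j" "f (a + real j / real N)"] by linarith
    qed
    then show ?thesis using i by (intro exI[of _ i]) auto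
  qed
  then show ?thesis by blast
qed

text \<open>A sequence of countable partitions that takes the place of separability of the path
  space in the supremum norm on \<open>{t..s}\<close>. Numbering the cells makes countability
  automatic and turns unions of cells into preimages of sets of numbers.\<close>

definition path_cells :: "real \<Rightarrow> real \<Rightarrow> real \<Rightarrow> (nat \<Rightarrow> ('d::finite) path \<Rightarrow> nat) \<Rightarrow> bool" where
  "path_cells T t s c \<longleftrightarrow>
    (\<forall>k. c k \<in> raw_filtration T t s \<rightarrow>\<^sub>M count_space UNIV) \<and>
    (\<forall>k. \<forall>v\<in>paths T t. \<forall>v'\<in>paths T t. c k v = c k v' \<longrightarrow>
      (\<forall>r\<in>{t..s}. norm (v r - v' r) \<le> 1 / (real k + 1)))"

lemma paths_continuous_on: "v \<in> paths T t \<Longrightarrow> s \<le> T \<Longrightarrow> continuous_on {t..s} v"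
  by (auto simp: paths_def intro: continuous_on_subset)

text \<open>A path is sent to the first step function near it. Nearness is tested at countably many
  times only, which makes it an event at time \<open>s\<close>; its radius is half the diameter
  allowed, as two paths of a cell are compared through their common step function.\<close>

lemma path_cells_exist:
  assumes "s \<le> T"
  shows "\<exists>c :: nat \<Rightarrow> ('d::finite) path \<Rightarrow> nat. path_cells T t s c"
proof -
  obtain D :: "nat \<Rightarrow> real \<Rightarrow> real ^ 'd" where
    D: "\<And>f e. continuous_on {t..s} f \<Longrightarrow> 0 < e \<Longrightarrow> \<exists>i. \<forall>r\<in>{t..s}. dist (f r) (D i r) < e"
    using countable_uniformly_dense[of t s] by blast
  obtain Q where Q: "countable Q" "Q \<subseteq> {t..s}" "{t..s} \<subseteq> closure Q"
    using separable by blast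
  then have clQ: "closure Q = {t..s}" using closure_minimal[of Q "{t..s}"] by auto
  define near where
    "near k i v \<longleftrightarrow> (\<forall>r\<in>Q. norm (v r - D i r) \<le> 1 / (2 * (real k + 1)))" for k i and v :: "'d path"
  define c where "c k v = (LEAST i. near k i v)" for k v
  have "c k \<in> raw_filtration T t s \<rightarrow>\<^sub>M count_space UNIV" for k
  proof -
    have "Measurable.pred (raw_filtration T t s) (near k i)" for i
      unfolding near_def pred_def
    proof (rule sets.sets_Collect_countable_All'[OF _ Q(1)])
      fix r assume "r \<in> Q"
      then have [measurable]: "(\<lambda>v. v r) \<in> borel_measurable (raw_filtration T t s)"
        using Q(2) by (intro borel_measurable_coordinate) auto
      show "{v \<in> space (raw_filtration T t s). norm (v r - D i r) \<le> 1 / (2 * (real k + 1))}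
          \<in> sets (raw_filtration T t s)"
        by measurable
    qed
    then show ?thesis unfolding c_def by measurable
  qed
  moreover have "norm (v r - v' r) \<le> 1 / (real k + 1)"
    if v: "v \<in> paths T t" "v' \<in> paths T t" and eq: "c k v = c k v'" and r: "r \<in> {t..s}" for k v v' r
  proof -
    have near: "near k (c k u) u" if u: "u \<in> paths T t" for u
    proof -
      obtain i where "\<forall>r\<in>{t..s}. dist (u r) (D i r) < 1 / (2 * (real k + 1))"
        using D[OF paths_continuous_on[OF u assms], of "1 / (2 * (real k + 1))"] by auto
      then have "near k i u"
        using Q(2) unfolding near_def dist_norm by (meson less_imp_le subsetD)
      then show ?thesis unfolding c_def by (rule LeastI)
    qed
    have "norm (v q - v' q) \<le> 1 / (real k + 1)" if "q \<in> Q" for q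
    proof -
      have "norm (v q - D (c k v) q) \<le> 1 / (2 * (real k + 1))"
        "norm (v' q - D (c k v) q) \<le> 1 / (2 * (real k + 1))"
        using near[OF v(1)] near[OF v(2)] that unfolding eq near_def by auto
      moreover have "norm (v q - v' q) \<le> norm (v q - D (c k v) q) + norm (v' q - D (c k v) q)"
        by (metis norm_triangle_ineq4 diff_diff_eq2 diff_add_cancel)
      ultimately have "norm (v q - v' q) \<le> 1 / (2 * (real k + 1)) + 1 / (2 * (real k + 1))" by linarith
      also have "\<dots> = 1 / (real k + 1)" by (simp add: field_simps)
      finally show ?thesis .
    qed
    \<comment> \<open>The step function may jump, so the bound passes from \<open>Q\<close> to all
      times only for the difference of the two paths.\<close>
    moreover have "continuous_on (closure Q) (\<lambda>r. v r - v' r)"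
      unfolding clQ using v assms by (intro continuous_intros paths_continuous_on)
    ultimately show ?thesis
      using continuous_on_closure_norm_le[of Q "\<lambda>r. v r - v' r" "1 / (real k + 1)" r] r clQ by auto
  qed
  ultimately show ?thesis by (intro exI[of _ c]) (auto simp: path_cells_def)
qed

text \<open>Evaluating \<open>f\<close> at a representative of the cell of \<open>v\<close> factors
  through a natural number, hence is measurable, and uniform continuity gives convergence as the
  cells shrink. \<open>M\<close> is kept general so that it can also be the sigma-algebra generated
  by the cells alone.\<close>

lemma borel_measurable_of_path_cells:
  fixes f :: "('d::finite) path \<Rightarrow> 'b::metric_space"
  assumes c: "path_cells T t s c" and sp: "space M = paths T t"
    and cM: "\<And>k. c k \<in> M \<rightarrow>\<^sub>M count_space UNIV"
    and f: "\<And>e. 0 < e \<Longrightarrow> \<exists>d>0. \<forall>v\<in>paths T t. \<forall>v'\<in>paths T t.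
      (\<forall>r\<in>{t..s}. norm (v r - v' r) \<le> d) \<longrightarrow> dist (f v) (f v') \<le> e"
  shows "f \<in> borel_measurable M"
proof -
  define rep where "rep k i = (SOME v. v \<in> paths T t \<and> c k v = i)" for k i
  have rep: "rep k (c k v) \<in> paths T t \<and> c k (rep k (c k v)) = c k v" if "v \<in> paths T t" for k v
    unfolding rep_def by (rule someI[of _ v]) (use that in auto)
  show ?thesis
  proof (rule borel_measurable_LIMSEQ_metric)
    fix k
    show "(\<lambda>v. f (rep k (c k v))) \<in> borel_measurable M"
      by (rule measurable_compose[OF cM]) simp
  next
    fix v assume "v \<in> space M"
    then have v: "v \<in> paths T t" by (simp add: sp)
    show "(\<lambda>k. f (rep k (c k v))) \<longlonglongrightarrow> f v"
    proof (rule metric_LIMSEQ_I)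
      fix e :: real assume "0 < e"
      then obtain d where d: "0 < d" "\<And>v v'. v \<in> paths T t \<Longrightarrow> v' \<in> paths T t \<Longrightarrow>
          (\<forall>r\<in>{t..s}. norm (v r - v' r) \<le> d) \<Longrightarrow> dist (f v) (f v') \<le> e / 2"
        using f[of "e / 2"] by auto
      obtain N where N: "inverse (real (Suc N)) < d" using reals_Archimedean[OF d(1)] by blast
      have "dist (f (rep k (c k v))) (f v) < e" if "N \<le> k" for k
      proof -
        have "1 / (real k + 1) \<le> inverse (real (Suc N))" using that by (auto simp: field_simps)
        moreover have "norm (rep k (c k v) r - v r) \<le> 1 / (real k + 1)" if "r \<in> {t..s}" for r
          using c rep[OF v, of k] v that unfolding path_cells_def by blast
        ultimately have "norm (rep k (c k v) r - v r) \<le> d" if "r \<in> {t..s}" for r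
          using that N by (meson less_imp_le order_trans)
        then have "dist (f (rep k (c k v))) (f v) \<le> e / 2"
          using rep[OF v, of k] v by (intro d(2)) auto
        then show ?thesis using \<open>0 < e\<close> by linarith
      qed
      then show "\<exists>N. \<forall>k\<ge>N. dist (f (rep k (c k v))) (f v) < e" by blast
    qed
  qed
qed

lemma borel_measurable_uniformly_continuous_path:
  fixes f :: "('d::finite) path \<Rightarrow> 'b::metric_space"
  assumes "s \<le> T"
    and "\<And>e. 0 < e \<Longrightarrow> \<exists>d>0. \<forall>v\<in>paths T t. \<forall>v'\<in>paths T t.
      (\<forall>r\<in>{t..s}. norm (v r - v' r) \<le> d) \<longrightarrow> dist (f v) (f v') \<le> e"
  shows "f \<in> borel_measurable (raw_filtration T t s)"
proof -
  obtain c :: "nat \<Rightarrow> 'd path \<Rightarrow> nat" where c: "path_cells T t s c"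
    using path_cells_exist[OF assms(1)] by blast
  show ?thesis
    by (rule borel_measurable_of_path_cells[OF c _ _ assms(2)]) (use c in \<open>auto simp: path_cells_def\<close>)
qed

text \<open>The countably many cells generate the whole sigma-algebra: each coordinate up to time
  \<open>s\<close> is uniformly continuous in the supremum norm, hence measurable with respect to
  the cells.\<close>

lemma raw_filtration_countable_algebra:
  assumes "s \<le> T"
  shows "\<exists>A. countable A \<and> algebra (paths T t :: ('d::finite) path set) A \<and>
    A \<subseteq> sets (raw_filtration T t s) \<and> sets (raw_filtration T t s) = sigma_sets (paths T t) A"
proof -
  let ?F = "raw_filtration T t s :: 'd path measure"
  obtain c :: "nat \<Rightarrow> 'd path \<Rightarrow> nat" where c: "path_cells T t s c"
    using path_cells_exist[OF assms(1)] by blast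
  define G where "G = (\<Union>k i. {c k -` {i} \<inter> paths T t})"
  have "countable G" "G \<subseteq> Pow (paths T t)" by (auto simp: G_def)
  from countable_generated_algebra[OF this]
  obtain A where A: "countable A" "algebra (paths T t) A" "G \<subseteq> A" "A \<subseteq> sigma_sets (paths T t) G"
    by (elim exE conjE)
  have "c k -` {i} \<inter> paths T t \<in> sets ?F" for k i
  proof -
    have "c k \<in> ?F \<rightarrow>\<^sub>M count_space UNIV" using c by (simp add: path_cells_def)
    from measurable_sets[OF this, of "{i}"] show ?thesis by simp
  qed
  then have "G \<subseteq> sets ?F" by (auto simp: G_def)
  then have GF: "sigma_sets (paths T t) G \<subseteq> sets ?F"
    using sets.sigma_sets_subset[of G ?F] by simp
  let ?M = "sigma (paths T t) G"
  have M: "space ?M = paths T t" "sets ?M = sigma_sets (paths T t) G"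
    using \<open>G \<subseteq> Pow (paths T t)\<close> by (auto intro: space_measure_of)
  have cM: "c k \<in> ?M \<rightarrow>\<^sub>M count_space UNIV" for k
  proof (subst measurable_count_space_eq_countable, simp, intro conjI ballI)
    fix i show "c k -` {i} \<inter> space ?M \<in> sets ?M"
      unfolding M by (rule sigma_sets.Basic) (auto simp: G_def)
  qed auto
  have co: "(\<lambda>v. v r) \<in> borel_measurable ?M" if r: "r \<in> {t..s}" for r
    using r by (intro borel_measurable_of_path_cells[OF c M(1) cM]) (auto simp: dist_norm)
  have "sets ?F \<subseteq> sigma_sets (paths T t) G"
    unfolding sets_raw_filtration
  proof (rule sigma_sets_mono, safe)
    fix r and B :: "(real ^ 'd) set" assume r: "r \<in> {t..s}" and B: "B \<in> sets borel"
    from measurable_sets[OF co[OF r] B]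
    show "(\<lambda>w. w r) -` B \<inter> paths T t \<in> sigma_sets (paths T t) G" by (simp add: M)
  qed
  moreover have "sigma_sets (paths T t) A = sigma_sets (paths T t) G"
    using A by (intro antisym sigma_sets_mono) (auto intro: sigma_sets.Basic)
  ultimately show ?thesis using A GF by (intro exI[of _ A]) auto
qed

section \<open>Concatenation of paths\<close>

lemma splice_apply:
  "r \<in> {t..T} \<Longrightarrow> splice T t s w v r = (if r < s then w r else w s + v r)"
  by (simp add: splice_def)

lemma splice_in_paths:
  assumes "w \<in> paths T t" "v \<in> paths T s" "t \<le> s" "s \<le> T"
  shows "splice T t s w v \<in> paths T t"
proof -
  have w: "continuous_on {t..T} w" "w t = 0" and v: "continuous_on {s..T} v" "v s = 0"
    using assms by (auto simp: paths_def)
  have "continuous_on ({t..s} \<union> {s..T}) (\<lambda>r. if r \<le> s then w r else w s + v r)"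
    using assms v by (intro continuous_on_If continuous_on_subset[OF w(1)] continuous_intros v) auto
  moreover have "{t..s} \<union> {s..T} = {t..T}" using assms by auto
  ultimately have "continuous_on {t..T} (\<lambda>r. if r \<le> s then w r else w s + v r)" by simp
  \<comment> \<open>The two case distinctions differ only at \<open>r = s\<close>, where both give
    \<open>w s\<close> because \<open>v s = 0\<close>.\<close>
  then have "continuous_on {t..T} (splice T t s w v)"
    by (rule continuous_on_eq) (use v in \<open>auto simp: splice_def\<close>)
  moreover have "splice T t s w v t = 0"
    using assms w v by (cases "t = s") (auto simp: splice_apply)
  ultimately show ?thesis by (auto simp: paths_def splice_def)
qed

section \<open>Payoff processes\<close>

lemma modulus_nonneg: "modulus_of_continuity \<rho> \<Longrightarrow> 0 \<le> x \<Longrightarrow> 0 \<le> \<rho> x"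
  by (simp add: modulus_of_continuity_def)

lemma modulus_mono: "modulus_of_continuity \<rho> \<Longrightarrow> 0 \<le> x \<Longrightarrow> x \<le> y \<Longrightarrow> \<rho> x \<le> \<rho> y"
  by (auto simp: modulus_of_continuity_def mono_on_def)

lemma modulus_zero: "modulus_of_continuity \<rho> \<Longrightarrow> \<rho> 0 = 0"
  by (simp add: modulus_of_continuity_def)

text \<open>The one-sided limit controls the value at \<open>b / 2\<close>, and monotonicity extends
  this to all smaller arguments, including 0.\<close>

lemma modulus_small:
  assumes "modulus_of_continuity \<rho>" "0 < e"
  shows "\<exists>d>0. \<forall>x. 0 \<le> x \<and> x \<le> d \<longrightarrow> \<rho> x < e"
proof -
  have "(\<rho> \<longlongrightarrow> 0) (at_right 0)" using assms(1) by (simp add: modulus_of_continuity_def)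
  then have "eventually (\<lambda>x. \<rho> x < e) (at_right 0)" using assms(2) by (rule order_tendstoD)
  then obtain b where b: "0 < b" "\<And>x. 0 < x \<Longrightarrow> x < b \<Longrightarrow> \<rho> x < e"
    unfolding eventually_at_right_field by auto
  have "\<rho> x < e" if "0 \<le> x" "x \<le> b / 2" for x
    using modulus_mono[OF assms(1) that] b(2)[of "b / 2"] b(1) by linarith
  then show ?thesis using b(1) by (intro exI[of _ "b / 2"]) auto
qed

lemma sup_norm_le:
  assumes "t \<le> s" "\<And>r. r \<in> {t..s} \<Longrightarrow> norm (f r) \<le> c"
  shows "sup_norm t s f \<le> c"
  unfolding sup_norm_def using assms by (intro cSUP_least) auto

text \<open>The bound \<open>c\<close> ensures that the set is bounded above, without which a real
  \<open>SUP\<close> is not an upper bound.\<close>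

lemma sup_norm_nonneg:
  assumes "t \<le> s" "\<And>r. r \<in> {t..s} \<Longrightarrow> norm (f r) \<le> c"
  shows "0 \<le> sup_norm t s f"
proof -
  have "norm (f t) \<le> sup_norm t s f"
    unfolding sup_norm_def using assms by (intro cSUP_upper bdd_aboveI2[of _ _ c]) auto
  then show ?thesis using norm_ge_zero[of "f t"] by linarith
qed

lemma norm_le_sup_norm:
  assumes "continuous_on {t..s} f" "r \<in> {t..s}"
  shows "norm (f r) \<le> sup_norm t s f"
  unfolding sup_norm_def
proof (rule cSUP_upper[OF assms(2)])
  have "compact ((\<lambda>r. norm (f r)) ` {t..s})"
    using assms(1) by (intro compact_continuous_image continuous_intros) auto
  then show "bdd_above ((\<lambda>r. norm (f r)) ` {t..s})"
    by (intro bounded_imp_bdd_above compact_imp_bounded)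
qed

lemma null_path_in_paths: "0 \<le> T \<Longrightarrow> null_path T \<in> paths T 0"
  by (auto simp: paths_def null_path_def intro: continuous_on_eq[OF continuous_on_const])

locale game =
  fixes T :: real and g L U :: "real \<Rightarrow> ('d::finite) path \<Rightarrow> real" and \<rho>0 :: "real \<Rightarrow> real"
  assumes T_pos: "0 < T" and reg: "payoff_regular T g L U \<rho>0"
begin

lemma mod0: "modulus_of_continuity \<rho>0"
  using reg by (simp add: payoff_regular_def)

lemma L_le_U: "a \<in> {0..T} \<Longrightarrow> w \<in> paths T 0 \<Longrightarrow> L a w \<le> U a w"
  using reg by (auto simp: payoff_regular_def)

lemma regD:
  "X \<in> {g, L, U} \<Longrightarrow> a \<in> {0..T} \<Longrightarrow> b \<in> {0..T} \<Longrightarrow> w \<in> paths T 0 \<Longrightarrow> w' \<in> paths T 0 \<Longrightarrow>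
    \<bar>X a w - X b w'\<bar> \<le> \<rho>0 (\<bar>a - b\<bar> + sup_norm 0 T (\<lambda>r. w (min r a) - w' (min r b)))"
  using reg unfolding payoff_regular_def by blast

text \<open>The modulus only compares the paths stopped at \<open>a\<close>, and with equal times
  its time part vanishes; closeness up to \<open>a\<close> is therefore enough.\<close>

lemma reg_path:
  assumes X: "X \<in> {g, L, U}" and a: "a \<in> {0..T}" and w: "w \<in> paths T 0" "w' \<in> paths T 0"
    and c: "\<And>r. r \<in> {0..a} \<Longrightarrow> norm (w r - w' r) \<le> c"
  shows "\<bar>X a w - X a w'\<bar> \<le> \<rho>0 c"
proof -
  have "norm (w (min r a) - w' (min r a)) \<le> c" if "r \<in> {0..T}" for r
    using that a by (intro c) auto
  then have "0 \<le> sup_norm 0 T (\<lambda>r. w (min r a) - w' (min r a))"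
    "sup_norm 0 T (\<lambda>r. w (min r a) - w' (min r a)) \<le> c"
    using T_pos sup_norm_nonneg[of 0 T "\<lambda>r. w (min r a) - w' (min r a)" c]
      sup_norm_le[of 0 T "\<lambda>r. w (min r a) - w' (min r a)" c] by auto
  then have "\<rho>0 (\<bar>a - a\<bar> + sup_norm 0 T (\<lambda>r. w (min r a) - w' (min r a))) \<le> \<rho>0 c"
    by (intro modulus_mono[OF mod0]) auto
  then show ?thesis using regD[OF X a a w] by linarith
qed

lemma continuous_in_time:
  assumes X: "X \<in> {g, L, U}" and w: "w \<in> paths T 0"
  shows "continuous_on {0..T} (\<lambda>a. X a w)"
  unfolding continuous_on_iff
proof (intro ballI allI impI)
  fix a e :: real assume a: "a \<in> {0..T}" and "0 < e"
  obtain d where d: "0 < d" "\<And>x. 0 \<le> x \<Longrightarrow> x \<le> d \<Longrightarrow> \<rho>0 x < e"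
    using modulus_small[OF mod0 \<open>0 < e\<close>] by blast
  have "uniformly_continuous_on {0..T} w"
    using paths_continuous_on[OF w order_refl] by (intro compact_uniformly_continuous) auto
  then obtain d1 where d1: "0 < d1" "\<And>x y. x \<in> {0..T} \<Longrightarrow> y \<in> {0..T} \<Longrightarrow> dist y x < d1 \<Longrightarrow>
      dist (w y) (w x) < d / 2"
    unfolding uniformly_continuous_on_def using half_gt_zero[OF d(1)] by meson
  have "dist (X b w) (X a w) < e" if b: "b \<in> {0..T}" and ba: "dist b a < min d1 (d / 2)" for b
  proof -
    have small: "norm (w (min r b) - w (min r a)) \<le> d / 2" if "r \<in> {0..T}" for r
    proof -
      have "dist (min r b) (min r a) \<le> dist b a" by (auto simp: dist_real_def min_def)
      then have "dist (min r b) (min r a) < d1" using ba by simp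
      then have "dist (w (min r b)) (w (min r a)) < d / 2" using that a b by (intro d1(2)) auto
      then show ?thesis by (simp add: dist_norm)
    qed
    have "0 \<le> sup_norm 0 T (\<lambda>r. w (min r b) - w (min r a))"
      using T_pos by (intro sup_norm_nonneg[OF _ small]) auto
    moreover have "sup_norm 0 T (\<lambda>r. w (min r b) - w (min r a)) \<le> d / 2"
      using T_pos by (intro sup_norm_le[OF _ small]) auto
    ultimately have "\<rho>0 (\<bar>b - a\<bar> + sup_norm 0 T (\<lambda>r. w (min r b) - w (min r a))) < e"
      using ba by (intro d(2)) (auto simp: dist_real_def)
    then show ?thesis using regD[OF X b a w w] by (simp add: dist_real_def)
  qed
  then show "\<exists>d>0. \<forall>b\<in>{0..T}. dist b a < d \<longrightarrow> dist (X b w) (X a w) < e"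
    using d(1) d1(1) by (intro exI[of _ "min d1 (d / 2)"]) auto
qed

lemma splice_diff_le:
  assumes "t \<in> {0..T}" "a \<le> T" "r \<in> {0..a}" "0 \<le> d"
    and w: "\<And>r. r \<in> {0..t} \<Longrightarrow> norm (w r - w' r) \<le> c"
    and v: "\<And>r. r \<in> {t..a} \<Longrightarrow> norm (v r - v' r) \<le> d"
  shows "norm (splice T 0 t w v r - splice T 0 t w' v' r) \<le> c + d"
proof (cases "r < t")
  case True
  then have "norm (w r - w' r) \<le> c" using assms by auto
  then have "norm (w r - w' r) \<le> c + d" using \<open>0 \<le> d\<close> by linarith
  then show ?thesis using assms True by (simp add: splice_apply)
next
  case False
  then have "norm (w t - w' t) \<le> c" "norm (v r - v' r) \<le> d" using assms by auto
  moreover have "norm (w t + v r - (w' t + v' r)) \<le> norm (w t - w' t) + norm (v r - v' r)"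
    using norm_triangle_ineq[of "w t - w' t" "v r - v' r"] by (simp add: algebra_simps)
  ultimately have "norm (w t + v r - (w' t + v' r)) \<le> c + d" by linarith
  then show ?thesis using False assms(1-3) by (simp add: splice_apply)
qed

lemma splice_paths0: "t \<in> {0..T} \<Longrightarrow> w \<in> paths T 0 \<Longrightarrow> v \<in> paths T t \<Longrightarrow> splice T 0 t w v \<in> paths T 0"
  by (intro splice_in_paths) auto

lemma shift_diff_le:
  assumes X: "X \<in> {g, L, U}" and "t \<in> {0..T}" "a \<in> {t..T}" "0 \<le> d"
    and "w \<in> paths T 0" "w' \<in> paths T 0" "v \<in> paths T t" "v' \<in> paths T t"
    and "\<And>r. r \<in> {0..t} \<Longrightarrow> norm (w r - w' r) \<le> c"
    and "\<And>r. r \<in> {t..a} \<Longrightarrow> norm (v r - v' r) \<le> d"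
  shows "\<bar>X a (splice T 0 t w v) - X a (splice T 0 t w' v')\<bar> \<le> \<rho>0 (c + d)"
  using assms by (intro reg_path[OF X] splice_paths0 splice_diff_le) auto

text \<open>The integral in the payoff as a process in its upper limit, so that it can be sampled at
  stopping times just like \<open>L\<close> and \<open>U\<close>.\<close>

definition running_gain :: "real \<Rightarrow> 'd path \<Rightarrow> real \<Rightarrow> 'd path \<Rightarrow> real" where
  "running_gain t w a v = (LINT r:{t..a}|lborel. g r (splice T 0 t w v))"

lemma payoff_eq:
  "payoff T g L U t w \<tau> \<gamma> v = running_gain t w (min (\<tau> v) (\<gamma> v)) v +
    (if \<tau> v \<le> \<gamma> v then L (\<tau> v) (splice T 0 t w v) else U (\<gamma> v) (splice T 0 t w v))"
  by (simp add: payoff_def shift_process_def running_gain_def)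

lemma shift_continuous_on:
  assumes "X \<in> {g, L, U}" "t \<in> {0..T}" "w \<in> paths T 0" "v \<in> paths T t" "a \<le> T"
  shows "continuous_on {t..a} (\<lambda>r. X r (splice T 0 t w v))"
  using assms by (intro continuous_on_subset[OF continuous_in_time[OF assms(1)]] splice_paths0) auto

lemma shift_set_integrable:
  assumes "t \<in> {0..T}" "w \<in> paths T 0" "v \<in> paths T t" "a \<le> T"
  shows "set_integrable lborel {t..a} (\<lambda>r. g r (splice T 0 t w v))"
  using shift_continuous_on[of g, OF _ assms]
  by (intro borel_integrable_atLeastAtMost') auto

lemma running_gain_continuous_on:
  assumes "t \<in> {0..T}" "w \<in> paths T 0" "v \<in> paths T t"
  shows "continuous_on {t..T} (\<lambda>a. running_gain t w a v)"
proof -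
  have cont: "continuous_on {t..T} (\<lambda>r. g r (splice T 0 t w v))"
    using assms by (intro shift_continuous_on) auto
  have "running_gain t w a v = integral {t..a} (\<lambda>r. g r (splice T 0 t w v))" if "a \<in> {t..T}" for a
    unfolding running_gain_def
    using that assms by (intro set_borel_integral_eq_integral shift_set_integrable) auto
  moreover have "continuous_on {t..T} (\<lambda>a. integral {t..a} (\<lambda>r. g r (splice T 0 t w v)))"
    by (intro indefinite_integral_continuous_1 integrable_continuous_interval cont)
  ultimately show ?thesis using continuous_on_eq by (metis (no_types, lifting))
qed

text \<open>The integrands differ by at most \<open>\<rho>0 (c + d)\<close> on an interval of length
  at most \<open>T\<close>. The bounds \<open>c\<close> for the past and \<open>d\<close> for the
  future are kept apart because some uses vary only the past and others only the future.\<close>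

lemma running_gain_diff_le:
  assumes t: "t \<in> {0..T}" and a: "a \<in> {t..T}" and cd: "0 \<le> c" "0 \<le> d"
    and w: "w \<in> paths T 0" "w' \<in> paths T 0" and v: "v \<in> paths T t" "v' \<in> paths T t"
    and dw: "\<And>r. r \<in> {0..t} \<Longrightarrow> norm (w r - w' r) \<le> c"
    and dv: "\<And>r. r \<in> {t..a} \<Longrightarrow> norm (v r - v' r) \<le> d"
  shows "\<bar>running_gain t w a v - running_gain t w' a v'\<bar> \<le> T * \<rho>0 (c + d)"
proof -
  have i: "set_integrable lborel {t..a} (\<lambda>r. g r (splice T 0 t w v))"
    "set_integrable lborel {t..a} (\<lambda>r. g r (splice T 0 t w' v'))"
    using assms by (auto intro!: shift_set_integrable)
  then have id: "set_integrable lborel {t..a} (\<lambda>r. g r (splice T 0 t w v) - g r (splice T 0 t w' v'))"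
    by (rule set_integral_diff)
  have "running_gain t w a v - running_gain t w' a v' =
      (LINT r:{t..a}|lborel. g r (splice T 0 t w v) - g r (splice T 0 t w' v'))"
    unfolding running_gain_def by (rule set_integral_diff(2)[OF i, symmetric])
  then have "\<bar>running_gain t w a v - running_gain t w' a v'\<bar> \<le>
      (LINT r:{t..a}|lborel. \<bar>g r (splice T 0 t w v) - g r (splice T 0 t w' v')\<bar>)"
    using set_integral_norm_bound[OF id] by (simp only: real_norm_def)
  also have "\<dots> \<le> (LINT r:{t..a}|lborel. \<rho>0 (c + d))"
  proof (rule set_integral_mono)
    show "set_integrable lborel {t..a} (\<lambda>r. \<bar>g r (splice T 0 t w v) - g r (splice T 0 t w' v')\<bar>)"
      by (rule set_integrable_abs[OF id])
    show "set_integrable lborel {t..a} (\<lambda>r. \<rho>0 (c + d))"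
      by (rule borel_integrable_atLeastAtMost'[OF continuous_on_const])
    show "\<bar>g r (splice T 0 t w v) - g r (splice T 0 t w' v')\<bar> \<le> \<rho>0 (c + d)" if r: "r \<in> {t..a}" for r
    proof (rule shift_diff_le[OF _ t _ cd(2) w v dw])
      show "norm (v q - v' q) \<le> d" if "q \<in> {t..r}" for q
        using that r by (intro dv) auto
    qed (use r a in auto)
  qed
  also have "\<dots> = (a - t) * \<rho>0 (c + d)"
    using a by (simp add: set_integral_const)
  also have "\<dots> \<le> T * \<rho>0 (c + d)"
    using a t cd by (intro mult_right_mono modulus_nonneg[OF mod0]) auto
  finally show ?thesis .
qed

lemma payoff_diff_le:
  assumes t: "t \<in> {0..T}" and w: "w \<in> paths T 0" "w' \<in> paths T 0" and v: "v \<in> paths T t"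
    and "\<tau> \<in> stopping_times T t" "\<gamma> \<in> stopping_times T t" and c: "0 \<le> c"
    and dw: "\<And>r. r \<in> {0..t} \<Longrightarrow> norm (w r - w' r) \<le> c"
  shows "\<bar>payoff T g L U t w \<tau> \<gamma> v - payoff T g L U t w' \<tau> \<gamma> v\<bar> \<le> (1 + T) * \<rho>0 c"
proof -
  have \<tau>: "\<tau> v \<in> {t..T}" "\<gamma> v \<in> {t..T}" using assms by (auto dest: stopping_times_in)
  have "\<bar>running_gain t w (min (\<tau> v) (\<gamma> v)) v - running_gain t w' (min (\<tau> v) (\<gamma> v)) v\<bar> \<le> T * \<rho>0 (c + 0)"
    using assms \<tau> by (intro running_gain_diff_le) auto
  moreover have "\<bar>L (\<tau> v) (splice T 0 t w v) - L (\<tau> v) (splice T 0 t w' v)\<bar> \<le> \<rho>0 (c + 0)"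
    using assms \<tau> by (intro shift_diff_le) auto
  moreover have "\<bar>U (\<gamma> v) (splice T 0 t w v) - U (\<gamma> v) (splice T 0 t w' v)\<bar> \<le> \<rho>0 (c + 0)"
    using assms \<tau> by (intro shift_diff_le) auto
  ultimately show ?thesis by (auto simp: payoff_eq algebra_simps)
qed

text \<open>A modulus estimate is uniform continuity in the supremum norm. It survives suprema over
  uncountable index sets, which is how such suprema are shown measurable below.\<close>

lemma borel_measurable_of_modulus:
  assumes "s \<le> T" "0 \<le> K"
    and "\<And>v v' d. v \<in> paths T t \<Longrightarrow> v' \<in> paths T t \<Longrightarrow> 0 < d \<Longrightarrow>
      (\<And>r. r \<in> {t..s} \<Longrightarrow> norm (v r - v' r) \<le> d) \<Longrightarrow> \<bar>f v - f v'\<bar> \<le> K * \<rho> d"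
    and "modulus_of_continuity \<rho>"
  shows "(f :: 'd path \<Rightarrow> real) \<in> borel_measurable (raw_filtration T t s)"
proof (rule borel_measurable_uniformly_continuous_path[OF assms(1)])
  fix e :: real assume "0 < e"
  \<comment> \<open>The denominator is \<open>K + 1\<close> because \<open>K\<close> may be
    zero.\<close>
  then obtain d where d: "0 < d" "\<rho> d < e / (K + 1)"
    using modulus_small[OF assms(4), of "e / (K + 1)"] assms(2) by force
  have "K * \<rho> d \<le> e"
  proof -
    have "K * \<rho> d \<le> K * (e / (K + 1))" using d assms(2) by (intro mult_left_mono) auto
    also have "\<dots> \<le> e" using assms(2) \<open>0 < e\<close> by (simp add: field_simps)
    finally show ?thesis .
  qed
  then show "\<exists>d>0. \<forall>v\<in>paths T t. \<forall>v'\<in>paths T t.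
      (\<forall>r\<in>{t..s}. norm (v r - v' r) \<le> d) \<longrightarrow> dist (f v) (f v') \<le> e"
    using d(1) assms(3) by (intro exI[of _ d]) (force simp: dist_real_def)
qed

lemma shift_adapted:
  assumes "X \<in> {g, L, U}" "t \<in> {0..T}" "a \<in> {t..T}" "w \<in> paths T 0"
  shows "(\<lambda>v. X a (splice T 0 t w v)) \<in> borel_measurable (raw_filtration T t a)"
proof (rule borel_measurable_of_modulus[where K = 1, OF _ _ _ mod0])
  fix v v' :: "'d path" and d :: real
  assume "v \<in> paths T t" "v' \<in> paths T t" "0 < d" "\<And>r. r \<in> {t..a} \<Longrightarrow> norm (v r - v' r) \<le> d"
  then show "\<bar>X a (splice T 0 t w v) - X a (splice T 0 t w v')\<bar> \<le> 1 * \<rho>0 d"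
    using shift_diff_le[OF assms(1-3), of d w w v v' 0] assms by auto
qed (use assms in auto)

lemma running_gain_adapted:
  assumes "t \<in> {0..T}" "a \<in> {t..T}" "w \<in> paths T 0"
  shows "running_gain t w a \<in> borel_measurable (raw_filtration T t a)"
proof (rule borel_measurable_of_modulus[where K = T, OF _ _ _ mod0])
  fix v v' :: "'d path" and d :: real
  assume "v \<in> paths T t" "v' \<in> paths T t" "0 < d" "\<And>r. r \<in> {t..a} \<Longrightarrow> norm (v r - v' r) \<le> d"
  then show "\<bar>running_gain t w a v - running_gain t w a v'\<bar> \<le> T * \<rho>0 d"
    using running_gain_diff_le[OF assms(1-2), of 0 d w w v v'] assms by auto
qed (use assms T_pos in auto)

lemma eval_shift_measurable:
  assumes "X \<in> {g, L, U}" "t \<in> {0..T}" "w \<in> paths T 0" "s \<in> {t..T}"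
    and "\<tau> \<in> borel_measurable (raw_filtration T t s)" "\<And>v. v \<in> paths T t \<Longrightarrow> \<tau> v \<in> {t..s}"
  shows "(\<lambda>v. X (\<tau> v) (splice T 0 t w v)) \<in> borel_measurable (raw_filtration T t s)"
proof (rule borel_measurable_eval_process[where a = t and b = s and X = "\<lambda>r v. X r (splice T 0 t w v)"])
  fix r assume "r \<in> {t..s}"
  then show "(\<lambda>v. X r (splice T 0 t w v)) \<in> borel_measurable (raw_filtration T t s)"
    using assms by (intro borel_measurable_raw_filtration_mono[OF shift_adapted]) auto
qed (use assms in \<open>auto intro!: shift_continuous_on\<close>)

lemma eval_running_gain_measurable:
  assumes "t \<in> {0..T}" "w \<in> paths T 0" "s \<in> {t..T}"
    and "\<tau> \<in> borel_measurable (raw_filtration T t s)" "\<And>v. v \<in> paths T t \<Longrightarrow> \<tau> v \<in> {t..s}"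
  shows "(\<lambda>v. running_gain t w (\<tau> v) v) \<in> borel_measurable (raw_filtration T t s)"
proof (rule borel_measurable_eval_process[where a = t and b = s and X = "running_gain t w"])
  fix r assume "r \<in> {t..s}"
  then show "running_gain t w r \<in> borel_measurable (raw_filtration T t s)"
    using assms by (intro borel_measurable_raw_filtration_mono[OF running_gain_adapted]) auto
next
  fix v :: "'d path" assume "v \<in> space (raw_filtration T t s)"
  then show "continuous_on {t..s} (\<lambda>r. running_gain t w r v)"
    using assms by (intro continuous_on_subset[OF running_gain_continuous_on]) auto
qed (use assms in auto)

lemma payoff_measurable:
  assumes "t \<in> {0..T}" "w \<in> paths T 0" "\<tau> \<in> stopping_times T t" "\<gamma> \<in> stopping_times T t"
  shows "payoff T g L U t w \<tau> \<gamma> \<in> borel_measurable (raw_filtration T t T)"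
proof -
  have [measurable]: "\<tau> \<in> borel_measurable (raw_filtration T t T)"
    "\<gamma> \<in> borel_measurable (raw_filtration T t T)"
    using assms by (auto intro: borel_measurable_stopping_time)
  have in_T: "\<tau> v \<in> {t..T}" "\<gamma> v \<in> {t..T}" if "v \<in> paths T t" for v
    using assms that by (auto dest: stopping_times_in)
  have [measurable]: "(\<lambda>v. L (\<tau> v) (splice T 0 t w v)) \<in> borel_measurable (raw_filtration T t T)"
    by (rule eval_shift_measurable[of L]) (use assms(1,2) in_T(1) in auto)
  have [measurable]: "(\<lambda>v. U (\<gamma> v) (splice T 0 t w v)) \<in> borel_measurable (raw_filtration T t T)"
    by (rule eval_shift_measurable[of U]) (use assms(1,2) in_T(2) in auto)
  have [measurable]: "(\<lambda>v. running_gain t w (min (\<tau> v) (\<gamma> v)) v) \<in> borel_measurable (raw_filtration T t T)"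
  proof (rule eval_running_gain_measurable)
    show "min (\<tau> v) (\<gamma> v) \<in> {t..T}" if "v \<in> paths T t" for v
      using in_T[OF that] by auto
  qed (use assms in auto)
  show ?thesis unfolding payoff_eq[abs_def] by measurable
qed

end

section \<open>Integrable bounds for the payoff\<close>

context game
begin

text \<open>By the reverse triangle inequality \<open>\<bar>g\<bar>\<close> has the same modulus as
  \<open>g\<close>, so the facts about running gains also cover the integral of
  \<open>\<bar>g\<bar>\<close>, which bounds all running gains at once.\<close>

lemma game_abs_gain: "game T (\<lambda>a w. \<bar>g a w\<bar>) L U \<rho>0"
proof (unfold_locales)
  have "\<bar>\<bar>x\<bar> - \<bar>y\<bar>\<bar> \<le> c" if "\<bar>x - y\<bar> \<le> c" for x y c :: real using that by linarith
  then show "payoff_regular T (\<lambda>a w. \<bar>g a w\<bar>) L U \<rho>0"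
    using reg unfolding payoff_regular_def by (simp add: Ball_def)
qed (rule T_pos)

lemma abs_le_Psi:
  assumes "a \<in> {0..T}" "w \<in> paths T 0"
  shows "\<bar>L a w\<bar> \<le> Psi L U a w" "\<bar>U a w\<bar> \<le> Psi L U a w"
  using L_le_U[OF assms] by (auto simp: Psi_def)

text \<open>Integrability is assumed along the null path only. Replacing the null path by
  \<open>w\<close> moves each value by at most \<open>\<rho>0\<close> of the supremum norm of
  \<open>w\<close>, a constant. The bound holds for all times together, hence for all stopping
  times.\<close>

lemma integrable_dominator:
  assumes t: "t \<in> {0..T}" and P: "P \<in> integrable_probs T g L U t" and w: "w \<in> paths T 0"
  shows "\<exists>Z. integrable P Z \<and> (\<forall>v\<in>paths T t. \<forall>a\<in>{t..T}. \<forall>b\<in>{t..T}.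
    \<bar>running_gain t w a v\<bar> + \<bar>L b (splice T 0 t w v)\<bar> \<le> Z v \<and>
    \<bar>running_gain t w a v\<bar> + \<bar>U b (splice T 0 t w v)\<bar> \<le> Z v)"
proof -
  interpret A: game T "\<lambda>a w. \<bar>g a w\<bar>" L U \<rho>0 by (rule game_abs_gain)
  have PP: "P \<in> path_probs T t" using P by (simp add: integrable_probs_def)
  interpret prob_space P using path_probsD(1)[OF PP] .
  have spP: "space P = paths T t" and setsP: "sets P = sets (raw_filtration T t T)"
    using path_probsD[OF PP] by auto
  have measP: "f \<in> borel_measurable P" if "f \<in> borel_measurable (raw_filtration T t T)"
    for f :: "'d path \<Rightarrow> real"
    using that measurable_cong_sets[OF setsP refl] by blast
  define N :: "'d path" where "N = null_path T"
  have N: "N \<in> paths T 0" using T_pos by (simp add: N_def null_path_in_paths)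
  define C where "C = sup_norm 0 T w"
  have wC: "norm (w r - N r) \<le> C" if "r \<in> {0..t}" for r
    using that t norm_le_sup_norm[OF paths_continuous_on[OF w order_refl], of r]
    by (simp add: N_def null_path_def C_def)
  have C0: "0 \<le> C" using order_trans[OF norm_ge_zero wC[of 0]] t by auto
  define p where "p a v = Psi L U a (splice T 0 t N v)" for a v
  define Pm where "Pm v = (SUP a\<in>{t..T}. p a v)" for v
  have p_cont: "continuous_on {t..T} (\<lambda>a. p a v)" if "v \<in> paths T t" for v
    unfolding p_def Psi_def using that t N by (intro continuous_intros shift_continuous_on) auto
  have p_bdd: "bdd_above ((\<lambda>a. p a v) ` {t..T})" if "v \<in> paths T t" for v
    by (intro bounded_imp_bdd_above compact_imp_bounded compact_continuous_image p_cont that) auto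
  have p_le: "p a v \<le> Pm v" if "a \<in> {t..T}" "v \<in> paths T t" for a v
    unfolding Pm_def using that by (intro cSUP_upper p_bdd)
  \<comment> \<open>Since the supremum is attained, the modulus estimate for single times carries
    over to \<open>Pm\<close> and gives its measurability.\<close>
  have Pm_attained: "\<exists>a\<in>{t..T}. Pm v = p a v" if v: "v \<in> paths T t" for v
  proof -
    have "{t..T} \<noteq> {}" using t by auto
    then obtain a where a: "a \<in> {t..T}" "\<forall>b\<in>{t..T}. p b v \<le> p a v"
      using continuous_attains_sup[OF compact_Icc _ p_cont[OF v]] by blast
    then have "Pm v \<le> p a v" unfolding Pm_def using t by (intro cSUP_least) auto
    then show ?thesis using p_le[OF a(1) v] a(1) by (intro bexI[of _ a]) auto
  qed
  have p_diff: "p a v \<le> p a v' + \<rho>0 d"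
    if "v \<in> paths T t" "v' \<in> paths T t" "0 < d" "a \<in> {t..T}"
      "\<And>r. r \<in> {t..T} \<Longrightarrow> norm (v r - v' r) \<le> d" for v v' d a
  proof -
    have "\<bar>X a (splice T 0 t N v) - X a (splice T 0 t N v')\<bar> \<le> \<rho>0 (0 + d)"
      if "X \<in> {g, L, U}" for X
      using that \<open>v \<in> paths T t\<close> \<open>v' \<in> paths T t\<close> \<open>0 < d\<close> \<open>a \<in> {t..T}\<close> N t
        \<open>\<And>r. r \<in> {t..T} \<Longrightarrow> norm (v r - v' r) \<le> d\<close>
      by (intro shift_diff_le[of X]) auto
    from this[of L] this[of U] show ?thesis
      using modulus_nonneg[OF mod0, of d] that(3) by (auto simp: p_def Psi_def abs_le_iff max_def)
  qed
  have Pm_meas: "Pm \<in> borel_measurable (raw_filtration T t T)"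
  proof (rule borel_measurable_of_modulus[where K = 1, OF _ _ _ mod0])
    fix v v' :: "'d path" and d :: real
    assume *: "v \<in> paths T t" "v' \<in> paths T t" "0 < d"
      "\<And>r. r \<in> {t..T} \<Longrightarrow> norm (v r - v' r) \<le> d"
    obtain a b where ab: "a \<in> {t..T}" "Pm v = p a v" "b \<in> {t..T}" "Pm v' = p b v'"
      using Pm_attained[OF *(1)] Pm_attained[OF *(2)] by blast
    have "p a v \<le> p a v' + \<rho>0 d" using * ab by (intro p_diff) auto
    moreover have "p b v' \<le> p b v + \<rho>0 d"
      using * ab by (intro p_diff) (auto simp: norm_minus_commute)
    ultimately show "\<bar>Pm v - Pm v'\<bar> \<le> 1 * \<rho>0 d"
      using p_le[OF ab(1) *(2)] p_le[OF ab(3) *(1)] ab by auto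
  qed auto
  have "0 \<le> p a v" for a v by (simp add: p_def Psi_def)
  have Pm_int: "integrable P Pm"
  proof (rule integrableI_bounded[OF measP[OF Pm_meas]])
    have "ennreal (norm (Pm v)) \<le>
        (SUP s\<in>{t..T}. ennreal \<bar>shift_process T 0 t (null_path T) (Psi L U) s v\<bar>)"
      if v: "v \<in> space P" for v
    proof -
      obtain a where a: "a \<in> {t..T}" "Pm v = p a v" using Pm_attained[of v] v unfolding spP by blast
      then have "ennreal (norm (Pm v)) = ennreal \<bar>shift_process T 0 t (null_path T) (Psi L U) a v\<bar>"
        by (simp add: p_def shift_process_def N_def)
      then show ?thesis using SUP_upper[OF a(1)] by simp
    qed
    then have "(\<integral>\<^sup>+v. ennreal (norm (Pm v)) \<partial>P) \<le>
        (\<integral>\<^sup>+v. (SUP s\<in>{t..T}. ennreal \<bar>shift_process T 0 t (null_path T) (Psi L U) s v\<bar>) \<partial>P)"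
      by (rule nn_integral_mono)
    also have "\<dots> < \<infinity>" using P by (simp add: integrable_probs_def S_space_def)
    finally show "(\<integral>\<^sup>+v. ennreal (norm (Pm v)) \<partial>P) < \<infinity>" .
  qed
  define G where "G = A.running_gain t N T"
  have G_meas: "G \<in> borel_measurable (raw_filtration T t T)"
    unfolding G_def using t N by (intro A.running_gain_adapted) auto
  have G_nonneg: "0 \<le> G v" for v
    unfolding G_def A.running_gain_def set_lebesgue_integral_def by (intro Bochner_Integration.integral_nonneg) auto
  have G_int: "integrable P G"
  proof (rule integrableI_bounded[OF measP[OF G_meas]])
    have "ennreal (norm (G v)) =
        (\<integral>\<^sup>+ s\<in>{t..T}. ennreal \<bar>shift_process T 0 t (null_path T) g s v\<bar> \<partial>lborel)"
      if "v \<in> space P" for v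
    proof -
      have "set_integrable lborel {t..T} (\<lambda>r. \<bar>g r (splice T 0 t N v)\<bar>)"
        using that spP t N by (intro A.shift_set_integrable) auto
      then have "(\<integral>\<^sup>+ r. ennreal (indicator {t..T} r *\<^sub>R \<bar>g r (splice T 0 t N v)\<bar>) \<partial>lborel) = ennreal (G v)"
        unfolding G_def A.running_gain_def set_lebesgue_integral_def set_integrable_def
        by (intro nn_integral_eq_integral) auto
      moreover have "ennreal (indicator {t..T} r *\<^sub>R \<bar>g r (splice T 0 t N v)\<bar>) =
          ennreal \<bar>shift_process T 0 t (null_path T) g r v\<bar> * indicator {t..T} r" for r
        by (simp add: shift_process_def N_def indicator_def)
      ultimately show ?thesis using G_nonneg[of v] by simp
    qed
    then have "(\<integral>\<^sup>+v. ennreal (norm (G v)) \<partial>P) =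
      (\<integral>\<^sup>+v. (\<integral>\<^sup>+ s\<in>{t..T}. ennreal \<bar>shift_process T 0 t (null_path T) g s v\<bar> \<partial>lborel) \<partial>P)"
      by (rule nn_integral_cong)
    also have "\<dots> < \<infinity>" using P by (simp add: integrable_probs_def)
    finally show "(\<integral>\<^sup>+v. ennreal (norm (G v)) \<partial>P) < \<infinity>" .
  qed
  \<comment> \<open>\<open>T * \<rho>0 C\<close> pays for changing the past in the gain, one more
    \<open>\<rho>0 C\<close> for changing it in \<open>L\<close> or \<open>U\<close>.\<close>
  define Z where "Z v = G v + Pm v + (1 + T) * \<rho>0 C" for v
  have "integrable P Z" unfolding Z_def using G_int Pm_int by simp
  moreover have "\<bar>running_gain t w a v\<bar> + \<bar>X b (splice T 0 t w v)\<bar> \<le> Z v"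
    if v: "v \<in> paths T t" and a: "a \<in> {t..T}" and b: "b \<in> {t..T}" and X: "X \<in> {L, U}" for v a b X
  proof -
    have "\<bar>running_gain t w a v\<bar> \<le> A.running_gain t w a v"
      using set_integral_norm_bound[OF shift_set_integrable[OF t w v, of a]] a
      by (simp add: running_gain_def A.running_gain_def)
    also have "\<dots> \<le> A.running_gain t w T v"
      unfolding A.running_gain_def set_lebesgue_integral_def
      by (intro Bochner_Integration.integral_mono A.shift_set_integrable[unfolded set_integrable_def] t w v)
        (use a in \<open>auto split: split_indicator\<close>)
    also have "\<dots> \<le> G v + T * \<rho>0 (C + 0)"
      using A.running_gain_diff_le[OF t _ C0 order_refl w N v v wC, of T] t by (auto simp: G_def)
    finally have 1: "\<bar>running_gain t w a v\<bar> \<le> G v + T * \<rho>0 C" by simp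
    have "\<bar>X b (splice T 0 t w v) - X b (splice T 0 t N v)\<bar> \<le> \<rho>0 (C + 0)"
      using X by (intro shift_diff_le[OF _ t b order_refl w N v v wC]) auto
    moreover have "\<bar>X b (splice T 0 t N v)\<bar> \<le> p b v"
      unfolding p_def using X abs_le_Psi[of b "splice T 0 t N v"] b t splice_paths0[OF t N v] by auto
    moreover have "p b v \<le> Pm v" by (rule p_le[OF b v])
    ultimately show ?thesis using 1 by (simp add: Z_def algebra_simps)
  qed
  ultimately show ?thesis by (intro exI[of _ Z]) blast
qed

text \<open>One \<open>Z\<close> serves all pairs of stopping times, so dominated convergence
  remains available when the opponent varies along the sequence.\<close>

lemma payoff_dominator:
  assumes t: "t \<in> {0..T}" and P: "P \<in> integrable_probs T g L U t" and w: "w \<in> paths T 0"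
  shows "\<exists>Z. integrable P Z \<and> (\<forall>v\<in>paths T t. \<forall>\<tau>\<in>stopping_times T t. \<forall>\<gamma>\<in>stopping_times T t.
    \<bar>payoff T g L U t w \<tau> \<gamma> v\<bar> \<le> Z v)"
proof -
  obtain Z where Z: "integrable P Z" and bd: "\<And>v a b. v \<in> paths T t \<Longrightarrow> a \<in> {t..T} \<Longrightarrow> b \<in> {t..T} \<Longrightarrow>
    \<bar>running_gain t w a v\<bar> + \<bar>L b (splice T 0 t w v)\<bar> \<le> Z v \<and>
    \<bar>running_gain t w a v\<bar> + \<bar>U b (splice T 0 t w v)\<bar> \<le> Z v"
    using integrable_dominator[OF assms] by blast
  have "\<bar>payoff T g L U t w \<tau> \<gamma> v\<bar> \<le> Z v"
    if v: "v \<in> paths T t" and "\<tau> \<in> stopping_times T t" "\<gamma> \<in> stopping_times T t" for v \<tau> \<gamma>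
  proof -
    have i: "\<tau> v \<in> {t..T}" "\<gamma> v \<in> {t..T}" using that by (auto dest: stopping_times_in)
    show ?thesis
      using bd[OF v i(1) i(1)] bd[OF v i(2) i(2)] by (auto simp: payoff_eq min_def)
  qed
  then show ?thesis using Z by blast
qed

lemma payoff_integrable:
  assumes t: "t \<in> {0..T}" and P: "P \<in> integrable_probs T g L U t" and w: "w \<in> paths T 0"
    and \<tau>: "\<tau> \<in> stopping_times T t" and \<gamma>: "\<gamma> \<in> stopping_times T t"
  shows "integrable P (payoff T g L U t w \<tau> \<gamma>)"
proof -
  obtain Z where Z: "integrable P Z" "\<And>v. v \<in> paths T t \<Longrightarrow> \<bar>payoff T g L U t w \<tau> \<gamma> v\<bar> \<le> Z v"
    using payoff_dominator[OF t P w] \<tau> \<gamma> by blast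
  have PP: "P \<in> path_probs T t" using P by (simp add: integrable_probs_def)
  have "payoff T g L U t w \<tau> \<gamma> \<in> borel_measurable P"
    using payoff_measurable[OF t w \<tau> \<gamma>] measurable_cong_sets[OF path_probsD(3)[OF PP] refl] by blast
  then show ?thesis
    using Z path_probsD(2)[OF PP] by (intro Bochner_Integration.integrable_bound[OF Z(1)]) (auto intro!: AE_I2 order_trans[OF Z(2)])
qed

end

section \<open>A countable near-optimal family of stopping times\<close>

text \<open>The family is fixed before the measure, since it has to serve uncountably many measures.
  For a given measure the level sets of \<open>\<gamma>\<close> at grid times are approximated by
  members of fixed countable algebras, and a finite list of such members determines a grid-valued
  stopping time.\<close>

lemma countable_stopping_family:
  assumes "s \<le> T"
  shows "\<exists>C :: nat \<Rightarrow> ('d::finite) path \<Rightarrow> real. (\<forall>i. C i \<in> stopping_times T s) \<and>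
    (\<forall>P\<in>path_probs T s. \<forall>\<gamma>\<in>stopping_times T s. \<forall>h>0. \<forall>e>0.
      \<exists>i. measure P {v \<in> paths T s. \<not> (\<gamma> v \<le> C i v \<and> C i v \<le> \<gamma> v + h)} < e)"
proof -
  have "\<forall>r\<in>{..T}. \<exists>A. countable A \<and> algebra (paths T s :: 'd path set) A \<and>
      A \<subseteq> sets (raw_filtration T s r) \<and> sets (raw_filtration T s r) = sigma_sets (paths T s) A"
    using raw_filtration_countable_algebra by auto
  then obtain Alg where Alg: "\<And>r. r \<le> T \<Longrightarrow> countable (Alg r)"
    "\<And>r. r \<le> T \<Longrightarrow> algebra (paths T s :: 'd path set) (Alg r)"
    "\<And>r. r \<le> T \<Longrightarrow> Alg r \<subseteq> sets (raw_filtration T s r)"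
    "\<And>r. r \<le> T \<Longrightarrow> sets (raw_filtration T s r) = sigma_sets (paths T s) (Alg r)"
    unfolding bchoice_iff by auto
  define grid where "grid N j = s + (T - s) * (real j / real N)" for N j :: nat
  have grid_mono: "grid N i \<le> grid N j" if "i \<le> j" for N i j
    unfolding grid_def using that assms by (intro add_left_mono mult_left_mono divide_right_mono) auto
  have grid_ge: "s \<le> grid N j" for N j unfolding grid_def using assms by auto
  have grid_le: "grid N j \<le> T" if "j < N" for N j
  proof -
    have "(T - s) * (real j / real N) \<le> (T - s) * 1"
      using that assms by (intro mult_left_mono) auto
    then show ?thesis by (simp add: grid_def)
  qed
  \<comment> \<open>The first grid time whose set contains the path. The list covers the indices
    below \<open>N\<close>; the default \<open>T\<close> stands for the last grid point.\<close>
  define hit where "hit N Es v = (if \<exists>j<N. v \<in> Es ! j then grid N (LEAST j. j < N \<and> v \<in> Es ! j) else T)"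
    for N and Es :: "'d path set list" and v
  define Idx where "Idx N = {Es. length Es = N \<and> (\<forall>j<N. Es ! j \<in> Alg (grid N j))}" for N
  have hit_least: "hit N Es v = grid N (LEAST j. j < N \<and> v \<in> Es ! j)" "(LEAST j. j < N \<and> v \<in> Es ! j) < N"
    "(LEAST j. j < N \<and> v \<in> Es ! j) \<le> j" "v \<in> Es ! (LEAST j. j < N \<and> v \<in> Es ! j)"
    if "j < N" "v \<in> Es ! j" for N Es v j
    using LeastI[of "\<lambda>j. j < N \<and> v \<in> Es ! j" j] Least_le[of "\<lambda>j. j < N \<and> v \<in> Es ! j" j] that
    by (auto simp: hit_def)
  let ?S = "\<Union>N. hit N ` Idx N"
  have "countable (Idx N)" for N
  proof (rule countable_subset)
    show "Idx N \<subseteq> lists (\<Union>j<N. Alg (grid N j))" by (fastforce simp: Idx_def in_set_conv_nth)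
    show "countable (lists (\<Union>j<N. Alg (grid N j)))" by (intro countable_lists countable_UN) (auto intro: Alg(1) grid_le)
  qed
  then have cS: "countable ?S" by auto
  have "hit 0 [] \<in> ?S" by (intro UN_I[of 0] imageI) (auto simp: Idx_def)
  then have neS: "?S \<noteq> {}" by blast
  have st: "hit N Es \<in> stopping_times T s" if Es: "Es \<in> Idx N" for N Es
  proof (rule stopping_timesI)
    fix q assume q: "s \<le> q" "q < T"
    have sets: "Es ! j \<in> sets (raw_filtration T s (grid N j))" if "j < N" for j
      using Es Alg(3)[OF grid_le[OF that]] that by (auto simp: Idx_def)
    have "{v \<in> paths T s. hit N Es v \<le> q} = (\<Union>j\<in>{j. j < N \<and> grid N j \<le> q}. Es ! j)"
    proof (intro set_eqI iffI)
      fix v assume v: "v \<in> {v \<in> paths T s. hit N Es v \<le> q}"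
      then obtain j where "j < N" "v \<in> Es ! j" using q by (force simp: hit_def split: if_splits)
      from hit_least[OF this] v show "v \<in> (\<Union>j\<in>{j. j < N \<and> grid N j \<le> q}. Es ! j)" by auto
    next
      fix v assume "v \<in> (\<Union>j\<in>{j. j < N \<and> grid N j \<le> q}. Es ! j)"
      then obtain j where j: "j < N" "grid N j \<le> q" "v \<in> Es ! j" by auto
      then have "v \<in> paths T s" using sets.sets_into_space[OF sets[OF j(1)]] by auto
      moreover have "hit N Es v \<le> q"
        using hit_least[OF j(1,3)] grid_mono[of "LEAST j. j < N \<and> v \<in> Es ! j" j N] j(2) by linarith
      ultimately show "v \<in> {v \<in> paths T s. hit N Es v \<le> q}" by simp
    qed
    also have "\<dots> \<in> sets (raw_filtration T s q)"
    proof (rule sets.finite_UN)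
      fix j assume "j \<in> {j. j < N \<and> grid N j \<le> q}"
      then show "Es ! j \<in> sets (raw_filtration T s q)"
        using sets[of j] sets_raw_filtration_mono[of "grid N j" q T s] by auto
    qed auto
    finally show "{v \<in> paths T s. hit N Es v \<le> q} \<in> sets (raw_filtration T s q)" .
  next
    fix v :: "'d path"
    show "hit N Es v \<in> {s..T}"
    proof (cases "\<exists>j<N. v \<in> Es ! j")
      case True
      then obtain j where "j < N" "v \<in> Es ! j" by blast
      from hit_least[OF this] show ?thesis using grid_ge grid_le by auto
    qed (use assms in \<open>auto simp: hit_def\<close>)
  qed
  have approx: "\<exists>C\<in>?S. measure P {v \<in> paths T s. \<not> (\<gamma> v \<le> C v \<and> C v \<le> \<gamma> v + h)} < e"
    if P: "P \<in> path_probs T s" and \<gamma>: "\<gamma> \<in> stopping_times T s" and "0 < h" "0 < e" for P \<gamma> h e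
  proof -
    interpret prob_space P by (rule path_probsD(1)[OF P])
    have spP: "space P = paths T s" and setsP: "sets P = sets (raw_filtration T s T)"
      using path_probsD[OF P] by auto
    \<comment> \<open>The grid gets mesh at most \<open>h\<close>, so that rounding up delays by at
      most \<open>h\<close>.\<close>
    obtain N :: nat where "(T - s) / h < real N" using reals_Archimedean2 by blast
    then have TN: "T - s < real N * h" using \<open>0 < h\<close> by (simp add: pos_divide_less_eq)
    have N0: "0 < N"
    proof (rule Nat.gr0I)
      assume "N = 0"
      then show False using TN assms by simp
    qed
    then have N: "0 < N" "(T - s) / real N \<le> h"
      using TN by (auto simp: pos_divide_le_eq mult.commute)
    define B where "B j = {v \<in> paths T s. \<gamma> v \<le> grid N j}" for j
    have Bm: "B j \<in> sets (raw_filtration T s (grid N j))" for j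
      unfolding B_def by (rule stopping_times_le[OF \<gamma> order_refl])
    have sub: "sets (raw_filtration T s (grid N j)) \<subseteq> sets P" if "j < N" for j
      unfolding setsP by (rule sets_raw_filtration_mono[OF grid_le[OF that]])
    have "\<exists>a\<in>Alg (grid N j). measure P ((a - B j) \<union> (B j - a)) < e / real N" if j: "j < N" for j
    proof (rule approx_by_algebra)
      show "algebra (space P) (Alg (grid N j))" using Alg(2)[OF grid_le[OF j]] by (simp add: spP)
      show "Alg (grid N j) \<subseteq> sets P" using Alg(3)[OF grid_le[OF j]] sub[OF j] by simp
      show "B j \<in> sigma_sets (space P) (Alg (grid N j))"
        using Bm[of j] Alg(4)[OF grid_le[OF j]] by (simp add: spP)
      show "0 < e / real N" using \<open>0 < e\<close> N by simp
    qed
    then obtain a where a: "\<And>j. j < N \<Longrightarrow> a j \<in> Alg (grid N j)"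
      "\<And>j. j < N \<Longrightarrow> measure P ((a j - B j) \<union> (B j - a j)) < e / real N" by metis
    define Es where "Es = map a [0..<N]"
    have Es_nth: "Es ! j = a j" if "j < N" for j using that by (simp add: Es_def)
    have Es: "Es \<in> Idx N" using a(1) by (auto simp: Idx_def Es_def)
    let ?D = "\<Union>j<N. (a j - B j) \<union> (B j - a j)"
    have am: "a j \<in> sets P" if "j < N" for j using a(1)[OF that] Alg(3)[OF grid_le[OF that]] sub[OF that] by auto
    have Bm': "B j \<in> sets P" if "j < N" for j using Bm[of j] sub[OF that] by auto
    \<comment> \<open>Outside \<open>?D\<close> the approximating sets agree with the level sets of
      \<open>\<gamma>\<close>, so \<open>hit\<close> is \<open>\<gamma>\<close> rounded up to the
      next grid point.\<close>
    have "{v \<in> paths T s. \<not> (\<gamma> v \<le> hit N Es v \<and> hit N Es v \<le> \<gamma> v + h)} \<subseteq> ?D"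
    proof (rule subsetI, rule ccontr)
      fix v assume v: "v \<in> {v \<in> paths T s. \<not> (\<gamma> v \<le> hit N Es v \<and> hit N Es v \<le> \<gamma> v + h)}"
        and "v \<notin> ?D"
      then have iff: "v \<in> Es ! j \<longleftrightarrow> \<gamma> v \<le> grid N j" if "j < N" for j
        using that by (auto simp: Es_nth B_def)
      have \<gamma>v: "\<gamma> v \<in> {s..T}" using v \<gamma> by (auto dest: stopping_times_in)
      have step: "grid N (Suc k) \<le> grid N k + h" for k
        using N by (simp add: grid_def add_divide_distrib distrib_left)
      have "\<gamma> v \<le> hit N Es v \<and> hit N Es v \<le> \<gamma> v + h"
      proof (cases "\<exists>j<N. v \<in> Es ! j")
        case True
        define J where "J = (LEAST j. j < N \<and> v \<in> Es ! j)"
        from True obtain j where "j < N" "v \<in> Es ! j" by blast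
        from hit_least[OF this] have J: "hit N Es v = grid N J" "J < N" "v \<in> Es ! J"
          unfolding J_def by simp_all
        have "grid N J \<le> \<gamma> v + h"
        proof (cases J)
          case 0
          then show ?thesis using \<gamma>v \<open>0 < h\<close> by (simp add: grid_def)
        next
          case (Suc k)
          then have "\<not> (k < N \<and> v \<in> Es ! k)" unfolding J_def by (intro not_less_Least) auto
          then have "grid N k < \<gamma> v" using iff[of k] J(2) Suc by auto
          then show ?thesis using step[of k] Suc by simp
        qed
        then show ?thesis using J iff by auto
      next
        case False
        obtain k where k: "N = Suc k" using N(1) gr0_implies_Suc by blast
        have "grid N k < \<gamma> v" using False iff[of k] k by force
        moreover have "grid N (Suc k) = T" using k by (simp add: grid_def)
        moreover have "hit N Es v = T" unfolding hit_def using False by (rule if_not_P)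
        ultimately show ?thesis using step[of k] \<gamma>v by auto
      qed
      then show False using v by simp
    qed
    then have "measure P {v \<in> paths T s. \<not> (\<gamma> v \<le> hit N Es v \<and> hit N Es v \<le> \<gamma> v + h)} \<le> measure P ?D"
      using am Bm' by (intro finite_measure_mono) auto
    also have "\<dots> \<le> (\<Sum>j<N. measure P ((a j - B j) \<union> (B j - a j)))"
      using am Bm' by (intro finite_measure_subadditive_finite) auto
    also have "\<dots> < (\<Sum>j<N. e / real N)"
      using a(2) N by (intro sum_strict_mono) auto
    also have "\<dots> = e" using N by simp
    finally show ?thesis using Es by (intro bexI[of _ "hit N Es"]) auto
  qed
  show ?thesis
  proof (intro exI[of _ "from_nat_into ?S"] conjI allI ballI impI)
    show "from_nat_into ?S i \<in> stopping_times T s" for i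
      using from_nat_into[OF neS, of i] st by auto
    fix P :: "'d path measure" and \<gamma> :: "'d path \<Rightarrow> real" and h e :: real
    assume "P \<in> path_probs T s" "\<gamma> \<in> stopping_times T s" "0 < h" "0 < e"
    from approx[OF this] obtain C where C: "C \<in> ?S"
      "measure P {v \<in> paths T s. \<not> (\<gamma> v \<le> C v \<and> C v \<le> \<gamma> v + h)} < e" by blast
    obtain i where "from_nat_into ?S i = C" using from_nat_into_surj[OF cS C(1)] by blast
    then show "\<exists>i. measure P {v \<in> paths T s. \<not> (\<gamma> v \<le> from_nat_into ?S i v \<and>
        from_nat_into ?S i v \<le> \<gamma> v + h)} < e" using C(2) by (intro exI[of _ i]) simp
  qed
qed

section \<open>Near-optimality within the countable family\<close>

context game
begin

text \<open>If \<open>\<tau> v \<le> \<gamma> v\<close>, nothing changes. If \<open>\<tau> v\<close>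
  lies after \<open>\<gamma> v\<close> but not after \<open>\<gamma>' v\<close>, then
  \<open>L\<close> is paid at \<open>\<tau> v\<close>, which is at most \<open>U\<close> there. If
  it is later still, \<open>U\<close> is paid at \<open>\<gamma>' v\<close>. The last two cases are
  covered by \<open>osc\<close>.\<close>

lemma payoff_delay_le:
  assumes t: "t \<in> {0..T}" and w: "w \<in> paths T 0" and v: "v \<in> paths T t"
    and \<tau>: "\<tau> \<in> stopping_times T t" and \<gamma>: "\<gamma> \<in> stopping_times T t" "\<gamma>' \<in> stopping_times T t"
    and le: "\<gamma> v \<le> \<gamma>' v"
    and osc: "\<And>a. a \<in> {\<gamma> v..\<gamma>' v} \<Longrightarrow>
      running_gain t w a v + U a (splice T 0 t w v) \<le>
      running_gain t w (\<gamma> v) v + U (\<gamma> v) (splice T 0 t w v) + e"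
    and "0 \<le> e"
  shows "payoff T g L U t w \<tau> \<gamma>' v \<le> payoff T g L U t w \<tau> \<gamma> v + e"
proof -
  have "\<tau> v \<in> {0..T}" using t stopping_times_in[OF \<tau> v] by auto
  then have "L (\<tau> v) (splice T 0 t w v) \<le> U (\<tau> v) (splice T 0 t w v)"
    using t w v by (intro L_le_U splice_paths0)
  then show ?thesis
    using osc[of "\<tau> v"] osc[of "\<gamma>' v"] le \<open>0 \<le> e\<close> by (auto simp: payoff_eq min_def)
qed

text \<open>The difficulty is uniformity in \<open>\<tau>\<close>. If every index failed, each ever
  better approximation would have its own bad \<open>\<tau>\<close>. The delay estimate does not
  depend on \<open>\<tau>\<close>, so the excess payoffs still tend to zero almost surely and, being
  dominated, in mean, which contradicts the gap \<open>e\<close>.\<close>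

lemma countable_near_optimal:
  assumes t: "t \<in> {0..T}"
  shows "\<exists>C :: nat \<Rightarrow> 'd path \<Rightarrow> real. (\<forall>i. C i \<in> stopping_times T t) \<and>
    (\<forall>P\<in>integrable_probs T g L U t. \<forall>w\<in>paths T 0. \<forall>\<gamma>\<in>stopping_times T t. \<forall>e>0.
      \<exists>i. \<forall>\<tau>\<in>stopping_times T t.
        (\<integral>v. payoff T g L U t w \<tau> (C i) v \<partial>P) \<le> (\<integral>v. payoff T g L U t w \<tau> \<gamma> v \<partial>P) + e)"
proof -
  have "t \<le> T" using t by simp
  from countable_stopping_family[OF this, where 'd = 'd]
  obtain C :: "nat \<Rightarrow> 'd path \<Rightarrow> real" where C1: "\<forall>i. C i \<in> stopping_times T t"
    and C2: "\<forall>P\<in>path_probs T t. \<forall>\<gamma>\<in>stopping_times T t. \<forall>h>0. \<forall>e>0.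
      \<exists>i. measure P {v \<in> paths T t. \<not> (\<gamma> v \<le> C i v \<and> C i v \<le> \<gamma> v + h)} < e"
    by (elim exE conjE)
  note C = C1[rule_format] and approx = C2[rule_format]
  have "\<exists>i. \<forall>\<tau>\<in>stopping_times T t.
      (\<integral>v. payoff T g L U t w \<tau> (C i) v \<partial>P) \<le> (\<integral>v. payoff T g L U t w \<tau> \<gamma> v \<partial>P) + e"
    if P: "P \<in> integrable_probs T g L U t" and w: "w \<in> paths T 0"
      and \<gamma>: "\<gamma> \<in> stopping_times T t" and e: "0 < e" for P w \<gamma> e
  proof (rule ccontr)
    assume contr: "\<not> (\<exists>i. \<forall>\<tau>\<in>stopping_times T t.
      (\<integral>v. payoff T g L U t w \<tau> (C i) v \<partial>P) \<le> (\<integral>v. payoff T g L U t w \<tau> \<gamma> v \<partial>P) + e)"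
    have PP: "P \<in> path_probs T t" using P by (simp add: integrable_probs_def)
    interpret prob_space P by (rule path_probsD(1)[OF PP])
    have spP: "space P = paths T t" and setsP: "sets P = sets (raw_filtration T t T)"
      using path_probsD[OF PP] by auto
    have measP: "f \<in> borel_measurable P" if "f \<in> borel_measurable (raw_filtration T t T)"
      for f :: "'d path \<Rightarrow> real"
      using that measurable_cong_sets[OF setsP refl] by blast
    \<comment> \<open>The delays \<open>1 / (m + 1)\<close> tend to zero, and the failure
      probabilities \<open>(1 / 2) ^ m\<close> are summable, as Borel-Cantelli requires.\<close>
    have "\<forall>m. \<exists>i. measure P {v \<in> paths T t. \<not> (\<gamma> v \<le> C i v \<and> C i v \<le> \<gamma> v + 1 / (real m + 1))} < (1 / 2) ^ m"
      by (intro allI approx[OF PP \<gamma>]) auto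
    from choice[OF this] obtain i where i: "\<forall>m. measure P {v \<in> paths T t.
        \<not> (\<gamma> v \<le> C (i m) v \<and> C (i m) v \<le> \<gamma> v + 1 / (real m + 1))} < (1 / 2) ^ m" ..
    define c where "c m = C (i m)" for m
    have c: "c m \<in> stopping_times T t" for m by (simp add: c_def C)
    define bad where "bad m = {v \<in> paths T t. \<not> (\<gamma> v \<le> c m v \<and> c m v \<le> \<gamma> v + 1 / (real m + 1))}" for m
    have "\<exists>\<tau>\<in>stopping_times T t. (\<integral>v. payoff T g L U t w \<tau> \<gamma> v \<partial>P) + e <
        (\<integral>v. payoff T g L U t w \<tau> (c m) v \<partial>P)" for m
      using contr unfolding c_def by (meson not_le)
    then have "\<forall>m. \<exists>\<tau>. \<tau> \<in> stopping_times T t \<and> (\<integral>v. payoff T g L U t w \<tau> \<gamma> v \<partial>P) + e <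
        (\<integral>v. payoff T g L U t w \<tau> (c m) v \<partial>P)" by blast
    from choice[OF this] obtain \<tau> where \<tau>: "\<And>m. \<tau> m \<in> stopping_times T t"
      and gap: "\<And>m. (\<integral>v. payoff T g L U t w (\<tau> m) \<gamma> v \<partial>P) + e <
        (\<integral>v. payoff T g L U t w (\<tau> m) (c m) v \<partial>P)" by blast
    \<comment> \<open>Only the positive part is controlled: a delay may lower the payoff by an
      amount that does not become small, as when \<open>L\<close> replaces \<open>U\<close>.\<close>
    define D where "D m v = max 0 (payoff T g L U t w (\<tau> m) (c m) v - payoff T g L U t w (\<tau> m) \<gamma> v)" for m v
    obtain Z where Z: "integrable P Z" "\<And>v \<tau> \<gamma>. v \<in> paths T t \<Longrightarrow> \<tau> \<in> stopping_times T t \<Longrightarrow>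
        \<gamma> \<in> stopping_times T t \<Longrightarrow> \<bar>payoff T g L U t w \<tau> \<gamma> v\<bar> \<le> Z v"
      using payoff_dominator[OF t P w] by blast
    have int: "integrable P (payoff T g L U t w (\<tau> m) (c m))" "integrable P (payoff T g L U t w (\<tau> m) \<gamma>)" for m
      using payoff_integrable[OF t P w \<tau>] c \<gamma> by auto
    have D_int: "integrable P (D m)" for m
      unfolding D_def using int by (intro integrable_max) auto
    have D_ge: "e \<le> (\<integral>v. D m v \<partial>P)" for m
    proof -
      have "(\<integral>v. payoff T g L U t w (\<tau> m) (c m) v - payoff T g L U t w (\<tau> m) \<gamma> v \<partial>P) \<le> (\<integral>v. D m v \<partial>P)"
        using int by (intro Bochner_Integration.integral_mono D_int) (auto simp: D_def)
      then show ?thesis using gap[of m] int by simp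
    qed
    have \<gamma>m: "\<gamma> \<in> borel_measurable P"
      by (rule measP[OF borel_measurable_stopping_time[OF \<gamma>]])
    have cm: "c m \<in> borel_measurable P" for m
      by (rule measP[OF borel_measurable_stopping_time[OF c]])
    have bad_sets: "bad m \<in> sets P" for m
    proof -
      have "{v \<in> space P. \<gamma> v \<le> c m v} \<in> sets P" by (rule borel_measurable_le[OF \<gamma>m cm])
      moreover have "{v \<in> space P. c m v \<le> \<gamma> v + 1 / (real m + 1)} \<in> sets P"
        by (rule borel_measurable_le[OF cm borel_measurable_add[OF \<gamma>m borel_measurable_const]])
      moreover have "bad m = space P - ({v \<in> space P. \<gamma> v \<le> c m v} \<inter>
          {v \<in> space P. c m v \<le> \<gamma> v + 1 / (real m + 1)})"
        by (auto simp: bad_def spP)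
      ultimately show ?thesis by (simp only: sets.compl_sets sets.Int)
    qed
    have "summable (\<lambda>m. measure P (bad m))"
    proof (rule summable_comparison_test)
      show "\<exists>N. \<forall>m\<ge>N. norm (measure P (bad m)) \<le> (1 / 2) ^ m"
        using less_imp_le[OF i[rule_format]] unfolding bad_def c_def by (simp only: real_norm_def abs_of_nonneg measure_nonneg) blast
      show "summable (\<lambda>m. (1 / 2 :: real) ^ m)" by (rule summable_geometric) simp
    qed
    then have "AE v in P. eventually (\<lambda>m. v \<in> space P - bad m) sequentially"
      using bad_sets by (intro borel_cantelli_AE1) (auto simp: emeasure_eq_measure)
    moreover have "(\<lambda>m. D m v) \<longlonglongrightarrow> 0"
      if ev: "eventually (\<lambda>m. v \<in> space P - bad m) sequentially" and vP: "v \<in> space P" for v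
    proof (rule LIMSEQ_I)
      fix r :: real assume r: "0 < r"
      have v: "v \<in> paths T t" using vP spP by simp
      let ?K = "\<lambda>a. running_gain t w a v + U a (splice T 0 t w v)"
      have "uniformly_continuous_on {t..T} ?K"
        using t w v by (intro compact_uniformly_continuous continuous_intros
          running_gain_continuous_on shift_continuous_on[of U]) auto
      then obtain d where d: "0 < d" "\<And>x y. x \<in> {t..T} \<Longrightarrow> y \<in> {t..T} \<Longrightarrow> dist y x < d \<Longrightarrow>
          dist (?K y) (?K x) < r / 2"
        unfolding uniformly_continuous_on_def using half_gt_zero[OF r] by meson
      obtain N where N: "inverse (real (Suc N)) < d" using reals_Archimedean[OF d(1)] by blast
      obtain M where M: "\<And>m. M \<le> m \<Longrightarrow> v \<notin> bad m"
        using ev by (auto simp: eventually_sequentially)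
      have "norm (D m v - 0) < r" if m: "max M N \<le> m" for m
      proof -
        have g: "\<gamma> v \<le> c m v" "c m v \<le> \<gamma> v + 1 / (real m + 1)"
          using M[of m] m v by (auto simp: bad_def)
        have "1 / (real m + 1) \<le> inverse (real (Suc N))" using m by (auto simp: field_simps)
        then have small: "c m v - \<gamma> v < d" using g N by linarith
        have in_T: "\<gamma> v \<in> {t..T}" "c m v \<in> {t..T}" using stopping_times_in \<gamma> c v by blast+
        have "payoff T g L U t w (\<tau> m) (c m) v \<le> payoff T g L U t w (\<tau> m) \<gamma> v + r / 2"
        proof (rule payoff_delay_le[OF t w v \<tau> \<gamma> c g(1)])
          fix a assume a: "a \<in> {\<gamma> v..c m v}"
          then have "dist (?K a) (?K (\<gamma> v)) < r / 2"
            using in_T small by (intro d(2)) (auto simp: dist_real_def)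
          then show "?K a \<le> ?K (\<gamma> v) + r / 2" unfolding dist_real_def by linarith
        qed (use r in simp)
        then show ?thesis using r by (auto simp: D_def)
      qed
      then show "\<exists>no. \<forall>m\<ge>no. norm (D m v - 0) < r" by blast
    qed
    ultimately have "AE v in P. (\<lambda>m. D m v) \<longlonglongrightarrow> 0" by (auto intro: AE_mp AE_I2)
    moreover have "norm (D m v) \<le> 2 * Z v" if "v \<in> space P" for m v
    proof -
      have "v \<in> paths T t" using that spP by simp
      from Z(2)[OF this \<tau> c, of m m] Z(2)[OF this \<tau> \<gamma>, of m] show ?thesis by (auto simp: D_def)
    qed
    ultimately have "(\<lambda>m. \<integral>v. D m v \<partial>P) \<longlonglongrightarrow> (\<integral>v. 0 \<partial>P)"
      using Z(1) D_int by (intro integral_dominated_convergence[where w = "\<lambda>v. 2 * Z v"]) auto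
    then have "(\<lambda>m. \<integral>v. D m v \<partial>P) \<longlonglongrightarrow> 0" by simp
    then have "e \<le> 0" by (rule LIMSEQ_le_const) (use D_ge in auto)
    then show False using e by simp
  qed
  then show ?thesis using C by (intro exI[of _ C]) blast
qed

end

section \<open>Values\<close>

lemma stopping_times_n_subset: "\<tau> \<in> stopping_times_n T t n \<Longrightarrow> \<tau> \<in> stopping_times T t"
  by (simp add: stopping_times_n_def)

lemma stopping_times_n_start:
  assumes "0 \<le> t" "t \<le> T"
  shows "(\<lambda>_. t) \<in> stopping_times_n T t n"
proof -
  have "t \<in> (\<lambda>i. max t (real i * T / 2 ^ k)) ` {0..2 ^ k}" for k
    using assms by (intro image_eqI[of _ _ 0]) auto
  then show ?thesis
    using assms stopping_times_const[of t t T] by (auto simp: stopping_times_n_def split: enat.split)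
qed


context game
begin

text \<open>Since \<open>v t = 0\<close>, the spliced path agrees with \<open>w\<close> up to time
  \<open>t\<close>, and \<open>X t\<close> sees no more of it.\<close>

lemma shift_at_start:
  assumes t: "t \<in> {0..T}" and w: "w \<in> paths T 0" and v: "v \<in> paths T t" and X: "X \<in> {g, L, U}"
  shows "X t (splice T 0 t w v) = X t w"
proof -
  have "norm (splice T 0 t w v r - w r) \<le> 0" if "r \<in> {0..t}" for r
    using that t v by (auto simp: splice_apply paths_def)
  then have "\<bar>X t (splice T 0 t w v) - X t w\<bar> \<le> \<rho>0 0"
    using t w v by (intro reg_path[OF X] splice_paths0) auto
  then show ?thesis by (simp add: modulus_zero[OF mod0])
qed

lemma running_gain_start: "running_gain t w t v = 0"
proof -
  have "AE r in lborel. indicator {t..t} r *\<^sub>R g r (splice T 0 t w v) = 0"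
    using AE_lborel_singleton[of t] by eventually_elim auto
  then show ?thesis unfolding running_gain_def set_lebesgue_integral_def by (rule integral_eq_zero_AE)
qed

lemma payoff_start:
  assumes "t \<in> {0..T}" "w \<in> paths T 0" "v \<in> paths T t" "t \<le> \<gamma> v"
  shows "payoff T g L U t w (\<lambda>_. t) \<gamma> v = L t w"
  using shift_at_start[OF assms(1-3), of L] assms(4)
  by (simp add: payoff_eq running_gain_start min_absorb1)

text \<open>A tie at time \<open>t\<close> pays \<open>L\<close>, any later \<open>\<tau>\<close>
  gets \<open>U\<close>; hence an inequality rather than an equation.\<close>

lemma payoff_stop_start:
  assumes "t \<in> {0..T}" "w \<in> paths T 0" "v \<in> paths T t" "t \<le> \<tau> v"
  shows "payoff T g L U t w \<tau> (\<lambda>_. t) v \<le> U t w"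
  using shift_at_start[OF assms(1-3), of L] shift_at_start[OF assms(1-3), of U] L_le_U[OF assms(1,2)] assms(4)
  by (simp add: payoff_eq running_gain_start min_absorb2 order_antisym_conv)

text \<open>A real \<open>SUP\<close> dominates its members only if they are bounded; the common
  dominator of all payoffs supplies the bound.\<close>

lemma payoff_values_bdd_above:
  assumes t: "t \<in> {0..T}" and w: "w \<in> paths T 0" and P: "P \<in> integrable_probs T g L U t"
    and \<gamma>: "\<gamma> \<in> stopping_times T t"
  shows "bdd_above ((\<lambda>\<tau>. \<integral>v. payoff T g L U t w \<tau> \<gamma> v \<partial>P) ` stopping_times_n T t n)"
proof -
  have PP: "P \<in> path_probs T t" using P by (simp add: integrable_probs_def)
  obtain Z where Z: "integrable P Z" "\<And>v \<tau> \<gamma>. v \<in> paths T t \<Longrightarrow> \<tau> \<in> stopping_times T t \<Longrightarrow>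
      \<gamma> \<in> stopping_times T t \<Longrightarrow> \<bar>payoff T g L U t w \<tau> \<gamma> v\<bar> \<le> Z v"
    using payoff_dominator[OF t P w] by blast
  show ?thesis
  proof (rule bdd_aboveI2)
    fix \<tau> :: "'d path \<Rightarrow> real" assume "\<tau> \<in> stopping_times_n T t n"
    then have \<tau>: "\<tau> \<in> stopping_times T t" by (rule stopping_times_n_subset)
    show "(\<integral>v. payoff T g L U t w \<tau> \<gamma> v \<partial>P) \<le> (\<integral>v. Z v \<partial>P)"
    proof (rule Bochner_Integration.integral_mono[OF payoff_integrable[OF t P w \<tau> \<gamma>] Z(1)])
      fix v assume "v \<in> space P"
      then have "v \<in> paths T t" using path_probsD(2)[OF PP] by simp
      from Z(2)[OF this \<tau> \<gamma>] show "payoff T g L U t w \<tau> \<gamma> v \<le> Z v" by simp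
    qed
  qed
qed

lemma payoff_value_le_SUP:
  assumes "t \<in> {0..T}" "w \<in> paths T 0" "P \<in> integrable_probs T g L U t"
    and "\<gamma> \<in> stopping_times T t" "\<tau> \<in> stopping_times_n T t n"
  shows "(\<integral>v. payoff T g L U t w \<tau> \<gamma> v \<partial>P) \<le>
    (SUP \<tau>\<in>stopping_times_n T t n. \<integral>v. payoff T g L U t w \<tau> \<gamma> v \<partial>P)"
  by (rule cSUP_upper[OF assms(5) payoff_values_bdd_above[OF assms(1-4)]])

text \<open>The maximising player can stop at once. The bound is free of the measure and of
  \<open>\<gamma>\<close>, so it is also the lower bound that the two real infima in the game value
  require.\<close>

lemma L_le_SUP:
  assumes t: "t \<in> {0..T}" and w: "w \<in> paths T 0" and P: "P \<in> integrable_probs T g L U t"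
    and \<gamma>: "\<gamma> \<in> stopping_times T t"
  shows "L t w \<le> (SUP \<tau>\<in>stopping_times_n T t n. \<integral>v. payoff T g L U t w \<tau> \<gamma> v \<partial>P)"
proof -
  have PP: "P \<in> path_probs T t" using P by (simp add: integrable_probs_def)
  interpret prob_space P by (rule path_probsD(1)[OF PP])
  have "(\<integral>v. payoff T g L U t w (\<lambda>_. t) \<gamma> v \<partial>P) = (\<integral>v. L t w \<partial>P)"
  proof (rule Bochner_Integration.integral_cong[OF refl])
    fix v assume "v \<in> space P"
    then have v: "v \<in> paths T t" using path_probsD(2)[OF PP] by simp
    then show "payoff T g L U t w (\<lambda>_. t) \<gamma> v = L t w"
      using stopping_times_in[OF \<gamma> v] by (intro payoff_start t w) auto
  qed
  then have "L t w = (\<integral>v. payoff T g L U t w (\<lambda>_. t) \<gamma> v \<partial>P)" by (simp add: prob_space)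
  also have "\<dots> \<le> (SUP \<tau>\<in>stopping_times_n T t n. \<integral>v. payoff T g L U t w \<tau> \<gamma> v \<partial>P)"
    using t by (intro payoff_value_le_SUP assms stopping_times_n_start) auto
  finally show ?thesis .
qed

end

locale game_class = game T g L U \<rho>0
  for T and g L U :: "real \<Rightarrow> ('d::finite) path \<Rightarrow> real" and \<rho>0 +
  fixes \<P> :: "real \<Rightarrow> 'd path \<Rightarrow> 'd path measure set"
  assumes adapted: "adapted_class T g L U \<P>"
begin

lemma
  assumes "t \<in> {0..T}" "w \<in> paths T 0"
  shows class_nonempty: "\<P> t w \<noteq> {}"
    and class_integrable: "P \<in> \<P> t w \<Longrightarrow> P \<in> integrable_probs T g L U t"
proof -
  have "\<forall>t\<in>{0..T}. \<forall>w\<in>paths T 0. \<P> t w \<noteq> {} \<and> \<P> t w \<subseteq> integrable_probs T g L U t"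
    using adapted unfolding adapted_class_def by (rule conjunct1)
  then have *: "\<P> t w \<noteq> {} \<and> \<P> t w \<subseteq> integrable_probs T g L U t"
    using assms by (elim ballE) auto
  show "\<P> t w \<noteq> {}" using * by (rule conjunct1)
  show "P \<in> \<P> t w \<Longrightarrow> P \<in> integrable_probs T g L U t" using * by (elim conjE subsetD)
qed

lemma game_value_le:
  assumes t: "t \<in> {0..T}" and w: "w \<in> paths T 0" and P: "P \<in> \<P> t w" and \<gamma>: "\<gamma> \<in> stopping_times T t"
  shows "game_value T g L U \<P> n t w \<le>
    (SUP \<tau>\<in>stopping_times_n T t n. \<integral>v. payoff T g L U t w \<tau> \<gamma> v \<partial>P)"
proof -
  let ?f = "\<lambda>P \<gamma>. SUP \<tau>\<in>stopping_times_n T t n. \<integral>v. payoff T g L U t w \<tau> \<gamma> v \<partial>P"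
  have L: "L t w \<le> ?f Q \<gamma>" if "Q \<in> \<P> t w" "\<gamma> \<in> stopping_times T t" for Q \<gamma>
    using that by (intro L_le_SUP t w class_integrable[OF t w])
  have ne: "stopping_times T t \<noteq> ({} :: ('d path \<Rightarrow> real) set)" using \<gamma> by blast
  have "game_value T g L U \<P> n t w \<le> (INF \<gamma>\<in>stopping_times T t. ?f P \<gamma>)"
    unfolding game_value_def
    by (intro cINF_lower P bdd_belowI2[where m = "L t w"] cINF_greatest ne L)
  also have "\<dots> \<le> ?f P \<gamma>"
    by (intro cINF_lower \<gamma> bdd_belowI2[where m = "L t w"] L P)
  finally show ?thesis .
qed

lemma game_value_near:
  assumes t: "t \<in> {0..T}" and w: "w \<in> paths T 0" and "0 < e"
  shows "\<exists>P\<in>\<P> t w. \<exists>\<gamma>\<in>stopping_times T t.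
    (SUP \<tau>\<in>stopping_times_n T t n. \<integral>v. payoff T g L U t w \<tau> \<gamma> v \<partial>P) < game_value T g L U \<P> n t w + e"
proof (rule ccontr)
  assume contr: "\<not> ?thesis"
  have ne: "stopping_times T t \<noteq> ({} :: ('d path \<Rightarrow> real) set)"
    using stopping_times_const[of t t T] t by fastforce
  have "game_value T g L U \<P> n t w + e \<le> game_value T g L U \<P> n t w"
    using contr unfolding game_value_def[of T g L U \<P> n t w]
    by (intro cINF_greatest ne class_nonempty t w) (meson not_le)
  then show False using \<open>0 < e\<close> by simp
qed

lemma L_le_game_value:
  assumes t: "t \<in> {0..T}" and w: "w \<in> paths T 0"
  shows "L t w \<le> game_value T g L U \<P> n t w"
proof -
  have ne: "stopping_times T t \<noteq> ({} :: ('d path \<Rightarrow> real) set)"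
    using stopping_times_const[of t t T] t by fastforce
  show ?thesis unfolding game_value_def
    by (intro cINF_greatest ne class_nonempty L_le_SUP class_integrable[OF t w] t w)
qed

text \<open>The minimising player can stop at once. Together with the lower bound by
  \<open>L\<close>, this puts the value under the same dominator as the payoffs.\<close>

lemma game_value_le_U:
  assumes t: "t \<in> {0..T}" and w: "w \<in> paths T 0"
  shows "game_value T g L U \<P> n t w \<le> U t w"
proof -
  obtain P where P: "P \<in> \<P> t w" using class_nonempty[OF t w] by blast
  have Pi: "P \<in> integrable_probs T g L U t" by (rule class_integrable[OF t w P])
  then have PP: "P \<in> path_probs T t" by (simp add: integrable_probs_def)
  interpret prob_space P by (rule path_probsD(1)[OF PP])
  have c: "(\<lambda>_. t) \<in> stopping_times T t" using t by (intro stopping_times_const) auto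
  have "game_value T g L U \<P> n t w \<le>
      (SUP \<tau>\<in>stopping_times_n T t n. \<integral>v. payoff T g L U t w \<tau> (\<lambda>_. t) v \<partial>P)"
    by (rule game_value_le[OF t w P c])
  also have "\<dots> \<le> U t w"
  proof (rule cSUP_least)
    show "stopping_times_n T t n \<noteq> ({} :: ('d path \<Rightarrow> real) set)"
      using stopping_times_n_start[of t T n] t by fastforce
    fix \<tau> :: "'d path \<Rightarrow> real" assume "\<tau> \<in> stopping_times_n T t n"
    then have \<tau>: "\<tau> \<in> stopping_times T t" by (rule stopping_times_n_subset)
    have "(\<integral>v. payoff T g L U t w \<tau> (\<lambda>_. t) v \<partial>P) \<le> (\<integral>v. U t w \<partial>P)"
    proof (rule Bochner_Integration.integral_mono[OF payoff_integrable[OF t Pi w \<tau> c]])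
      fix v assume "v \<in> space P"
      then have v: "v \<in> paths T t" using path_probsD(2)[OF PP] by simp
      then show "payoff T g L U t w \<tau> (\<lambda>_. t) v \<le> U t w"
        using stopping_times_in[OF \<tau> v] by (intro payoff_stop_start t w) auto
    qed simp
    then show "(\<integral>v. payoff T g L U t w \<tau> (\<lambda>_. t) v \<partial>P) \<le> U t w" by (simp add: prob_space)
  qed
  finally show ?thesis .
qed

end

section \<open>Pasting\<close>

text \<open>Dominated convergence, as each point leaves the sets for good. It serves to discard
  parts of the path space at a small cost.\<close>

lemma integral_indicator_tendsto_zero:
  fixes Z :: "'a \<Rightarrow> real"
  assumes Z: "integrable P Z" and B: "\<And>i. B i \<in> sets P"
    and ev: "\<And>x. x \<in> space P \<Longrightarrow> eventually (\<lambda>i. x \<notin> B i) sequentially"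
  shows "(\<lambda>i. \<integral>x. indicator (B i) x * Z x \<partial>P) \<longlonglongrightarrow> 0"
proof -
  have "(\<lambda>i. \<integral>x. indicator (B i) x * Z x \<partial>P) \<longlonglongrightarrow> (\<integral>x. 0 \<partial>P)"
  proof (rule integral_dominated_convergence[where w = "\<lambda>x. \<bar>Z x\<bar>"])
    show "(\<lambda>x. indicator (B i) x * Z x) \<in> borel_measurable P" for i using B Z by measurable
    show "AE x in P. (\<lambda>i. indicator (B i) x * Z x) \<longlonglongrightarrow> 0"
    proof (rule AE_I2)
      fix x assume "x \<in> space P"
      from ev[OF this] have "eventually (\<lambda>i. indicator (B i) x * Z x = 0) sequentially"
        by eventually_elim simp
      then show "(\<lambda>i. indicator (B i) x * Z x) \<longlonglongrightarrow> 0" by (rule tendsto_eventually)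
    qed
    show "AE x in P. norm (indicator (B i) x * Z x) \<le> \<bar>Z x\<bar>" for i
      by (auto simp: indicator_def)
  qed (use Z in auto)
  then show ?thesis by simp
qed

text \<open>The data of the inequality are fixed, with \<open>t < s\<close> strict as the pasting
  condition demands; the case \<open>t = s\<close> is left to the final theorem. Continuity of the
  value is kept at time \<open>s\<close>, where it makes the value measurable and compares the paths
  of one cell.\<close>

locale game_dpp = game_class T g L U \<rho>0 \<P>
  for T and g L U :: "real \<Rightarrow> ('d::finite) path \<Rightarrow> real" and \<rho>0
    and \<P> :: "real \<Rightarrow> 'd path \<Rightarrow> 'd path measure set" +
  fixes n :: enat and \<rho>1 :: "real \<Rightarrow> real" and t s :: real and w :: "'d path"
  assumes mod1: "modulus_of_continuity \<rho>1"
    and value_cont: "\<And>w1 w2. w1 \<in> paths T 0 \<Longrightarrow> w2 \<in> paths T 0 \<Longrightarrow>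
      \<bar>game_value T g L U \<P> n s w1 - game_value T g L U \<P> n s w2\<bar> \<le> \<rho>1 (sup_norm 0 s (\<lambda>r. w1 r - w2 r))"
    and n: "1 \<le> n" and t0: "0 \<le> t" and ts: "t < s" and sT: "s \<le> T" and w: "w \<in> paths T 0"
begin

abbreviation R :: "('d path \<Rightarrow> real) \<Rightarrow> ('d path \<Rightarrow> real) \<Rightarrow> 'd path \<Rightarrow> real" where
  "R \<tau> \<gamma> v \<equiv> payoff T g L U t w \<tau> \<gamma> v"

definition VS :: "'d path \<Rightarrow> real" where
  "VS v = game_value T g L U \<P> n s (splice T 0 t w v)"

text \<open>The inner supremum of the pasting condition as a function of the path \<open>v\<close>,
  while the measure and the minimising player's stopping time stay fixed over a block.\<close>

definition sup_payoff :: "'d path measure \<Rightarrow> ('d path \<Rightarrow> real) \<Rightarrow> 'd path \<Rightarrow> real" where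
  "sup_payoff Q p v = (SUP \<sigma>\<in>stopping_times_n T s n. \<integral>u. payoff T g L U s (splice T 0 t w v) \<sigma> p u \<partial>Q)"

lemma t_in: "t \<in> {0..T}" and s_in: "s \<in> {0..T}" "s \<in> {t..T}"
  using t0 ts sT by auto

lemma spliced: "v \<in> paths T t \<Longrightarrow> splice T 0 t w v \<in> paths T 0"
  by (rule splice_paths0[OF t_in w])

lemma spliced_diff:
  assumes "0 \<le> d" "\<And>r. r \<in> {t..s} \<Longrightarrow> norm (v r - v' r) \<le> d" "r \<in> {0..s}"
  shows "norm (splice T 0 t w v r - splice T 0 t w v' r) \<le> d"
  using splice_diff_le[OF t_in sT assms(3,1), of w w 0 v v'] assms(2) by simp

lemma VS_diff:
  assumes "v \<in> paths T t" "v' \<in> paths T t" "0 \<le> d" "\<And>r. r \<in> {t..s} \<Longrightarrow> norm (v r - v' r) \<le> d"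
  shows "\<bar>VS v - VS v'\<bar> \<le> \<rho>1 d"
proof -
  have "\<bar>VS v - VS v'\<bar> \<le> \<rho>1 (sup_norm 0 s (\<lambda>r. splice T 0 t w v r - splice T 0 t w v' r))"
    unfolding VS_def by (intro value_cont spliced assms)
  also have "\<dots> \<le> \<rho>1 d"
  proof (rule modulus_mono[OF mod1])
    show "0 \<le> sup_norm 0 s (\<lambda>r. splice T 0 t w v r - splice T 0 t w v' r)"
      using s_in by (intro sup_norm_nonneg[where c = d] spliced_diff[OF assms(3,4)]) auto
    show "sup_norm 0 s (\<lambda>r. splice T 0 t w v r - splice T 0 t w v' r) \<le> d"
      using s_in by (intro sup_norm_le spliced_diff[OF assms(3,4)]) auto
  qed
  finally show ?thesis .
qed

lemma VS_measurable: "VS \<in> borel_measurable (raw_filtration T t s)"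
proof (rule borel_measurable_of_modulus[where K = 1, OF sT _ _ mod1])
  fix v v' :: "'d path" and d :: real
  assume "v \<in> paths T t" "v' \<in> paths T t" "0 < d" "\<And>r. r \<in> {t..s} \<Longrightarrow> norm (v r - v' r) \<le> d"
  then show "\<bar>VS v - VS v'\<bar> \<le> 1 * \<rho>1 d" using VS_diff[of v v' d] by simp
qed simp

text \<open>\<open>Q\<close> ranges over all integrable measures at \<open>s\<close>: a measure
  selected at one path is applied to the other paths of its cell, where it may lie outside the
  class. Every \<open>\<sigma>\<close> loses at most the modulus of the payoff, hence so does the
  supremum.\<close>

lemma sup_payoff_le:
  assumes Q: "Q \<in> integrable_probs T g L U s" and p: "p \<in> stopping_times T s"
    and v: "v \<in> paths T t" "v' \<in> paths T t" and d: "0 \<le> d" "\<And>r. r \<in> {t..s} \<Longrightarrow> norm (v r - v' r) \<le> d"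
  shows "sup_payoff Q p v \<le> sup_payoff Q p v' + (1 + T) * \<rho>0 d"
  unfolding sup_payoff_def[of Q p v]
proof (rule cSUP_least)
  show "stopping_times_n T s n \<noteq> ({} :: ('d path \<Rightarrow> real) set)"
    using stopping_times_n_start[of s T n] s_in by fastforce
  fix \<sigma> :: "'d path \<Rightarrow> real" assume \<sigma>n: "\<sigma> \<in> stopping_times_n T s n"
  then have \<sigma>: "\<sigma> \<in> stopping_times T s" by (rule stopping_times_n_subset)
  have QQ: "Q \<in> path_probs T s" using Q by (simp add: integrable_probs_def)
  interpret prob_space Q by (rule path_probsD(1)[OF QQ])
  have i: "integrable Q (payoff T g L U s (splice T 0 t w v) \<sigma> p)"
    "integrable Q (payoff T g L U s (splice T 0 t w v') \<sigma> p)"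
    by (intro payoff_integrable[OF s_in(1) Q spliced \<sigma> p] v)+
  have "(\<integral>u. payoff T g L U s (splice T 0 t w v) \<sigma> p u \<partial>Q) \<le>
      (\<integral>u. payoff T g L U s (splice T 0 t w v') \<sigma> p u + (1 + T) * \<rho>0 d \<partial>Q)"
  proof (rule Bochner_Integration.integral_mono[OF i(1)])
    show "integrable Q (\<lambda>u. payoff T g L U s (splice T 0 t w v') \<sigma> p u + (1 + T) * \<rho>0 d)"
      using i(2) by simp
    fix u assume "u \<in> space Q"
    then have "u \<in> paths T s" using path_probsD(2)[OF QQ] by simp
    from payoff_diff_le[OF s_in(1) spliced[OF v(1)] spliced[OF v(2)] this \<sigma> p d(1) spliced_diff[OF d]]
    show "payoff T g L U s (splice T 0 t w v) \<sigma> p u \<le>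
        payoff T g L U s (splice T 0 t w v') \<sigma> p u + (1 + T) * \<rho>0 d" by linarith
  qed
  also have "\<dots> = (\<integral>u. payoff T g L U s (splice T 0 t w v') \<sigma> p u \<partial>Q) + (1 + T) * \<rho>0 d"
    using i(2) by (simp add: prob_space)
  also have "(\<integral>u. payoff T g L U s (splice T 0 t w v') \<sigma> p u \<partial>Q) \<le> sup_payoff Q p v'"
    unfolding sup_payoff_def by (rule payoff_value_le_SUP[OF s_in(1) spliced[OF v(2)] Q p \<sigma>n])
  finally show "(\<integral>u. payoff T g L U s (splice T 0 t w v) \<sigma> p u \<partial>Q) \<le>
      sup_payoff Q p v' + (1 + T) * \<rho>0 d" by simp
qed

lemma sup_payoff_measurable:
  assumes Q: "Q \<in> integrable_probs T g L U s" and p: "p \<in> stopping_times T s"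
  shows "sup_payoff Q p \<in> borel_measurable (raw_filtration T t s)"
proof (rule borel_measurable_of_modulus[where K = "1 + T", OF sT _ _ mod0])
  fix v v' :: "'d path" and d :: real
  assume *: "v \<in> paths T t" "v' \<in> paths T t" "0 < d" "\<And>r. r \<in> {t..s} \<Longrightarrow> norm (v r - v' r) \<le> d"
  then have "sup_payoff Q p v \<le> sup_payoff Q p v' + (1 + T) * \<rho>0 d"
    by (intro sup_payoff_le[OF Q p]) auto
  moreover have "sup_payoff Q p v' \<le> sup_payoff Q p v + (1 + T) * \<rho>0 d"
    using * by (intro sup_payoff_le[OF Q p]) (auto simp: norm_minus_commute)
  ultimately show "\<bar>sup_payoff Q p v - sup_payoff Q p v'\<bar> \<le> (1 + T) * \<rho>0 d" by linarith
qed (use T_pos in simp)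

text \<open>One \<open>e\<close> is spent on a near-optimal measure and stopping time, the other on
  replacing that stopping time by a member of the countable family. The family is common to all
  paths; the measure and the index are picked by choice, with no measurability in
  \<open>v\<close>.\<close>

lemma near_optimal_selection:
  assumes "0 < e"
  shows "\<exists>(C :: nat \<Rightarrow> 'd path \<Rightarrow> real) Q mi. (\<forall>i. C i \<in> stopping_times T s) \<and>
    (\<forall>v\<in>paths T t. Q v \<in> \<P> s (splice T 0 t w v) \<and> sup_payoff (Q v) (C (mi v)) v \<le> VS v + 2 * e)"
proof -
  from countable_near_optimal[OF s_in(1)]
  obtain C :: "nat \<Rightarrow> 'd path \<Rightarrow> real" where C: "\<forall>i. C i \<in> stopping_times T s"
    and near: "\<forall>P\<in>integrable_probs T g L U s. \<forall>w\<in>paths T 0. \<forall>\<gamma>\<in>stopping_times T s. \<forall>e>0.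
      \<exists>i. \<forall>\<tau>\<in>stopping_times T s. (\<integral>v. payoff T g L U s w \<tau> (C i) v \<partial>P) \<le>
        (\<integral>v. payoff T g L U s w \<tau> \<gamma> v \<partial>P) + e"
    by (elim exE conjE)
  have "\<exists>Q i. Q \<in> \<P> s (splice T 0 t w v) \<and> sup_payoff Q (C i) v \<le> VS v + 2 * e"
    if v: "v \<in> paths T t" for v
  proof -
    let ?x = "splice T 0 t w v"
    have x: "?x \<in> paths T 0" by (rule spliced[OF v])
    from game_value_near[OF s_in(1) x assms, of n]
    obtain Q \<gamma> where Q: "Q \<in> \<P> s ?x" and \<gamma>: "\<gamma> \<in> stopping_times T s"
      and le: "(SUP \<tau>\<in>stopping_times_n T s n. \<integral>u. payoff T g L U s ?x \<tau> \<gamma> u \<partial>Q) < VS v + e"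
      unfolding VS_def by (elim bexE)
    have Qi: "Q \<in> integrable_probs T g L U s" by (rule class_integrable[OF s_in(1) x Q])
    from near[rule_format, OF Qi x \<gamma> assms]
    obtain i where i: "\<forall>\<tau>\<in>stopping_times T s. (\<integral>u. payoff T g L U s ?x \<tau> (C i) u \<partial>Q) \<le>
        (\<integral>u. payoff T g L U s ?x \<tau> \<gamma> u \<partial>Q) + e" ..
    have "sup_payoff Q (C i) v \<le> VS v + 2 * e"
      unfolding sup_payoff_def
    proof (rule cSUP_least)
      show "stopping_times_n T s n \<noteq> ({} :: ('d path \<Rightarrow> real) set)"
        using stopping_times_n_start[of s T n] s_in by fastforce
      fix \<sigma> :: "'d path \<Rightarrow> real" assume \<sigma>n: "\<sigma> \<in> stopping_times_n T s n"
      show "(\<integral>u. payoff T g L U s ?x \<sigma> (C i) u \<partial>Q) \<le> VS v + 2 * e"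
        using bspec[OF i stopping_times_n_subset[OF \<sigma>n]] le
          payoff_value_le_SUP[OF s_in(1) x Qi \<gamma> \<sigma>n] by linarith
    qed
    then show ?thesis using Q by (intro exI conjI)
  qed
  then have "\<forall>v\<in>paths T t. \<exists>Qi. fst Qi \<in> \<P> s (splice T 0 t w v) \<and> sup_payoff (fst Qi) (C (snd Qi)) v \<le> VS v + 2 * e"
    by (metis fst_conv snd_conv)
  from bchoice[OF this] obtain h where h: "\<forall>v\<in>paths T t. fst (h v) \<in> \<P> s (splice T 0 t w v) \<and>
      sup_payoff (fst (h v)) (C (snd (h v))) v \<le> VS v + 2 * e" ..
  then show ?thesis
    using C by (intro exI[of _ C] exI[of _ "\<lambda>v. fst (h v)"] exI[of _ "\<lambda>v. snd (h v)"] conjI)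
qed

end

lemma integrable_indicator_mult:
  fixes f :: "'a \<Rightarrow> real"
  assumes "integrable M f" "B \<in> sets M"
  shows "integrable M (\<lambda>x. indicator B x * f x)"
  using integrable_mult_indicator[OF assms(2,1)] by simp

lemma
  fixes f :: "'a \<Rightarrow> real" and h k :: "nat \<Rightarrow> 'a \<Rightarrow> real"
  assumes f: "integrable M f" and h: "\<And>j. j \<in> J \<Longrightarrow> integrable M (h j)"
    and k: "\<And>j. j \<in> J \<Longrightarrow> integrable M (k j)"
  shows integrable_add_sum: "integrable M (\<lambda>v. f v + (\<Sum>j\<in>J. h j v + k j v))"
    and integral_add_sum: "(\<integral>v. f v + (\<Sum>j\<in>J. h j v + k j v) \<partial>M) =
      (\<integral>v. f v \<partial>M) + (\<Sum>j\<in>J. (\<integral>v. h j v \<partial>M) + (\<integral>v. k j v \<partial>M))"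
proof -
  have hk: "integrable M (\<lambda>v. h j v + k j v)" if "j \<in> J" for j
    by (rule Bochner_Integration.integrable_add[OF h[OF that] k[OF that]])
  then have S: "integrable M (\<lambda>v. \<Sum>j\<in>J. h j v + k j v)"
    by (rule Bochner_Integration.integrable_sum)
  show "integrable M (\<lambda>v. f v + (\<Sum>j\<in>J. h j v + k j v))"
    by (rule Bochner_Integration.integrable_add[OF f S])
  have "(\<integral>v. f v + (\<Sum>j\<in>J. h j v + k j v) \<partial>M) =
      (\<integral>v. f v \<partial>M) + (\<integral>v. (\<Sum>j\<in>J. h j v + k j v) \<partial>M)"
    by (rule Bochner_Integration.integral_add[OF f S])
  also have "(\<integral>v. (\<Sum>j\<in>J. h j v + k j v) \<partial>M) = (\<Sum>j\<in>J. \<integral>v. h j v + k j v \<partial>M)"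
    by (rule Bochner_Integration.integral_sum[OF hk])
  also have "\<dots> = (\<Sum>j\<in>J. (\<integral>v. h j v \<partial>M) + (\<integral>v. k j v \<partial>M))"
    by (rule sum.cong[OF refl Bochner_Integration.integral_add[OF h k]])
  finally show "(\<integral>v. f v + (\<Sum>j\<in>J. h j v + k j v) \<partial>M) =
      (\<integral>v. f v \<partial>M) + (\<Sum>j\<in>J. (\<integral>v. h j v \<partial>M) + (\<integral>v. k j v \<partial>M))" .
qed

text \<open>The hypothesis uses one label \<open>i\<close> on all blocks, the conclusion lets the
  label vary with the block. Intersecting the event with the blocks labelled \<open>i\<close>
  silences the others; summing over the labels then costs \<open>r\<close> once per label, not once
  per block.\<close>

lemma sum_integral_grouped:
  fixes f h :: "nat \<Rightarrow> nat \<Rightarrow> 'a \<Rightarrow> real" and m :: "nat \<Rightarrow> nat"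
  assumes disj: "disjoint_family_on \<A> {1..l}" and m: "\<And>j. j \<in> {1..l} \<Longrightarrow> m j < M"
    and \<A>: "\<And>j. j \<in> {1..l} \<Longrightarrow> \<A> j \<in> sets F" and A: "A \<in> sets F"
    and H: "\<And>i B. B \<in> sets F \<Longrightarrow>
      (\<Sum>j=1..l. \<integral>v. indicator (B \<inter> \<A> j) v * f i j v \<partial>N) \<le>
      (\<Sum>j=1..l. \<integral>v. indicator (B \<inter> \<A> j) v * h i j v \<partial>P) + r"
  shows "(\<Sum>j=1..l. \<integral>v. indicator (A \<inter> \<A> j) v * f (m j) j v \<partial>N) \<le>
    (\<Sum>j=1..l. \<integral>v. indicator (A \<inter> \<A> j) v * h (m j) j v \<partial>P) + real M * r"
proof -
  define B where "B i = A \<inter> (\<Union>j\<in>{j \<in> {1..l}. m j = i}. \<A> j)" for i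
  have B: "B i \<in> sets F" for i unfolding B_def using A \<A> by (intro sets.Int sets.finite_UN) auto
  have Bj: "B i \<inter> \<A> j = (if m j = i then A \<inter> \<A> j else {})" if "j \<in> {1..l}" for i j
  proof (cases "m j = i")
    case False
    have "\<A> j' \<inter> \<A> j = {}" if "j' \<in> {1..l}" "m j' = i" for j'
      using disjoint_family_onD[OF disj that(1) \<open>j \<in> {1..l}\<close>] False that(2) by auto
    then show ?thesis using False by (auto simp: B_def)
  qed (use that in \<open>auto simp: B_def\<close>)
  have eq: "(\<Sum>i<M. \<Sum>j=1..l. \<integral>v. indicator (B i \<inter> \<A> j) v * k i j v \<partial>K) =
      (\<Sum>j=1..l. \<integral>v. indicator (A \<inter> \<A> j) v * k (m j) j v \<partial>K)"
    for k :: "nat \<Rightarrow> nat \<Rightarrow> 'a \<Rightarrow> real" and K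
  proof -
    have "(\<Sum>j=1..l. \<integral>v. indicator (B i \<inter> \<A> j) v * k i j v \<partial>K) =
        (\<Sum>j\<in>{j \<in> {1..l}. m j = i}. \<integral>v. indicator (A \<inter> \<A> j) v * k (m j) j v \<partial>K)" for i
    proof -
      have "(\<Sum>j=1..l. \<integral>v. indicator (B i \<inter> \<A> j) v * k i j v \<partial>K) =
          (\<Sum>j=1..l. if m j = i then \<integral>v. indicator (A \<inter> \<A> j) v * k (m j) j v \<partial>K else 0)"
        by (rule sum.cong[OF refl]) (simp add: Bj)
      also have "\<dots> = (\<Sum>j\<in>{j \<in> {1..l}. m j = i}. \<integral>v. indicator (A \<inter> \<A> j) v * k (m j) j v \<partial>K)"
        by (subst sum.inter_filter) auto
      finally show ?thesis .
    qed
    then show ?thesis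
      using sum.group[of "{1..l}" "{..<M}" m "\<lambda>j. \<integral>v. indicator (A \<inter> \<A> j) v * k (m j) j v \<partial>K"] m
      by (simp add: image_subset_iff)
  qed
  have "(\<Sum>i<M. \<Sum>j=1..l. \<integral>v. indicator (B i \<inter> \<A> j) v * f i j v \<partial>N) \<le>
      (\<Sum>i<M. (\<Sum>j=1..l. \<integral>v. indicator (B i \<inter> \<A> j) v * h i j v \<partial>P) + r)"
    by (intro sum_mono H B)
  then show ?thesis unfolding sum.distrib eq by simp
qed

section \<open>The payoff of the pasted pair against one opponent\<close>

context game_dpp
begin

definition stopped_payoff :: "('d path \<Rightarrow> real) \<Rightarrow> ('d path \<Rightarrow> real) \<Rightarrow> 'd path \<Rightarrow> real" where
  "stopped_payoff \<tau> \<gamma> v = (if min (\<tau> v) (\<gamma> v) < s then R \<tau> \<gamma> v else VS v + running_gain t w s v)"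

text \<open>The value at \<open>s\<close> lies between \<open>L\<close> and \<open>U\<close>, so the
  dominator of the payoffs covers it too.\<close>

lemma dominator_bounds:
  assumes bd: "\<And>v a b. v \<in> paths T t \<Longrightarrow> a \<in> {t..T} \<Longrightarrow> b \<in> {t..T} \<Longrightarrow>
      \<bar>running_gain t w a v\<bar> + \<bar>L b (splice T 0 t w v)\<bar> \<le> Z v \<and>
      \<bar>running_gain t w a v\<bar> + \<bar>U b (splice T 0 t w v)\<bar> \<le> Z v"
    and v: "v \<in> paths T t" and \<tau>: "\<tau> \<in> stopping_times T t" "\<gamma> \<in> stopping_times T t"
  shows "\<bar>R \<tau> \<gamma> v\<bar> \<le> Z v" "\<bar>VS v + running_gain t w s v\<bar> \<le> Z v" "\<bar>stopped_payoff \<tau> \<gamma> v\<bar> \<le> Z v"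
proof -
  have i: "\<tau> v \<in> {t..T}" "\<gamma> v \<in> {t..T}" using v \<tau> by (auto dest: stopping_times_in)
  show 1: "\<bar>R \<tau> \<gamma> v\<bar> \<le> Z v"
    using bd[OF v i(1) i(1)] bd[OF v i(2) i(2)] by (auto simp: payoff_eq min_def)
  have "L s (splice T 0 t w v) \<le> VS v" "VS v \<le> U s (splice T 0 t w v)"
    unfolding VS_def using L_le_game_value[OF s_in(1) spliced[OF v]] game_value_le_U[OF s_in(1) spliced[OF v]] .
  then show 2: "\<bar>VS v + running_gain t w s v\<bar> \<le> Z v"
    using bd[OF v s_in(2) s_in(2)] by linarith
  show "\<bar>stopped_payoff \<tau> \<gamma> v\<bar> \<le> Z v" using 1 2 by (simp add: stopped_payoff_def)
qed

lemma filtration_s_T: "f \<in> borel_measurable (raw_filtration T t s) \<Longrightarrow> f \<in> borel_measurable (raw_filtration T t T)"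
  by (rule borel_measurable_raw_filtration_mono[OF _ sT])

lemma stopped_payoff_measurable:
  assumes \<tau>: "\<tau> \<in> stopping_times T t" and \<gamma>: "\<gamma> \<in> stopping_times T t"
  shows "stopped_payoff \<tau> \<gamma> \<in> borel_measurable (raw_filtration T t T)"
proof -
  have [measurable]: "\<tau> \<in> borel_measurable (raw_filtration T t T)" "\<gamma> \<in> borel_measurable (raw_filtration T t T)"
    "R \<tau> \<gamma> \<in> borel_measurable (raw_filtration T t T)" "VS \<in> borel_measurable (raw_filtration T t T)"
    "running_gain t w s \<in> borel_measurable (raw_filtration T t T)"
    using borel_measurable_stopping_time[OF \<tau>] borel_measurable_stopping_time[OF \<gamma>]
      payoff_measurable[OF t_in w \<tau> \<gamma>] filtration_s_T[OF VS_measurable]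
      filtration_s_T[OF running_gain_adapted[OF t_in s_in(2) w]] .
  show ?thesis unfolding stopped_payoff_def[abs_def] by measurable
qed

lemma stopped_payoff_integrable:
  assumes P: "P \<in> integrable_probs T g L U t"
    and \<tau>: "\<tau> \<in> stopping_times T t" and \<gamma>: "\<gamma> \<in> stopping_times T t"
  shows "integrable P (stopped_payoff \<tau> \<gamma>)"
proof -
  have PP: "P \<in> path_probs T t" using P by (simp add: integrable_probs_def)
  from integrable_dominator[OF t_in P w] obtain Z where Z: "integrable P Z"
    and bd: "\<forall>v\<in>paths T t. \<forall>a\<in>{t..T}. \<forall>b\<in>{t..T}.
      \<bar>running_gain t w a v\<bar> + \<bar>L b (splice T 0 t w v)\<bar> \<le> Z v \<and>
      \<bar>running_gain t w a v\<bar> + \<bar>U b (splice T 0 t w v)\<bar> \<le> Z v" by (elim exE conjE)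
  have "stopped_payoff \<tau> \<gamma> \<in> borel_measurable P"
    using stopped_payoff_measurable[OF \<tau> \<gamma>] measurable_cong_sets[OF path_probsD(3)[OF PP] refl] by blast
  then show ?thesis
  proof (rule Bochner_Integration.integrable_bound[OF Z], intro AE_I2)
    fix v assume "v \<in> space P"
    then have "v \<in> paths T t" using path_probsD(2)[OF PP] by simp
    from dominator_bounds(3)[OF bd[rule_format] this \<tau> \<gamma>]
    show "norm (stopped_payoff \<tau> \<gamma> v) \<le> norm (Z v)" by simp
  qed
qed

text \<open>The pasting inequality admits only stopping times from \<open>s\<close> on. Earlier ones
  are moved to \<open>T\<close>, which lies on every grid, whereas \<open>s\<close> may not; whether
  to move is known at time \<open>s\<close>.\<close>

lemma delayed_stopping_time:
  fixes \<tau> :: "'d path \<Rightarrow> real"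
  assumes \<tau>: "\<tau> \<in> stopping_times_n T t n"
  shows "(\<lambda>v. if \<tau> v < s then T else \<tau> v) \<in> stopping_times_from T t s n"
proof -
  let ?\<tau> = "\<lambda>v. if \<tau> v < s then T else \<tau> v"
  have \<tau>': "\<tau> \<in> stopping_times T t" by (rule stopping_times_n_subset[OF \<tau>])
  have st: "?\<tau> \<in> stopping_times T t"
  proof (rule stopping_timesI)
    fix r assume r: "t \<le> r" "r < T"
    have "{v \<in> paths T t. ?\<tau> v \<le> r} = {v \<in> paths T t. \<tau> v \<le> r} - {v \<in> paths T t. \<tau> v < s}"
      using r by auto
    moreover have "\<dots> \<in> sets (raw_filtration T t r)"
    proof (cases "r < s")
      case True
      then have empty: "{v \<in> paths T t. \<tau> v \<le> r} - {v \<in> paths T t. \<tau> v < s} = {}" by auto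
      show ?thesis unfolding empty by simp
    next
      case False
      then show ?thesis
        using stopping_times_less[OF \<tau>', of s] sets_raw_filtration_mono[of s r T t]
        by (intro sets.Diff stopping_times_le[OF \<tau>' order_refl]) auto
    qed
    ultimately show "{v \<in> paths T t. ?\<tau> v \<le> r} \<in> sets (raw_filtration T t r)" by simp
  next
    fix v :: "'d path" assume "v \<in> paths T t"
    from stopping_times_in[OF \<tau>' this] show "?\<tau> v \<in> {t..T}" by auto
  qed
  have "T \<in> (\<lambda>i. max t (real i * T / 2 ^ k)) ` {0..2 ^ k}" for k
    using t_in by (intro image_eqI[of _ _ "2 ^ k"]) auto
  then show ?thesis
    using st \<tau> sT by (auto simp: stopping_times_from_def stopping_times_n_def split: enat.splits)
qed

text \<open>On block 0 the measure and \<open>\<gamma>\<close> are unchanged. On the other blocks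
  the part \<open>\<tau> < s\<close> is known at time \<open>s\<close>, where \<open>Ph\<close> and
  \<open>P\<close> agree, and the part \<open>s \<le> \<tau>\<close> is handled by the pasting
  inequality. The term with \<open>2 * Z\<close> pays for the paths of block 0 with
  \<open>s \<le> \<gamma>\<close>, where the payoff and \<open>stopped_payoff\<close> may
  differ.\<close>

lemma pasted_payoff_le:
  fixes b :: "'d path \<Rightarrow> nat"
  assumes P: "P \<in> integrable_probs T g L U t" and Ph: "Ph \<in> integrable_probs T g L U t"
    and b: "\<And>j. {v \<in> paths T t. b v = j} \<in> sets (raw_filtration T t s)" and bl: "\<And>v. b v \<le> l"
    and \<gamma>: "\<gamma> \<in> stopping_times T t" and b\<gamma>: "\<And>v. v \<in> paths T t \<Longrightarrow> b v \<noteq> 0 \<Longrightarrow> s \<le> \<gamma> v"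
    and q: "\<And>j. j \<in> {1..l} \<Longrightarrow> q j \<in> stopping_times_from T t s \<infinity>"
    and \<gamma>h_st: "(\<lambda>v. if b v = 0 then \<gamma> v else q (b v) v) \<in> stopping_times T t"
    and on0: "\<And>A. A \<in> sets (raw_filtration T t T) \<Longrightarrow>
      emeasure Ph (A \<inter> {v \<in> paths T t. b v = 0}) = emeasure P (A \<inter> {v \<in> paths T t. b v = 0})"
    and onj: "\<And>A j. j \<in> {1..l} \<Longrightarrow> A \<in> sets (raw_filtration T t s) \<Longrightarrow>
      emeasure Ph (A \<inter> {v \<in> paths T t. b v = j}) = emeasure P (A \<inter> {v \<in> paths T t. b v = j})"
    and Z: "integrable P Z"
    and bd: "\<And>v a b. v \<in> paths T t \<Longrightarrow> a \<in> {t..T} \<Longrightarrow> b \<in> {t..T} \<Longrightarrow>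
      \<bar>running_gain t w a v\<bar> + \<bar>L b (splice T 0 t w v)\<bar> \<le> Z v \<and>
      \<bar>running_gain t w a v\<bar> + \<bar>U b (splice T 0 t w v)\<bar> \<le> Z v"
    and pasted: "\<And>A \<tau>. A \<in> sets (raw_filtration T t s) \<Longrightarrow> \<tau> \<in> stopping_times_from T t s n \<Longrightarrow>
      (\<Sum>j=1..l. \<integral>v. indicator (A \<inter> {v \<in> paths T t. b v = j}) v * R \<tau> (q j) v \<partial>Ph) \<le>
      (\<Sum>j=1..l. \<integral>v. indicator (A \<inter> {v \<in> paths T t. b v = j}) v * (VS v + running_gain t w s v) \<partial>P) + r"
    and \<tau>n: "\<tau> \<in> stopping_times_n T t n"
  shows "(\<integral>v. R \<tau> (\<lambda>v. if b v = 0 then \<gamma> v else q (b v) v) v \<partial>Ph) \<le>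
    (\<integral>v. stopped_payoff \<tau> \<gamma> v \<partial>P) +
    (\<integral>v. indicator {v \<in> paths T t. b v = 0 \<and> s \<le> \<gamma> v} v * (2 * Z v) \<partial>P) + r"
proof -
  define \<A> where "\<A> j = {v \<in> paths T t. b v = j}" for j
  define E where "E = {v \<in> paths T t. \<tau> v < s}"
  define E' where "E' = {v \<in> paths T t. s \<le> \<tau> v}"
  define \<gamma>h where "\<gamma>h v = (if b v = 0 then \<gamma> v else q (b v) v)" for v
  define \<tau>' where "\<tau>' v = (if \<tau> v < s then T else \<tau> v)" for v
  \<comment> \<open>The payoff for \<open>\<tau> v < s\<close> on the blocks from 1 on: the
    minimising player is at \<open>s\<close> or later, so \<open>L\<close> is paid. The cap at
    \<open>s\<close> makes it measurable at time \<open>s\<close> on the whole space.\<close>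
  define H where "H v = running_gain t w (min (\<tau> v) s) v + L (min (\<tau> v) s) (splice T 0 t w v)" for v
  define K where "K v = VS v + running_gain t w s v" for v
  let ?F = "raw_filtration T t s :: 'd path measure"
  let ?FT = "raw_filtration T t T :: 'd path measure"
  have \<tau>: "\<tau> \<in> stopping_times T t" by (rule stopping_times_n_subset[OF \<tau>n])
  have PP: "P \<in> path_probs T t" and PPh: "Ph \<in> path_probs T t"
    using P Ph by (auto simp: integrable_probs_def)
  note spP = path_probsD(2)[OF PP] and spPh = path_probsD(2)[OF PPh]
  note setsP = path_probsD(3)[OF PP] and setsPh = path_probsD(3)[OF PPh]
  have sub: "sets ?F \<subseteq> sets ?FT" by (rule sets_raw_filtration_mono[OF sT])
  have \<A>: "\<A> j \<in> sets ?F" for j unfolding \<A>_def by (rule b)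
  have E: "E \<in> sets ?F" unfolding E_def by (rule stopping_times_less[OF \<tau>])
  have E'_eq: "E' = space ?F - E" by (auto simp: E_def E'_def)
  have E': "E' \<in> sets ?F" unfolding E'_eq by (rule sets.compl_sets[OF E])
  have sets: "\<A> j \<in> sets P" "E \<inter> \<A> j \<in> sets P" "E' \<inter> \<A> j \<in> sets P"
    "\<A> j \<in> sets Ph" "E \<inter> \<A> j \<in> sets Ph" "E' \<inter> \<A> j \<in> sets Ph" for j
    using sub \<A>[of j] E E' unfolding setsP setsPh by auto
  have qst: "q j \<in> stopping_times T t" "v \<in> paths T t \<Longrightarrow> s \<le> q j v" if "j \<in> {1..l}" for j v
    using q[OF that] by (auto simp: stopping_times_from_def stopping_times_n_def)
  have b_in: "b v \<in> {1..l}" if "b v \<noteq> 0" for v using that bl[of v] by auto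
  have H_meas: "H \<in> borel_measurable ?F"
  proof -
    have m: "(\<lambda>v. min (\<tau> v) s) \<in> borel_measurable ?F" by (rule borel_measurable_min_stopping_time[OF \<tau>])
    have in_s: "min (\<tau> v) s \<in> {t..s}" if "v \<in> paths T t" for v
      using stopping_times_in[OF \<tau> that] s_in by auto
    show ?thesis unfolding H_def
      by (intro borel_measurable_add eval_running_gain_measurable[OF t_in w s_in(2) m in_s]
        eval_shift_measurable[of L, OF _ t_in w s_in(2) m in_s]) auto
  qed
  have H_bd: "\<bar>H v\<bar> \<le> Z v" if "v \<in> paths T t" for v
  proof -
    have "min (\<tau> v) s \<in> {t..T}" using stopping_times_in[OF \<tau> that] s_in by auto
    from bd[OF that this this] show ?thesis unfolding H_def by linarith
  qed
  have measP: "f \<in> borel_measurable P" if "f \<in> borel_measurable ?F" for f :: "'d path \<Rightarrow> real"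
    using filtration_s_T[OF that] measurable_cong_sets[OF setsP refl] by blast
  have int_bd: "integrable P f" if "f \<in> borel_measurable ?F" "\<And>v. v \<in> paths T t \<Longrightarrow> \<bar>f v\<bar> \<le> Z v" for f
  proof (rule Bochner_Integration.integrable_bound[OF Z measP[OF that(1)]], intro AE_I2)
    fix v assume "v \<in> space P"
    then have "\<bar>f v\<bar> \<le> Z v" using that(2) by (simp add: spP)
    then show "norm (f v) \<le> norm (Z v)" by simp
  qed
  have H_int: "integrable P H" by (rule int_bd[OF H_meas H_bd])
  have K_int: "integrable P K"
  proof (rule int_bd)
    show "K \<in> borel_measurable ?F" unfolding K_def
      by (intro borel_measurable_add VS_measurable running_gain_adapted[OF t_in s_in(2) w])
    show "\<bar>K v\<bar> \<le> Z v" if "v \<in> paths T t" for v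
      unfolding K_def by (rule dominator_bounds(2)[OF bd that \<tau> \<gamma>])
  qed
  have RP: "integrable P (R \<tau> \<gamma>)" by (rule payoff_integrable[OF t_in P w \<tau> \<gamma>])
  have RPh: "integrable Ph (R \<tau> \<gamma>)" by (rule payoff_integrable[OF t_in Ph w \<tau> \<gamma>])
  have RPhq: "integrable Ph (R \<tau> (q j))" if "j \<in> {1..l}" for j
    by (rule payoff_integrable[OF t_in Ph w \<tau> qst(1)[OF that]])

  \<comment> \<open>Only the summand with \<open>j = b v\<close> survives at a path, and none does
    in block 0.\<close>
  have split: "(\<Sum>j=1..l. indicator (E \<inter> \<A> j) v * f j + indicator (E' \<inter> \<A> j) v * h j) =
      (if b v = 0 then 0 else if \<tau> v < s then f (b v) else h (b v))"
    if v: "v \<in> paths T t" for v and f h :: "nat \<Rightarrow> real"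
  proof -
    have "(\<Sum>j=1..l. indicator (E \<inter> \<A> j) v * f j + indicator (E' \<inter> \<A> j) v * h j) =
        (\<Sum>j=1..l. if j = b v then (if \<tau> v < s then f (b v) else h (b v)) else 0)"
      by (rule sum.cong[OF refl]) (use v in \<open>auto simp: indicator_def \<A>_def E_def E'_def\<close>)
    then show ?thesis using b_in[of v] by auto
  qed

  have eq1: "(\<integral>v. R \<tau> \<gamma>h v \<partial>Ph) = (\<integral>v. indicator (\<A> 0) v * R \<tau> \<gamma> v +
      (\<Sum>j=1..l. indicator (E \<inter> \<A> j) v * R \<tau> (q j) v + indicator (E' \<inter> \<A> j) v * R \<tau> (q j) v) \<partial>Ph)"
  proof (rule Bochner_Integration.integral_cong[OF refl])
    fix v assume "v \<in> space Ph"
    then have v: "v \<in> paths T t" by (simp add: spPh)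
    have "R \<tau> \<gamma>h v = (if b v = 0 then R \<tau> \<gamma> v else R \<tau> (q (b v)) v)"
      by (simp add: payoff_def \<gamma>h_def)
    then show "R \<tau> \<gamma>h v = indicator (\<A> 0) v * R \<tau> \<gamma> v +
      (\<Sum>j=1..l. indicator (E \<inter> \<A> j) v * R \<tau> (q j) v + indicator (E' \<inter> \<A> j) v * R \<tau> (q j) v)"
      unfolding split[OF v] using v by (simp add: indicator_def \<A>_def)
  qed
  have eq2: "(\<integral>v. indicator (\<A> 0) v * R \<tau> \<gamma> v +
      (\<Sum>j=1..l. indicator (E \<inter> \<A> j) v * R \<tau> (q j) v + indicator (E' \<inter> \<A> j) v * R \<tau> (q j) v) \<partial>Ph) =
      (\<integral>v. indicator (\<A> 0) v * R \<tau> \<gamma> v \<partial>Ph) +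
      (\<Sum>j=1..l. (\<integral>v. indicator (E \<inter> \<A> j) v * R \<tau> (q j) v \<partial>Ph) +
        (\<integral>v. indicator (E' \<inter> \<A> j) v * R \<tau> (q j) v \<partial>Ph))"
  proof -
    have i: "integrable Ph (\<lambda>v. indicator (\<A> 0) v * R \<tau> \<gamma> v)"
      by (intro integrable_indicator_mult RPh sets)
    have ij: "integrable Ph (\<lambda>v. indicator (E \<inter> \<A> j) v * R \<tau> (q j) v)"
      "integrable Ph (\<lambda>v. indicator (E' \<inter> \<A> j) v * R \<tau> (q j) v)" if "j \<in> {1..l}" for j
      by (intro integrable_indicator_mult RPhq[OF that] sets)+
    show ?thesis by (rule integral_add_sum[OF i ij])
  qed
  have eq3: "(\<integral>v. indicator (\<A> 0) v * R \<tau> \<gamma> v \<partial>Ph) = (\<integral>v. indicator (\<A> 0) v * R \<tau> \<gamma> v \<partial>P)"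
  proof (rule integral_indicator_cong_subalgebra)
    show "sets Ph = sets P" by (simp add: setsP setsPh)
    show "subalgebra Ph ?FT" by (simp add: subalgebra_def spPh setsPh)
    show "\<A> 0 \<in> sets ?FT" using \<A> sub by blast
    show "emeasure Ph (A \<inter> \<A> 0) = emeasure P (A \<inter> \<A> 0)" if "A \<in> sets ?FT" for A
      unfolding \<A>_def by (rule on0[OF that])
    show "R \<tau> \<gamma> \<in> borel_measurable ?FT" by (rule payoff_measurable[OF t_in w \<tau> \<gamma>])
  qed
  have le4: "(\<Sum>j=1..l. (\<integral>v. indicator (E \<inter> \<A> j) v * R \<tau> (q j) v \<partial>Ph) +
        (\<integral>v. indicator (E' \<inter> \<A> j) v * R \<tau> (q j) v \<partial>Ph)) \<le>
      (\<Sum>j=1..l. (\<integral>v. indicator (E \<inter> \<A> j) v * H v \<partial>P) +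
        (\<integral>v. indicator (E' \<inter> \<A> j) v * K v \<partial>P)) + r"
  proof -
    have e1: "(\<integral>v. indicator (E \<inter> \<A> j) v * R \<tau> (q j) v \<partial>Ph) = (\<integral>v. indicator (E \<inter> \<A> j) v * H v \<partial>P)"
      if j: "j \<in> {1..l}" for j
    proof -
      have "(\<integral>v. indicator (E \<inter> \<A> j) v * R \<tau> (q j) v \<partial>Ph) = (\<integral>v. indicator (E \<inter> \<A> j) v * H v \<partial>Ph)"
      proof (rule Bochner_Integration.integral_cong[OF refl])
        fix v assume "v \<in> space Ph"
        then have v: "v \<in> paths T t" by (simp add: spPh)
        have "R \<tau> (q j) v = H v" if "\<tau> v < s"
          using that qst(2)[OF j v] by (simp add: payoff_eq H_def min_absorb1)
        then show "indicator (E \<inter> \<A> j) v * R \<tau> (q j) v = indicator (E \<inter> \<A> j) v * H v"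
          by (auto simp: indicator_def E_def)
      qed
      also have "\<dots> = (\<integral>v. indicator (E \<inter> \<A> j) v * H v \<partial>P)"
      proof (rule integral_indicator_cong_subalgebra[OF _ _ _ _ H_meas])
        show "sets Ph = sets P" by (simp add: setsP setsPh)
        show "subalgebra Ph ?F" using sub by (simp add: subalgebra_def spPh setsPh)
        show "E \<inter> \<A> j \<in> sets ?F" using E \<A> by blast
        show "emeasure Ph (A \<inter> (E \<inter> \<A> j)) = emeasure P (A \<inter> (E \<inter> \<A> j))" if "A \<in> sets ?F" for A
          using onj[OF j sets.Int[OF that E]] by (simp add: \<A>_def Int_assoc)
      qed
      finally show ?thesis .
    qed
    \<comment> \<open>A payoff depends on a stopping time only through its value at the path, and
      \<open>\<tau>'\<close> equals \<open>\<tau>\<close> on \<open>E'\<close>.\<close>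
    have e2: "(\<integral>v. indicator (E' \<inter> \<A> j) v * R \<tau> (q j) v \<partial>Ph) = (\<integral>v. indicator (E' \<inter> \<A> j) v * R \<tau>' (q j) v \<partial>Ph)" for j
      by (rule Bochner_Integration.integral_cong[OF refl])
        (auto simp: indicator_def E'_def payoff_def \<tau>'_def)
    have "\<tau>' \<in> stopping_times_from T t s n"
      unfolding \<tau>'_def by (rule delayed_stopping_time[OF \<tau>n])
    from pasted[OF E' this]
    have "(\<Sum>j=1..l. \<integral>v. indicator (E' \<inter> \<A> j) v * R \<tau>' (q j) v \<partial>Ph) \<le>
        (\<Sum>j=1..l. \<integral>v. indicator (E' \<inter> \<A> j) v * K v \<partial>P) + r"
      by (simp only: \<A>_def K_def)
    moreover have "(\<Sum>j=1..l. \<integral>v. indicator (E \<inter> \<A> j) v * R \<tau> (q j) v \<partial>Ph) =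
        (\<Sum>j=1..l. \<integral>v. indicator (E \<inter> \<A> j) v * H v \<partial>P)"
      by (rule sum.cong[OF refl e1])
    ultimately show ?thesis unfolding sum.distrib e2 by linarith
  qed
  have eq5: "(\<integral>v. indicator (\<A> 0) v * R \<tau> \<gamma> v +
      (\<Sum>j=1..l. indicator (E \<inter> \<A> j) v * H v + indicator (E' \<inter> \<A> j) v * K v) \<partial>P) =
      (\<integral>v. indicator (\<A> 0) v * R \<tau> \<gamma> v \<partial>P) +
      (\<Sum>j=1..l. (\<integral>v. indicator (E \<inter> \<A> j) v * H v \<partial>P) + (\<integral>v. indicator (E' \<inter> \<A> j) v * K v \<partial>P))"
  proof -
    have i: "integrable P (\<lambda>v. indicator (\<A> 0) v * R \<tau> \<gamma> v)"
      by (intro integrable_indicator_mult RP sets)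
    have ij: "integrable P (\<lambda>v. indicator (E \<inter> \<A> j) v * H v)"
      "integrable P (\<lambda>v. indicator (E' \<inter> \<A> j) v * K v)" for j
      by (intro integrable_indicator_mult H_int K_int sets)+
    show ?thesis by (rule integral_add_sum[OF i ij])
  qed
  have le6: "(\<integral>v. indicator (\<A> 0) v * R \<tau> \<gamma> v +
      (\<Sum>j=1..l. indicator (E \<inter> \<A> j) v * H v + indicator (E' \<inter> \<A> j) v * K v) \<partial>P) \<le>
      (\<integral>v. stopped_payoff \<tau> \<gamma> v + indicator {v \<in> paths T t. b v = 0 \<and> s \<le> \<gamma> v} v * (2 * Z v) \<partial>P)"
  proof (rule Bochner_Integration.integral_mono)
    show "integrable P (\<lambda>v. indicator (\<A> 0) v * R \<tau> \<gamma> v +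
      (\<Sum>j=1..l. indicator (E \<inter> \<A> j) v * H v + indicator (E' \<inter> \<A> j) v * K v))"
      by (intro integrable_add_sum integrable_indicator_mult H_int K_int RP sets)
    have "{v \<in> paths T t. b v = 0 \<and> s \<le> \<gamma> v} = \<A> 0 - {v \<in> paths T t. \<gamma> v < s}"
      by (auto simp: \<A>_def)
    then have "{v \<in> paths T t. b v = 0 \<and> s \<le> \<gamma> v} \<in> sets P"
      using \<A>[of 0] stopping_times_less[OF \<gamma>, of s] sub unfolding setsP by auto
    then show "integrable P (\<lambda>v. stopped_payoff \<tau> \<gamma> v +
        indicator {v \<in> paths T t. b v = 0 \<and> s \<le> \<gamma> v} v * (2 * Z v))"
      by (intro Bochner_Integration.integrable_add integrable_indicator_mult
          stopped_payoff_integrable[OF P \<tau> \<gamma>]) (use Z in auto)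
    fix v assume "v \<in> space P"
    then have v: "v \<in> paths T t" by (simp add: spP)
    note bounds = dominator_bounds[OF bd v \<tau> \<gamma>]
    show "indicator (\<A> 0) v * R \<tau> \<gamma> v +
        (\<Sum>j=1..l. indicator (E \<inter> \<A> j) v * H v + indicator (E' \<inter> \<A> j) v * K v) \<le>
        stopped_payoff \<tau> \<gamma> v + indicator {v \<in> paths T t. b v = 0 \<and> s \<le> \<gamma> v} v * (2 * Z v)"
    \<comment> \<open>In block 0 with \<open>\<gamma> v < s\<close> both sides carry the same
      payoff; with \<open>s \<le> \<gamma> v\<close> the payoff and \<open>stopped_payoff\<close>
      both lie between \<open>- Z v\<close> and \<open>Z v\<close>. On the other blocks the two
      sides are equal.\<close>
    proof (cases "b v = 0")
      case True
      then show ?thesis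
        unfolding split[OF v] using v bounds
        by (auto simp: indicator_def \<A>_def stopped_payoff_def)
    next
      case False
      then have \<gamma>v: "s \<le> \<gamma> v" by (rule b\<gamma>[OF v])
      have "R \<tau> \<gamma> v = H v" if "\<tau> v < s"
        using that \<gamma>v by (simp add: payoff_eq H_def min_absorb1)
      then show ?thesis
        unfolding split[OF v] using False \<gamma>v
        by (auto simp: indicator_def \<A>_def stopped_payoff_def K_def)
    qed
  qed
  have eq7: "(\<integral>v. stopped_payoff \<tau> \<gamma> v + indicator {v \<in> paths T t. b v = 0 \<and> s \<le> \<gamma> v} v * (2 * Z v) \<partial>P) =
      (\<integral>v. stopped_payoff \<tau> \<gamma> v \<partial>P) +
      (\<integral>v. indicator {v \<in> paths T t. b v = 0 \<and> s \<le> \<gamma> v} v * (2 * Z v) \<partial>P)"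
  proof (rule Bochner_Integration.integral_add[OF stopped_payoff_integrable[OF P \<tau> \<gamma>]])
    have "{v \<in> paths T t. b v = 0 \<and> s \<le> \<gamma> v} = \<A> 0 - {v \<in> paths T t. \<gamma> v < s}"
      by (auto simp: \<A>_def)
    then have "{v \<in> paths T t. b v = 0 \<and> s \<le> \<gamma> v} \<in> sets P"
      using \<A>[of 0] stopping_times_less[OF \<gamma>, of s] sub unfolding setsP by auto
    then show "integrable P (\<lambda>v. indicator {v \<in> paths T t. b v = 0 \<and> s \<le> \<gamma> v} v * (2 * Z v))"
      by (intro integrable_indicator_mult) (use Z in auto)
  qed
  have "(\<integral>v. R \<tau> \<gamma>h v \<partial>Ph) \<le> (\<integral>v. stopped_payoff \<tau> \<gamma> v \<partial>P) +
      (\<integral>v. indicator {v \<in> paths T t. b v = 0 \<and> s \<le> \<gamma> v} v * (2 * Z v) \<partial>P) + r"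
    using eq1 eq2 eq3 le4 eq5 le6 eq7 by linarith
  then show ?thesis unfolding \<gamma>h_def[abs_def] .
qed

end

section \<open>Choice of the partition and comparison of the values\<close>

context game_dpp
begin

text \<open>The pasting condition for the fixed data, with all radii equal to
  \<open>\<delta>\<close>. Two orders of quantifiers matter: \<open>\<rho>h\<close> precedes
  \<open>\<delta>\<close>, so \<open>\<delta>\<close> can be adapted to it, and \<open>Ph\<close>
  precedes \<open>p\<close>, so one pasted measure serves every stopping time of the family.\<close>

lemma pasted_measure_exists:
  assumes "weakly_stable_under_pasting T g L U \<P>"
  shows "\<exists>\<rho>h. modulus_of_continuity \<rho>h \<and>
    (\<forall>P \<delta> l. \<forall>\<A> :: nat \<Rightarrow> 'd path set. \<forall>ws Q. P \<in> \<P> t w \<longrightarrow> 0 < \<delta> \<longrightarrow> \<delta> \<in> \<rat> \<longrightarrow> (1::nat) \<le> l \<longrightarrow>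
      (\<forall>j\<in>{0..l}. \<A> j \<in> sets (raw_filtration T t s)) \<longrightarrow>
      disjoint_family_on \<A> {0..l} \<longrightarrow> (\<Union>j\<in>{0..l}. \<A> j) = paths T t \<longrightarrow>
      (\<forall>j\<in>{1..l}. ws j \<in> paths T t \<and> \<A> j \<subseteq> path_ball T t s \<delta> (ws j) \<and> Q j \<in> \<P> s (splice T 0 t w (ws j))) \<longrightarrow>
      (\<exists>Ph\<in>\<P> t w.
        (\<forall>A\<in>sets (raw_filtration T t T). emeasure Ph (A \<inter> \<A> 0) = emeasure P (A \<inter> \<A> 0)) \<and>
        (\<forall>j\<in>{1..l}. \<forall>A\<in>sets (raw_filtration T t s). emeasure Ph (A \<inter> \<A> j) = emeasure P (A \<inter> \<A> j)) \<and>
        (\<forall>p\<in>stopping_times T s. \<exists>q :: nat \<Rightarrow> 'd path \<Rightarrow> real.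
          (\<forall>j\<in>{1..l}. q j \<in> stopping_times_from T t s \<infinity>) \<and>
          (\<forall>A\<in>sets (raw_filtration T t s). \<forall>\<tau>\<in>stopping_times_from T t s n.
            (\<Sum>j=1..l. \<integral>v. indicator (A \<inter> \<A> j) v * R \<tau> (q j) v \<partial>Ph) \<le>
            (\<Sum>j=1..l. \<integral>v. indicator (A \<inter> \<A> j) v *
              (sup_payoff (Q j) p v + running_gain t w s v) \<partial>P) + \<rho>h \<delta>))))"
proof -
  from assms obtain \<rho>h where mod: "modulus_of_continuity \<rho>h" and
    paste: "\<forall>t s \<delta>. \<forall>w\<in>paths T 0. \<forall>P\<in>\<P> t w.
          \<forall>l::nat. \<forall>\<A> :: nat \<Rightarrow> 'd path set. \<forall>\<delta>s :: nat \<Rightarrow> real.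
          \<forall>ws :: nat \<Rightarrow> 'd path. \<forall>Q :: nat \<Rightarrow> 'd path measure.
          0 \<le> t \<longrightarrow> t < s \<longrightarrow> s \<le> T \<longrightarrow> 0 < \<delta> \<longrightarrow> \<delta> \<in> \<rat> \<longrightarrow> 1 \<le> l \<longrightarrow>
          (\<forall>j\<in>{0..l}. \<A> j \<in> sets (raw_filtration T t s)) \<longrightarrow>
          disjoint_family_on \<A> {0..l} \<longrightarrow> (\<Union>j\<in>{0..l}. \<A> j) = paths T t \<longrightarrow>
          (\<forall>j\<in>{1..l}. \<delta>s j \<in> ({0<..\<delta>} \<inter> \<rat>) \<union> {\<delta>} \<and> ws j \<in> paths T t \<and>
             \<A> j \<subseteq> path_ball T t s (\<delta>s j) (ws j) \<and> Q j \<in> \<P> s (splice T 0 t w (ws j))) \<longrightarrow>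
          (\<exists>Ph\<in>\<P> t w.
             (\<forall>A\<in>sets (raw_filtration T t T). emeasure Ph (A \<inter> \<A> 0) = emeasure P (A \<inter> \<A> 0)) \<and>
             (\<forall>j\<in>{1..l}. \<forall>A\<in>sets (raw_filtration T t s).
                emeasure Ph (A \<inter> \<A> j) = emeasure P (A \<inter> \<A> j)) \<and>
             (\<forall>n::enat. 1 \<le> n \<longrightarrow> (\<forall>p\<in>stopping_times T s.
                \<exists>q :: nat \<Rightarrow> 'd path \<Rightarrow> real.
                  (\<forall>j\<in>{1..l}. q j \<in> stopping_times_from T t s \<infinity>) \<and>
                  (\<forall>A\<in>sets (raw_filtration T t s). \<forall>\<tau>\<in>stopping_times_from T t s n.
                     (\<Sum>j=1..l. \<integral>v. indicator (A \<inter> \<A> j) v * payoff T g L U t w \<tau> (q j) v \<partial>Ph)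
                     \<le> (\<Sum>j=1..l. \<integral>v. indicator (A \<inter> \<A> j) v *
                           ((SUP \<sigma>\<in>stopping_times_n T s n.
                               \<integral>u. payoff T g L U s (splice T 0 t w v) \<sigma> p u \<partial>Q j)
                            + (LINT r:{t..s}|lborel. shift_process T 0 t w g r v)) \<partial>P)
                       + \<rho>h \<delta>))))"
    unfolding weakly_stable_under_pasting_def by (elim exE conjE)
  have gain: "running_gain t w s v = (LINT r:{t..s}|lborel. shift_process T 0 t w g r v)" for v
    by (simp add: running_gain_def shift_process_def)
  show ?thesis
    unfolding sup_payoff_def gain
  proof (intro exI[of _ \<rho>h] conjI mod allI impI)
    fix P and \<delta> :: real and l :: nat and \<A> :: "nat \<Rightarrow> 'd path set" and ws :: "nat \<Rightarrow> 'd path"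
      and Q :: "nat \<Rightarrow> 'd path measure"
    assume P: "P \<in> \<P> t w" and \<delta>: "0 < \<delta>" "\<delta> \<in> \<rat>" and l: "1 \<le> l"
      and \<A>: "\<forall>j\<in>{0..l}. \<A> j \<in> sets (raw_filtration T t s)" "disjoint_family_on \<A> {0..l}"
        "(\<Union>j\<in>{0..l}. \<A> j) = paths T t"
      and pts: "\<forall>j\<in>{1..l}. ws j \<in> paths T t \<and> \<A> j \<subseteq> path_ball T t s \<delta> (ws j) \<and>
        Q j \<in> \<P> s (splice T 0 t w (ws j))"
    have pts': "\<forall>j\<in>{1..l}. \<delta> \<in> ({0<..\<delta>} \<inter> \<rat>) \<union> {\<delta>} \<and> ws j \<in> paths T t \<and>
        \<A> j \<subseteq> path_ball T t s \<delta> (ws j) \<and> Q j \<in> \<P> s (splice T 0 t w (ws j))"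
      using pts by simp
    note * = paste[THEN spec[where x = t], THEN spec[where x = s], THEN spec[where x = \<delta>],
        THEN bspec[where x = w], OF w, THEN bspec[where x = P], OF P, THEN spec[where x = l],
        THEN spec[where x = \<A>], THEN spec[where x = "\<lambda>_. \<delta>"], THEN spec[where x = ws],
        THEN spec[where x = Q], THEN mp, OF t0, THEN mp, OF ts, THEN mp, OF sT, THEN mp, OF \<delta>(1),
        THEN mp, OF \<delta>(2), THEN mp, OF l, THEN mp, OF \<A>(1), THEN mp, OF \<A>(2), THEN mp, OF \<A>(3),
        THEN mp, OF pts']
    from * obtain Ph where Ph: "Ph \<in> \<P> t w" and 1: "\<forall>A\<in>sets (raw_filtration T t T).
          emeasure Ph (A \<inter> \<A> 0) = emeasure P (A \<inter> \<A> 0)"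
      and 2: "\<forall>j\<in>{1..l}. \<forall>A\<in>sets (raw_filtration T t s).
          emeasure Ph (A \<inter> \<A> j) = emeasure P (A \<inter> \<A> j)"
      and 3: "\<forall>n::enat. 1 \<le> n \<longrightarrow> (\<forall>p\<in>stopping_times T s.
                \<exists>q :: nat \<Rightarrow> 'd path \<Rightarrow> real.
                  (\<forall>j\<in>{1..l}. q j \<in> stopping_times_from T t s \<infinity>) \<and>
                  (\<forall>A\<in>sets (raw_filtration T t s). \<forall>\<tau>\<in>stopping_times_from T t s n.
                     (\<Sum>j=1..l. \<integral>v. indicator (A \<inter> \<A> j) v * payoff T g L U t w \<tau> (q j) v \<partial>Ph)
                     \<le> (\<Sum>j=1..l. \<integral>v. indicator (A \<inter> \<A> j) v *
                           ((SUP \<sigma>\<in>stopping_times_n T s n.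
                               \<integral>u. payoff T g L U s (splice T 0 t w v) \<sigma> p u \<partial>Q j)
                            + (LINT r:{t..s}|lborel. shift_process T 0 t w g r v)) \<partial>P)
                       + \<rho>h \<delta>))"
      by (elim bexE conjE)
    show "\<exists>Ph\<in>\<P> t w.
        (\<forall>A\<in>sets (raw_filtration T t T). emeasure Ph (A \<inter> \<A> 0) = emeasure P (A \<inter> \<A> 0)) \<and>
        (\<forall>j\<in>{1..l}. \<forall>A\<in>sets (raw_filtration T t s). emeasure Ph (A \<inter> \<A> j) = emeasure P (A \<inter> \<A> j)) \<and>
        (\<forall>p\<in>stopping_times T s. \<exists>q :: nat \<Rightarrow> 'd path \<Rightarrow> real.
          (\<forall>j\<in>{1..l}. q j \<in> stopping_times_from T t s \<infinity>) \<and>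
          (\<forall>A\<in>sets (raw_filtration T t s). \<forall>\<tau>\<in>stopping_times_from T t s n.
            (\<Sum>j=1..l. \<integral>v. indicator (A \<inter> \<A> j) v * R \<tau> (q j) v \<partial>Ph) \<le>
            (\<Sum>j=1..l. \<integral>v. indicator (A \<inter> \<A> j) v *
              ((SUP \<sigma>\<in>stopping_times_n T s n.
                \<integral>u. payoff T g L U s (splice T 0 t w v) \<sigma> p u \<partial>Q j) +
               (LINT r:{t..s}|lborel. shift_process T 0 t w g r v)) \<partial>P) + \<rho>h \<delta>))"
      by (rule bexI[OF _ Ph], intro conjI, rule 1, rule 2, rule 3[THEN spec[where x = n], THEN mp, OF n])
  qed
qed

lemma path_ballI:
  assumes "v \<in> paths T t" "\<And>r. r \<in> {t..s} \<Longrightarrow> norm (v r - x r) \<le> d" "d < \<delta>"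
  shows "v \<in> path_ball T t s \<delta> x"
proof -
  have "sup_norm t s (\<lambda>r. v r - x r) \<le> d" using ts by (intro sup_norm_le assms(2)) auto
  then show ?thesis using assms by (simp add: path_ball_def)
qed

text \<open>Before \<open>s\<close> the switch is invisible, since on the switched blocks the old
  and the new time are both at least \<open>s\<close>; from \<open>s\<close> on the block number is
  known.\<close>

lemma switched_stopping_time:
  fixes b :: "'d path \<Rightarrow> nat"
  assumes b: "\<And>j. {v \<in> paths T t. b v = j} \<in> sets (raw_filtration T t s)" and bl: "\<And>v. b v \<le> l"
    and \<gamma>: "\<gamma> \<in> stopping_times T t" and b\<gamma>: "\<And>v. v \<in> paths T t \<Longrightarrow> b v \<noteq> 0 \<Longrightarrow> s \<le> \<gamma> v"
    and q: "\<And>j. j \<in> {1..l} \<Longrightarrow> q j \<in> stopping_times_from T t s \<infinity>"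
  shows "(\<lambda>v. if b v = 0 then \<gamma> v else q (b v) v) \<in> stopping_times T t"
proof -
  let ?\<gamma> = "\<lambda>v. if b v = 0 then \<gamma> v else q (b v) v"
  have qst: "q j \<in> stopping_times T t" "v \<in> paths T t \<Longrightarrow> s \<le> q j v" if "j \<in> {1..l}" for j v
    using q[OF that] by (auto simp: stopping_times_from_def stopping_times_n_def)
  have b_in: "b v \<in> {1..l}" if "b v \<noteq> 0" for v
    using bl[of v] that by (simp add: Suc_le_eq)
  show ?thesis
  proof (rule stopping_timesI)
    fix r assume r: "t \<le> r" "r < T"
    show "{v \<in> paths T t. ?\<gamma> v \<le> r} \<in> sets (raw_filtration T t r)"
    proof (cases "r < s")
      case True
      have "?\<gamma> v \<le> r \<longleftrightarrow> \<gamma> v \<le> r" if v: "v \<in> paths T t" for v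
      proof (cases "b v = 0")
        case False
        then show ?thesis using True b\<gamma>[OF v False] qst(2)[OF b_in[OF False] v] by simp
      qed simp
      then have eq: "{v \<in> paths T t. ?\<gamma> v \<le> r} = {v \<in> paths T t. \<gamma> v \<le> r}" by blast
      show ?thesis unfolding eq by (rule stopping_times_le[OF \<gamma> order_refl])
    next
      case False
      have eq: "{v \<in> paths T t. ?\<gamma> v \<le> r} = ({v \<in> paths T t. b v = 0} \<inter> {v \<in> paths T t. \<gamma> v \<le> r}) \<union>
          (\<Union>j\<in>{1..l}. {v \<in> paths T t. b v = j} \<inter> {v \<in> paths T t. q j v \<le> r})"
        using b_in by (auto split: if_splits)
      have br: "{v \<in> paths T t. b v = j} \<in> sets (raw_filtration T t r)" for j
        using b[of j] sets_raw_filtration_mono[of s r T t] False by auto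
      show ?thesis unfolding eq
        by (intro sets.Un sets.Int sets.finite_UN br stopping_times_le[OF \<gamma> order_refl]
            stopping_times_le[OF qst(1) order_refl]) auto
    qed
  next
    fix v :: "'d path" assume v: "v \<in> paths T t"
    show "?\<gamma> v \<in> {t..T}"
      using stopping_times_in[OF \<gamma> v] stopping_times_in[OF qst(1)[OF b_in] v] by simp
  qed
qed

text \<open>The error budget: \<open>2 * e\<close> for the selection, \<open>e\<close> each for
  moving the payoff and the value within a cell, \<open>e\<close> for the repeated pasting error,
  and \<open>e\<close> each for the paths outside \<open>G M\<close> and for the cells numbered from
  \<open>l\<close> on. The parameters are chosen in the order \<open>M\<close>,
  \<open>\<delta>\<close>, \<open>k\<close>, \<open>l\<close>.\<close>

lemma game_value_le_stopped:
  assumes pasting: "weakly_stable_under_pasting T g L U \<P>"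
    and P: "P \<in> \<P> t w" and \<gamma>: "\<gamma> \<in> stopping_times T t" and e: "0 < e"
  shows "game_value T g L U \<P> n t w \<le>
    (SUP \<tau>\<in>stopping_times_n T t n. \<integral>v. stopped_payoff \<tau> \<gamma> v \<partial>P) + 7 * e"
proof -
  let ?F = "raw_filtration T t s :: 'd path measure"
  have Pi: "P \<in> integrable_probs T g L U t" by (rule class_integrable[OF t_in w P])
  then have PP: "P \<in> path_probs T t" by (simp add: integrable_probs_def)
  interpret prob_space P by (rule path_probsD(1)[OF PP])
  note spP = path_probsD(2)[OF PP] and setsP = path_probsD(3)[OF PP]
  have sub: "sets ?F \<subseteq> sets P" unfolding setsP by (rule sets_raw_filtration_mono[OF sT])
  from integrable_dominator[OF t_in Pi w] obtain Z where Z: "integrable P Z"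
    and bd: "\<forall>v\<in>paths T t. \<forall>a\<in>{t..T}. \<forall>b\<in>{t..T}.
      \<bar>running_gain t w a v\<bar> + \<bar>L b (splice T 0 t w v)\<bar> \<le> Z v \<and>
      \<bar>running_gain t w a v\<bar> + \<bar>U b (splice T 0 t w v)\<bar> \<le> Z v" by (elim exE conjE)
  have bounds: "\<bar>VS v + running_gain t w s v\<bar> \<le> Z v" "\<bar>stopped_payoff \<tau> \<gamma> v\<bar> \<le> Z v"
    if "v \<in> paths T t" "\<tau> \<in> stopping_times T t" for v \<tau>
  proof -
    show "\<bar>VS v + running_gain t w s v\<bar> \<le> Z v"
      by (rule dominator_bounds(2)[OF bd[rule_format] that \<gamma>])
    show "\<bar>stopped_payoff \<tau> \<gamma> v\<bar> \<le> Z v"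
      by (rule dominator_bounds(3)[OF bd[rule_format] that \<gamma>])
  qed
  have Z2: "integrable P (\<lambda>v. 2 * Z v)" using Z by simp
  from near_optimal_selection[OF e]
  obtain C :: "nat \<Rightarrow> 'd path \<Rightarrow> real" and Q mi where C: "\<forall>i. C i \<in> stopping_times T s"
    and sel: "\<forall>v\<in>paths T t. Q v \<in> \<P> s (splice T 0 t w v) \<and> sup_payoff (Q v) (C (mi v)) v \<le> VS v + 2 * e"
    by (elim exE conjE)
  from pasted_measure_exists[OF pasting]
  obtain \<rho>h where modh: "modulus_of_continuity \<rho>h" and paste:
    "\<forall>P \<delta> l. \<forall>\<A> :: nat \<Rightarrow> 'd path set. \<forall>ws Q. P \<in> \<P> t w \<longrightarrow> 0 < \<delta> \<longrightarrow> \<delta> \<in> \<rat> \<longrightarrow> (1::nat) \<le> l \<longrightarrow>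
      (\<forall>j\<in>{0..l}. \<A> j \<in> sets (raw_filtration T t s)) \<longrightarrow>
      disjoint_family_on \<A> {0..l} \<longrightarrow> (\<Union>j\<in>{0..l}. \<A> j) = paths T t \<longrightarrow>
      (\<forall>j\<in>{1..l}. ws j \<in> paths T t \<and> \<A> j \<subseteq> path_ball T t s \<delta> (ws j) \<and> Q j \<in> \<P> s (splice T 0 t w (ws j))) \<longrightarrow>
      (\<exists>Ph\<in>\<P> t w.
        (\<forall>A\<in>sets (raw_filtration T t T). emeasure Ph (A \<inter> \<A> 0) = emeasure P (A \<inter> \<A> 0)) \<and>
        (\<forall>j\<in>{1..l}. \<forall>A\<in>sets (raw_filtration T t s). emeasure Ph (A \<inter> \<A> j) = emeasure P (A \<inter> \<A> j)) \<and>
        (\<forall>p\<in>stopping_times T s. \<exists>q :: nat \<Rightarrow> 'd path \<Rightarrow> real.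
          (\<forall>j\<in>{1..l}. q j \<in> stopping_times_from T t s \<infinity>) \<and>
          (\<forall>A\<in>sets (raw_filtration T t s). \<forall>\<tau>\<in>stopping_times_from T t s n.
            (\<Sum>j=1..l. \<integral>v. indicator (A \<inter> \<A> j) v * R \<tau> (q j) v \<partial>Ph) \<le>
            (\<Sum>j=1..l. \<integral>v. indicator (A \<inter> \<A> j) v *
              (sup_payoff (Q j) p v + running_gain t w s v) \<partial>P) + \<rho>h \<delta>)))"
    by (elim exE conjE)
  from path_cells_exist[OF sT, of t, where 'd = 'd]
  obtain c :: "nat \<Rightarrow> 'd path \<Rightarrow> nat" where c: "path_cells T t s c" by (elim exE)
  have cF: "c k \<in> ?F \<rightarrow>\<^sub>M count_space UNIV" for k using c by (simp add: path_cells_def)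
  have cell: "norm (v r - v' r) \<le> 1 / (real k + 1)"
    if "v \<in> paths T t" "v' \<in> paths T t" "c k v = c k v'" "r \<in> {t..s}" for k v v' r
    using c[unfolded path_cells_def, THEN conjunct2, rule_format, OF that] .
  have c_sets: "{v \<in> paths T t. c k v \<in> X} \<in> sets ?F" for k X
  proof -
    have "c k -` X \<inter> space ?F \<in> sets ?F" by (rule measurable_sets[OF cF]) simp
    moreover have "c k -` X \<inter> space ?F = {v \<in> paths T t. c k v \<in> X}" by auto
    ultimately show ?thesis by simp
  qed
  have "paths T t \<noteq> ({} :: 'd path set)" using not_empty unfolding spP .
  then obtain x0 :: "'d path" where x0: "x0 \<in> paths T t" by blast

  \<comment> \<open>\<open>G M\<close> is the closure, in the supremum norm on \<open>{t..s}\<close>, of the points whose selected stopping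
    time has an index below \<open>M\<close>; it is measurable although \<open>mi\<close> need not be.\<close>
  define G where "G M = {v \<in> paths T t. \<forall>k. \<exists>x\<in>paths T t. mi x < M \<and> c k x = c k v}" for M :: nat
  have G_sets: "G M \<in> sets ?F" for M
  proof -
    \<comment> \<open>Membership is read off the cell numbers at all resolutions. The arbitrary
      \<open>mi\<close> enters only through sets of numbers, and any set of numbers yields an event
      at time \<open>s\<close>.\<close>
    have "G M = (\<Inter>k. {v \<in> paths T t. c k v \<in> c k ` {x \<in> paths T t. mi x < M}})"
      by (auto simp: G_def image_iff) metis+
    moreover have "\<dots> \<in> sets ?F" by (rule sets.countable_INT) (auto intro: c_sets)
    ultimately show ?thesis by simp
  qed
  have "(\<lambda>M. \<integral>v. indicator (paths T t - G M) v * (2 * Z v) \<partial>P) \<longlonglongrightarrow> 0"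
  proof (rule integral_indicator_tendsto_zero[OF Z2])
    show "paths T t - G M \<in> sets P" for M
      using sets.compl_sets[OF G_sets[of M]] sub by auto
    fix v assume "v \<in> space P"
    then have v: "v \<in> paths T t" by (simp add: spP)
    \<comment> \<open>The path \<open>v\<close> is its own witness as soon as \<open>M\<close>
      exceeds \<open>mi v\<close>.\<close>
    have "v \<notin> paths T t - G M" if "Suc (mi v) \<le> M" for M
      using v that by (auto simp: G_def intro!: bexI[of _ v])
    then show "eventually (\<lambda>M. v \<notin> paths T t - G M) sequentially"
      unfolding eventually_sequentially by blast
  qed
  then have "eventually (\<lambda>M. (\<integral>v. indicator (paths T t - G M) v * (2 * Z v) \<partial>P) < e) sequentially"
    using e by (rule order_tendstoD)
  \<comment> \<open>The additional condition admits \<open>x0\<close> as a default centre of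
    blocks.\<close>
  then have "eventually (\<lambda>M. (\<integral>v. indicator (paths T t - G M) v * (2 * Z v) \<partial>P) < e \<and> Suc (mi x0) \<le> M) sequentially"
    by (intro eventually_conj eventually_ge_at_top)
  from eventually_happens'[OF sequentially_bot this]
  obtain M where M: "(\<integral>v. indicator (paths T t - G M) v * (2 * Z v) \<partial>P) < e" "mi x0 < M"
    unfolding Suc_le_eq by (elim exE conjE)

  \<comment> \<open>With \<open>M\<close> fixed the mesh can be chosen:
    \<open>\<rho>h \<delta>\<close> will be charged \<open>M\<close> times, and
    \<open>\<rho>0 \<delta>\<close> comes with the factor \<open>1 + T\<close>.\<close>
  have "0 < e / (real M + 1)" "0 < e / (1 + T)" using e T_pos by auto
  from modulus_small[OF modh this(1)] modulus_small[OF mod0 this(2)] modulus_small[OF mod1 e]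
  obtain d1 d2 d3 where d: "0 < d1" "\<forall>x. 0 \<le> x \<and> x \<le> d1 \<longrightarrow> \<rho>h x < e / (real M + 1)"
      "0 < d2" "\<forall>x. 0 \<le> x \<and> x \<le> d2 \<longrightarrow> \<rho>0 x < e / (1 + T)"
      "0 < d3" "\<forall>x. 0 \<le> x \<and> x \<le> d3 \<longrightarrow> \<rho>1 x < e"
    by (elim exE conjE)
  have "0 < min d1 (min d2 d3)" using d(1,3,5) by simp
  then obtain \<delta> where \<delta>: "\<delta> \<in> \<rat>" "0 < \<delta>" "\<delta> < min d1 (min d2 d3)"
    using Rats_dense_in_real by blast
  have \<delta>0: "0 \<le> \<delta>" using \<delta> by simp
  have "\<rho>h \<delta> < e / (real M + 1)" using \<delta> by (intro d(2)[rule_format]) auto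
  then have "real M * \<rho>h \<delta> \<le> real M * (e / (real M + 1))" by (intro mult_left_mono) auto
  also have "\<dots> \<le> e" using e by (simp add: field_simps)
  finally have \<rho>h: "real M * \<rho>h \<delta> \<le> e" .
  have "\<rho>0 \<delta> < e / (1 + T)" using \<delta> by (intro d(4)[rule_format]) auto
  then have \<rho>0: "(1 + T) * \<rho>0 \<delta> \<le> e" using T_pos by (simp add: field_simps)
  have "\<rho>1 \<delta> < e" using \<delta> by (intro d(6)[rule_format]) auto
  then have \<rho>1: "\<rho>1 \<delta> \<le> e" by simp
  \<comment> \<open>The diameter of the cells has to be strictly below \<open>\<delta>\<close>,
    since \<open>path_ball\<close> is an open ball.\<close>
  obtain k :: nat where "inverse (real (Suc k)) < \<delta>" using reals_Archimedean[OF \<delta>(2)] by blast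
  then have k: "1 / (real k + 1) < \<delta>" by (simp add: inverse_eq_divide add.commute)

  \<comment> \<open>Pasting admits finitely many blocks only, so the cells numbered from
    \<open>l\<close> on are left to block 0.\<close>
  have "(\<lambda>l. \<integral>v. indicator {v \<in> paths T t. c k v \<in> {l..}} v * (2 * Z v) \<partial>P) \<longlonglongrightarrow> 0"
  proof (rule integral_indicator_tendsto_zero[OF Z2])
    show "{v \<in> paths T t. c k v \<in> {l..}} \<in> sets P" for l using c_sets sub by blast
    fix v
    have "v \<notin> {v \<in> paths T t. c k v \<in> {l..}}" if "Suc (c k v) \<le> l" for l using that by auto
    then show "eventually (\<lambda>l. v \<notin> {v \<in> paths T t. c k v \<in> {l..}}) sequentially"
      unfolding eventually_sequentially by blast
  qed
  then have "eventually (\<lambda>l. (\<integral>v. indicator {v \<in> paths T t. c k v \<in> {l..}} v * (2 * Z v) \<partial>P) < e) sequentially"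
    using e by (rule order_tendstoD)
  then have "eventually (\<lambda>l. (\<integral>v. indicator {v \<in> paths T t. c k v \<in> {l..}} v * (2 * Z v) \<partial>P) < e \<and> 1 \<le> l) sequentially"
    by (intro eventually_conj eventually_ge_at_top)
  from eventually_happens'[OF sequentially_bot this]
  obtain l :: nat where l: "(\<integral>v. indicator {v \<in> paths T t. c k v \<in> {l..}} v * (2 * Z v) \<partial>P) < e" "1 \<le> l"
    by (elim exE conjE)

  \<comment> \<open>The block number; in block 0 neither the measure nor \<open>\<gamma>\<close> is changed.\<close>
  define b where "b v = (if v \<in> G M \<and> s \<le> \<gamma> v \<and> c k v < l then Suc (c k v) else 0)" for v
  define \<A> where "\<A> j = {v \<in> paths T t. b v = j}" for j
  have bl: "b v \<le> l" for v by (simp add: b_def)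
  have b\<gamma>: "s \<le> \<gamma> v" if "b v \<noteq> 0" for v using that by (auto simp: b_def split: if_splits)
  \<comment> \<open>The union of the blocks from 1 on, written as an event at time
    \<open>s\<close>.\<close>
  define S where "S = G M \<inter> (paths T t - {v \<in> paths T t. \<gamma> v < s}) \<inter> {v \<in> paths T t. c k v \<in> {..<l}}"
  have compl: "paths T t - X \<in> sets ?F" if "X \<in> sets ?F" for X
    using sets.compl_sets[OF that] by simp
  have S: "S \<in> sets ?F" unfolding S_def
    by (intro sets.Int G_sets c_sets compl stopping_times_less[OF \<gamma>])
  have bS: "b v = (if v \<in> S then Suc (c k v) else 0)" if "v \<in> paths T t" for v
    using that by (auto simp: b_def S_def)
  have \<A>_sets: "\<A> j \<in> sets ?F" for j
  proof (cases j)
    case 0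
    have eq: "\<A> j = paths T t - S" using 0 bS by (auto simp: \<A>_def split: if_splits)
    show ?thesis unfolding eq by (rule compl[OF S])
  next
    case (Suc i)
    have "S \<subseteq> paths T t" by (auto simp: S_def)
    then have eq: "\<A> j = S \<inter> {v \<in> paths T t. c k v \<in> {i}}"
      using Suc bS by (auto simp: \<A>_def split: if_splits)
    show ?thesis unfolding eq by (intro sets.Int S c_sets)
  qed
  \<comment> \<open>Block \<open>j\<close> lies in cell \<open>j - 1\<close>, since number 0 denotes
    the unchanged block. A cell without a path of index below \<open>M\<close> yields an empty
    block, but the pasting condition asks for a centre there too, hence the default
    \<open>x0\<close>.\<close>
  define good where "good i x \<longleftrightarrow> x \<in> paths T t \<and> mi x < M \<and> c k x = i" for i x
  define ws where "ws j = (if \<exists>x. good (j - 1) x then SOME x. good (j - 1) x else x0)" for j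
  have ws_paths: "ws j \<in> paths T t" and ws_mi: "mi (ws j) < M" for j
    using someI_ex[of "good (j - 1)"] x0 M(2) by (auto simp: ws_def good_def)
  \<comment> \<open>Membership in \<open>G M\<close> is used at resolution \<open>k\<close> alone:
    the cell of \<open>v\<close> contains a path of index below \<open>M\<close>, so the centre was
    picked from that cell.\<close>
  have close: "norm (v r - ws j r) \<le> 1 / (real k + 1)"
    if v: "v \<in> \<A> j" and j: "j \<in> {1..l}" and r: "r \<in> {t..s}" for v j r
  proof -
    have "b v = j" "b v \<noteq> 0" using v j by (auto simp: \<A>_def)
    then have "v \<in> G M" and cv: "c k v = j - 1" by (auto simp: b_def split: if_splits)
    then obtain x where "x \<in> paths T t" "mi x < M" "c k x = c k v" unfolding G_def by blast
    then have "\<exists>x. good (j - 1) x" using cv by (auto simp: good_def)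
    then have "good (j - 1) (ws j)" by (simp add: ws_def someI_ex)
    then have "c k v = c k (ws j)" using cv by (simp add: good_def)
    then show ?thesis using v ws_paths r by (intro cell) (auto simp: \<A>_def)
  qed
  have Qi: "Q (ws j) \<in> integrable_probs T g L U s" for j
    using class_integrable[OF s_in(1) spliced[OF ws_paths]] sel ws_paths by blast

  have p1: "\<forall>j\<in>{0..l}. \<A> j \<in> sets ?F" using \<A>_sets by blast
  have p2: "disjoint_family_on \<A> {0..l}" by (auto simp: disjoint_family_on_def \<A>_def)
  have p3: "(\<Union>j\<in>{0..l}. \<A> j) = paths T t" using bl by (auto simp: \<A>_def)
  have p4: "\<forall>j\<in>{1..l}. ws j \<in> paths T t \<and> \<A> j \<subseteq> path_ball T t s \<delta> (ws j) \<and>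
      Q (ws j) \<in> \<P> s (splice T 0 t w (ws j))"
  proof (intro ballI conjI subsetI)
    fix j v assume "j \<in> {1..l}" "v \<in> \<A> j"
    then show "v \<in> path_ball T t s \<delta> (ws j)"
      by (intro path_ballI[OF _ close k]) (auto simp: \<A>_def)
  qed (use ws_paths sel in auto)
  note paste' = paste[THEN spec[where x = P], THEN spec[where x = \<delta>], THEN spec[where x = l],
      THEN spec[where x = \<A>], THEN spec[where x = ws], THEN spec[where x = "\<lambda>j. Q (ws j)"],
      THEN mp, OF P, THEN mp, OF \<delta>(2), THEN mp, OF \<delta>(1), THEN mp, OF l(2), THEN mp, OF p1,
      THEN mp, OF p2, THEN mp, OF p3, THEN mp, OF p4]
  from paste' obtain Ph where Ph: "Ph \<in> \<P> t w"
    and on0: "\<forall>A\<in>sets (raw_filtration T t T). emeasure Ph (A \<inter> \<A> 0) = emeasure P (A \<inter> \<A> 0)"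
    and onj: "\<forall>j\<in>{1..l}. \<forall>A\<in>sets ?F. emeasure Ph (A \<inter> \<A> j) = emeasure P (A \<inter> \<A> j)"
    and qs: "\<forall>p\<in>stopping_times T s. \<exists>q :: nat \<Rightarrow> 'd path \<Rightarrow> real.
          (\<forall>j\<in>{1..l}. q j \<in> stopping_times_from T t s \<infinity>) \<and>
          (\<forall>A\<in>sets ?F. \<forall>\<tau>\<in>stopping_times_from T t s n.
            (\<Sum>j=1..l. \<integral>v. indicator (A \<inter> \<A> j) v * R \<tau> (q j) v \<partial>Ph) \<le>
            (\<Sum>j=1..l. \<integral>v. indicator (A \<inter> \<A> j) v *
              (sup_payoff (Q (ws j)) p v + running_gain t w s v) \<partial>P) + \<rho>h \<delta>)"
    by (elim bexE conjE)
  have "\<forall>i. \<exists>q :: nat \<Rightarrow> 'd path \<Rightarrow> real.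
          (\<forall>j\<in>{1..l}. q j \<in> stopping_times_from T t s \<infinity>) \<and>
          (\<forall>A\<in>sets ?F. \<forall>\<tau>\<in>stopping_times_from T t s n.
            (\<Sum>j=1..l. \<integral>v. indicator (A \<inter> \<A> j) v * R \<tau> (q j) v \<partial>Ph) \<le>
            (\<Sum>j=1..l. \<integral>v. indicator (A \<inter> \<A> j) v *
              (sup_payoff (Q (ws j)) (C i) v + running_gain t w s v) \<partial>P) + \<rho>h \<delta>)"
    by (intro allI bspec[OF qs]) (rule C[rule_format])
  from choice[OF this] obtain q :: "nat \<Rightarrow> nat \<Rightarrow> 'd path \<Rightarrow> real" where q: "\<forall>i.
          (\<forall>j\<in>{1..l}. q i j \<in> stopping_times_from T t s \<infinity>) \<and>
          (\<forall>A\<in>sets ?F. \<forall>\<tau>\<in>stopping_times_from T t s n.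
            (\<Sum>j=1..l. \<integral>v. indicator (A \<inter> \<A> j) v * R \<tau> (q i j) v \<partial>Ph) \<le>
            (\<Sum>j=1..l. \<integral>v. indicator (A \<inter> \<A> j) v *
              (sup_payoff (Q (ws j)) (C i) v + running_gain t w s v) \<partial>P) + \<rho>h \<delta>)" ..
  \<comment> \<open>The label of a block is the index selected at its centre. All labels lie below
    \<open>M\<close>, so the error is charged at most \<open>M\<close> times.\<close>
  define m where "m j = mi (ws j)" for j
  have q_st: "q i j \<in> stopping_times_from T t s \<infinity>" if "j \<in> {1..l}" for i j
    using q[THEN spec[where x = i], THEN conjunct1, THEN bspec, OF that] .
  have disj: "disjoint_family_on \<A> {1..l}" by (auto simp: disjoint_family_on_def \<A>_def)

  have pasted: "(\<Sum>j=1..l. \<integral>v. indicator (A \<inter> \<A> j) v * R \<tau> (q (m j) j) v \<partial>Ph) \<le>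
      (\<Sum>j=1..l. \<integral>v. indicator (A \<inter> \<A> j) v * (VS v + running_gain t w s v) \<partial>P) + 5 * e"
    if A: "A \<in> sets ?F" and \<tau>: "\<tau> \<in> stopping_times_from T t s n" for A \<tau>
  proof -
    have "(\<Sum>j=1..l. \<integral>v. indicator (A \<inter> \<A> j) v * R \<tau> (q (m j) j) v \<partial>Ph) \<le>
        (\<Sum>j=1..l. \<integral>v. indicator (A \<inter> \<A> j) v *
          (sup_payoff (Q (ws j)) (C (m j)) v + running_gain t w s v) \<partial>P) + real M * \<rho>h \<delta>"
    proof (rule sum_integral_grouped[OF disj _ \<A>_sets A, where f = "\<lambda>i j. R \<tau> (q i j)" and
        h = "\<lambda>i j v. sup_payoff (Q (ws j)) (C i) v + running_gain t w s v"])
      show "m j < M" for j unfolding m_def by (rule ws_mi)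
      fix i B assume B: "B \<in> sets ?F"
      show "(\<Sum>j=1..l. \<integral>v. indicator (B \<inter> \<A> j) v * R \<tau> (q i j) v \<partial>Ph) \<le>
        (\<Sum>j=1..l. \<integral>v. indicator (B \<inter> \<A> j) v *
          (sup_payoff (Q (ws j)) (C i) v + running_gain t w s v) \<partial>P) + \<rho>h \<delta>"
        using q[THEN spec[where x = i], THEN conjunct2, THEN bspec, OF B, THEN bspec, OF \<tau>] .
    qed
    moreover have "(\<Sum>j=1..l. \<integral>v. indicator (A \<inter> \<A> j) v *
          (sup_payoff (Q (ws j)) (C (m j)) v + running_gain t w s v) \<partial>P) \<le>
        (\<Sum>j=1..l. (\<integral>v. indicator (A \<inter> \<A> j) v * (VS v + running_gain t w s v) \<partial>P) +
          4 * e * measure P (A \<inter> \<A> j))"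
    proof (rule sum_mono)
      fix j assume j: "j \<in> {1..l}"
      let ?B = "A \<inter> \<A> j" and ?S = "sup_payoff (Q (ws j)) (C (m j))"
      have B: "?B \<in> sets P" using A \<A>_sets[of j] sub by auto
      have measP: "f \<in> borel_measurable P" if "f \<in> borel_measurable ?F" for f :: "'d path \<Rightarrow> real"
        using filtration_s_T[OF that] measurable_cong_sets[OF setsP refl] by blast
      have gm: "running_gain t w s \<in> borel_measurable P"
        by (rule measP[OF running_gain_adapted[OF t_in s_in(2) w]])
      have Sm: "?S \<in> borel_measurable P"
        by (rule measP[OF sup_payoff_measurable[OF Qi C[rule_format]]])
      have VSm: "VS \<in> borel_measurable P" by (rule measP[OF VS_measurable])
      \<comment> \<open>From \<open>v\<close> to the centre, the selection there, and back to
        \<open>v\<close>: \<open>e + 2 * e + e\<close>.\<close>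
      have S_le: "?S v \<le> VS v + 4 * e" if v: "v \<in> ?B" for v
      proof -
        have vp: "v \<in> paths T t" and v\<A>: "v \<in> \<A> j" using v by (auto simp: \<A>_def)
        have cl: "norm (v r - ws j r) \<le> \<delta>" if "r \<in> {t..s}" for r
          using close[OF v\<A> j that] k by linarith
        have "?S v \<le> ?S (ws j) + (1 + T) * \<rho>0 \<delta>"
          by (rule sup_payoff_le[OF Qi C[rule_format] vp ws_paths \<delta>0 cl])
        moreover have "?S (ws j) \<le> VS (ws j) + 2 * e" using sel ws_paths unfolding m_def by blast
        moreover have "\<bar>VS v - VS (ws j)\<bar> \<le> \<rho>1 \<delta>" by (rule VS_diff[OF vp ws_paths \<delta>0 cl])
        ultimately show ?thesis using \<rho>0 \<rho>1 by linarith
      qed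
      \<comment> \<open>A bound that is integrable under \<open>Q (ws j)\<close> says nothing about
        \<open>P\<close>. Integrability under \<open>P\<close> comes from enclosing
        \<open>?S\<close> on the block between \<open>L\<close> and
        \<open>VS v + 4 * e\<close>.\<close>
      have S_ge: "L s (splice T 0 t w v) \<le> ?S v" if "v \<in> paths T t" for v
        unfolding sup_payoff_def by (rule L_le_SUP[OF s_in(1) spliced[OF that] Qi C[rule_format]])
      have i1: "integrable P (\<lambda>v. indicator ?B v * (?S v + running_gain t w s v))"
      proof (rule Bochner_Integration.integrable_bound[where f = "\<lambda>v. Z v + 4 * e"])
        show "integrable P (\<lambda>v. Z v + 4 * e)" using Z by simp
        show "(\<lambda>v. indicator ?B v * (?S v + running_gain t w s v)) \<in> borel_measurable P"
          using B gm Sm by measurable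
        show "AE v in P. norm (indicator ?B v * (?S v + running_gain t w s v)) \<le> norm (Z v + 4 * e)"
        proof (rule AE_I2)
          fix v assume "v \<in> space P"
          then have v: "v \<in> paths T t" by (simp add: spP)
          have Z0: "\<bar>running_gain t w s v\<bar> + \<bar>L s (splice T 0 t w v)\<bar> \<le> Z v"
            using bd[rule_format, OF v s_in(2) s_in(2)] by (rule conjunct1)
          have "\<bar>?S v + running_gain t w s v\<bar> \<le> Z v + 4 * e" if "v \<in> ?B"
            using S_le[OF that] S_ge[OF v] Z0 e bounds(1)[OF v \<gamma>] by linarith
          then show "norm (indicator ?B v * (?S v + running_gain t w s v)) \<le> norm (Z v + 4 * e)"
            using Z0 e by (cases "v \<in> ?B") simp_all
        qed
      qed
      have VSg: "integrable P (\<lambda>v. VS v + running_gain t w s v)"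
      proof (rule Bochner_Integration.integrable_bound[OF Z])
        show "(\<lambda>v. VS v + running_gain t w s v) \<in> borel_measurable P" using VSm gm by measurable
        show "AE v in P. norm (VS v + running_gain t w s v) \<le> norm (Z v)"
        proof (rule AE_I2)
          fix v assume "v \<in> space P"
          then have "v \<in> paths T t" by (simp add: spP)
          from bounds(1)[OF this \<gamma>] show "norm (VS v + running_gain t w s v) \<le> norm (Z v)" by simp
        qed
      qed
      have i2: "integrable P (\<lambda>v. indicator ?B v * (VS v + running_gain t w s v))"
        by (rule integrable_indicator_mult[OF VSg B])
      have i3: "integrable P (\<lambda>v. 4 * e * indicator ?B v)"
        using B by (intro integrable_mult_right integrable_real_indicator) (auto simp: emeasure_eq_measure)
      have "(\<integral>v. indicator ?B v * (?S v + running_gain t w s v) \<partial>P) \<le>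
          (\<integral>v. indicator ?B v * (VS v + running_gain t w s v) + 4 * e * indicator ?B v \<partial>P)"
      proof (rule Bochner_Integration.integral_mono[OF i1 Bochner_Integration.integrable_add[OF i2 i3]])
        fix v
        show "indicator ?B v * (?S v + running_gain t w s v) \<le>
            indicator ?B v * (VS v + running_gain t w s v) + 4 * e * indicator ?B v"
          using S_le[of v] by (cases "v \<in> ?B") simp_all
      qed
      also have "\<dots> = (\<integral>v. indicator ?B v * (VS v + running_gain t w s v) \<partial>P) + 4 * e * measure P ?B"
        using B by (subst Bochner_Integration.integral_add[OF i2 i3]) simp
      finally show "(\<integral>v. indicator ?B v * (?S v + running_gain t w s v) \<partial>P) \<le>
          (\<integral>v. indicator ?B v * (VS v + running_gain t w s v) \<partial>P) + 4 * e * measure P ?B" .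
    qed
    \<comment> \<open>The blocks are disjoint, so the loss \<open>4 * e\<close> is paid once in
      total, however many blocks there are.\<close>
    moreover have "(\<Sum>j=1..l. 4 * e * measure P (A \<inter> \<A> j)) \<le> 4 * e"
    proof -
      have "A \<inter> \<A> j \<in> sets P" for j using sets.Int[OF A \<A>_sets] sub by blast
      moreover have "disjoint_family_on (\<lambda>j. A \<inter> \<A> j) {1..l}"
        by (auto simp: disjoint_family_on_def \<A>_def)
      ultimately have "(\<Sum>j=1..l. measure P (A \<inter> \<A> j)) = measure P (\<Union>j\<in>{1..l}. A \<inter> \<A> j)"
        by (intro finite_measure_finite_Union[symmetric]) auto
      also have "\<dots> \<le> 1" by (rule prob_le_1)
      finally have "4 * e * (\<Sum>j=1..l. measure P (A \<inter> \<A> j)) \<le> 4 * e * 1"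
        using e by (intro mult_left_mono) auto
      then show ?thesis by (simp only: sum_distrib_left mult_1_right)
    qed
    ultimately show ?thesis using \<rho>h unfolding sum.distrib by linarith
  qed

  let ?\<gamma>h = "\<lambda>v. if b v = 0 then \<gamma> v else q (m (b v)) (b v) v"
  have \<gamma>h: "?\<gamma>h \<in> stopping_times T t"
    using switched_stopping_time[of b l \<gamma> "\<lambda>j. q (m j) j"] \<A>_sets bl \<gamma> b\<gamma> q_st
    unfolding \<A>_def by blast
  have Phi: "Ph \<in> integrable_probs T g L U t" by (rule class_integrable[OF t_in w Ph])
  \<comment> \<open>A path of block 0 with \<open>s \<le> \<gamma> v\<close> lies outside
    \<open>G M\<close> or in a cell numbered from \<open>l\<close> on; each of the two sets
    contributes at most \<open>e\<close>.\<close>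
  have bad: "(\<integral>v. indicator {v \<in> paths T t. b v = 0 \<and> s \<le> \<gamma> v} v * (2 * Z v) \<partial>P) \<le> 2 * e"
  proof -
    have B: "{v \<in> paths T t. b v = 0 \<and> s \<le> \<gamma> v} = \<A> 0 \<inter> (paths T t - {v \<in> paths T t. \<gamma> v < s})"
      by (auto simp: \<A>_def)
    have B1: "{v \<in> paths T t. b v = 0 \<and> s \<le> \<gamma> v} \<in> sets P"
      unfolding B using sets.Int[OF \<A>_sets compl[OF stopping_times_less[OF \<gamma>]]] sub by blast
    have B2: "paths T t - G M \<in> sets P" using compl[OF G_sets] sub by blast
    have B3: "{v \<in> paths T t. c k v \<in> {l..}} \<in> sets P" using c_sets sub by blast
    have "(\<integral>v. indicator {v \<in> paths T t. b v = 0 \<and> s \<le> \<gamma> v} v * (2 * Z v) \<partial>P) \<le>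
        (\<integral>v. indicator (paths T t - G M) v * (2 * Z v) +
          indicator {v \<in> paths T t. c k v \<in> {l..}} v * (2 * Z v) \<partial>P)"
    proof (rule Bochner_Integration.integral_mono)
      show "integrable P (\<lambda>v. indicator {v \<in> paths T t. b v = 0 \<and> s \<le> \<gamma> v} v * (2 * Z v))"
        by (rule integrable_indicator_mult[OF Z2 B1])
      show "integrable P (\<lambda>v. indicator (paths T t - G M) v * (2 * Z v) +
          indicator {v \<in> paths T t. c k v \<in> {l..}} v * (2 * Z v))"
        by (intro Bochner_Integration.integrable_add integrable_indicator_mult Z2 B2 B3)
      fix v assume "v \<in> space P"
      then have v: "v \<in> paths T t" by (simp add: spP)
      have "0 \<le> Z v" using bounds(1)[OF v \<gamma>] by linarith
      then show "indicator {v \<in> paths T t. b v = 0 \<and> s \<le> \<gamma> v} v * (2 * Z v) \<le>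
          indicator (paths T t - G M) v * (2 * Z v) + indicator {v \<in> paths T t. c k v \<in> {l..}} v * (2 * Z v)"
        using v by (auto simp: indicator_def b_def)
    qed
    also have "\<dots> = (\<integral>v. indicator (paths T t - G M) v * (2 * Z v) \<partial>P) +
        (\<integral>v. indicator {v \<in> paths T t. c k v \<in> {l..}} v * (2 * Z v) \<partial>P)"
      by (intro Bochner_Integration.integral_add integrable_indicator_mult Z2 B2 B3)
    finally show ?thesis using M(1) l(1) by linarith
  qed
  have bdd: "bdd_above ((\<lambda>\<tau>. \<integral>v. stopped_payoff \<tau> \<gamma> v \<partial>P) ` stopping_times_n T t n)"
  proof (rule bdd_aboveI2)
    fix \<tau> :: "'d path \<Rightarrow> real" assume "\<tau> \<in> stopping_times_n T t n"
    then have \<tau>: "\<tau> \<in> stopping_times T t" by (rule stopping_times_n_subset)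
    show "(\<integral>v. stopped_payoff \<tau> \<gamma> v \<partial>P) \<le> (\<integral>v. Z v \<partial>P)"
    proof (rule Bochner_Integration.integral_mono[OF stopped_payoff_integrable[OF Pi \<tau> \<gamma>] Z])
      fix v assume "v \<in> space P"
      then have "v \<in> paths T t" by (simp add: spP)
      from bounds(2)[OF this \<tau>] show "stopped_payoff \<tau> \<gamma> v \<le> Z v" by linarith
    qed
  qed
  have "game_value T g L U \<P> n t w \<le> (SUP \<tau>\<in>stopping_times_n T t n. \<integral>v. R \<tau> ?\<gamma>h v \<partial>Ph)"
    by (rule game_value_le[OF t_in w Ph \<gamma>h])
  also have "\<dots> \<le> (SUP \<tau>\<in>stopping_times_n T t n. \<integral>v. stopped_payoff \<tau> \<gamma> v \<partial>P) + 7 * e"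
  proof (rule cSUP_least)
    show "stopping_times_n T t n \<noteq> ({} :: ('d path \<Rightarrow> real) set)"
      using stopping_times_n_start[of t T n] t_in by fastforce
    fix \<tau> :: "'d path \<Rightarrow> real" assume \<tau>: "\<tau> \<in> stopping_times_n T t n"
    have "(\<integral>v. R \<tau> ?\<gamma>h v \<partial>Ph) \<le> (\<integral>v. stopped_payoff \<tau> \<gamma> v \<partial>P) +
        (\<integral>v. indicator {v \<in> paths T t. b v = 0 \<and> s \<le> \<gamma> v} v * (2 * Z v) \<partial>P) + 5 * e"
    proof (rule pasted_payoff_le[where b = b and l = l and \<gamma> = \<gamma> and q = "\<lambda>j. q (m j) j",
        OF Pi Phi \<A>_sets[unfolded \<A>_def] bl \<gamma> b\<gamma> q_st \<gamma>h _ _ Z bd[rule_format] pasted[unfolded \<A>_def] \<tau>])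
      show "emeasure Ph (A \<inter> {v \<in> paths T t. b v = 0}) = emeasure P (A \<inter> {v \<in> paths T t. b v = 0})"
        if "A \<in> sets (raw_filtration T t T)" for A
        using bspec[OF on0 that] by (simp only: \<A>_def)
      show "emeasure Ph (A \<inter> {v \<in> paths T t. b v = j}) = emeasure P (A \<inter> {v \<in> paths T t. b v = j})"
        if "j \<in> {1..l}" "A \<in> sets ?F" for A j
        using bspec[OF bspec[OF onj that(1)] that(2)] by (simp only: \<A>_def)
    qed
    moreover have "(\<integral>v. stopped_payoff \<tau> \<gamma> v \<partial>P) \<le>
        (SUP \<tau>\<in>stopping_times_n T t n. \<integral>v. stopped_payoff \<tau> \<gamma> v \<partial>P)"
      by (rule cSUP_upper[OF \<tau> bdd])
    ultimately show "(\<integral>v. R \<tau> ?\<gamma>h v \<partial>Ph) \<le>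
        (SUP \<tau>\<in>stopping_times_n T t n. \<integral>v. stopped_payoff \<tau> \<gamma> v \<partial>P) + 7 * e"
      using bad by linarith
  qed
  finally show ?thesis .
qed

end

theorem proposition3p1:
  fixes T t s :: real
    and g L U :: "real \<Rightarrow> ('d::finite) path \<Rightarrow> real"
    and \<P> :: "real \<Rightarrow> 'd path \<Rightarrow> 'd path measure set"
    and \<rho>0 :: "real \<Rightarrow> real"
    and n :: enat
    and w :: "'d path"
  assumes "0 < T"
    and "payoff_regular T g L U \<rho>0"
    and "integrability_condition T g L U"
    and "adapted_class T g L U \<P>"
    and "stable_under_conditioning T \<P>"
    and "weakly_stable_under_pasting T g L U \<P>"
    and "path_continuous_values T g L U \<P> \<rho>0"
    and "1 \<le> n" and "0 \<le> t" and "t \<le> s" and "s \<le> T" and "w \<in> paths T 0"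
  shows "game_value T g L U \<P> n t w \<le>
    (INF P\<in>\<P> t w. INF \<gamma>\<in>stopping_times T t. SUP \<tau>\<in>stopping_times_n T t n.
       (\<integral>v. (if min (\<tau> v) (\<gamma> v) < s then payoff T g L U t w \<tau> \<gamma> v
             else shift_process T 0 t w (game_value T g L U \<P> n) s v
                  + (LINT r:{t..s}|lborel. shift_process T 0 t w g r v)) \<partial>P))"
proof -
  have t: "t \<in> {0..T}" using assms by auto
  interpret game_class T g L U \<rho>0 \<P>
    using assms(1,2,4) by unfold_locales
  obtain \<rho>1 where mod1: "modulus_of_continuity \<rho>1" and cont:
    "\<forall>n::enat. 1 \<le> n \<longrightarrow> (\<forall>t\<in>{0..T}. \<forall>w1\<in>paths T 0. \<forall>w2\<in>paths T 0.
      \<bar>game_value T g L U \<P> n t w1 - game_value T g L U \<P> n t w2\<bar> \<le> \<rho>1 (sup_norm 0 t (\<lambda>r. w1 r - w2 r)))"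
    using assms(7) unfolding path_continuous_values_def by (elim exE conjE)
  let ?F = "\<lambda>\<tau> \<gamma> v. if min (\<tau> v) (\<gamma> v) < s then payoff T g L U t w \<tau> \<gamma> v
    else shift_process T 0 t w (game_value T g L U \<P> n) s v
      + (LINT r:{t..s}|lborel. shift_process T 0 t w g r v)"
  have main: "game_value T g L U \<P> n t w \<le> (SUP \<tau>\<in>stopping_times_n T t n. \<integral>v. ?F \<tau> \<gamma> v \<partial>P)"
    if P: "P \<in> \<P> t w" and \<gamma>: "\<gamma> \<in> stopping_times T t" for P \<gamma>
  proof (cases "t < s")
    case True
    have s: "s \<in> {0..T}" using assms by auto
    interpret game_dpp T g L U \<rho>0 \<P> n \<rho>1 t s w
    proof (unfold_locales, rule mod1)
      show "\<bar>game_value T g L U \<P> n s w1 - game_value T g L U \<P> n s w2\<bar> \<le> \<rho>1 (sup_norm 0 s (\<lambda>r. w1 r - w2 r))"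
        if "w1 \<in> paths T 0" "w2 \<in> paths T 0" for w1 w2
        using cont[THEN spec[where x = n], THEN mp, OF assms(8), THEN bspec, OF s,
            THEN bspec, OF that(1), THEN bspec, OF that(2)] .
    qed (use assms True in auto)
    have F: "?F \<tau> \<gamma> = stopped_payoff \<tau> \<gamma>" for \<tau>
      by (simp add: fun_eq_iff stopped_payoff_def VS_def running_gain_def shift_process_def)
    show ?thesis
    proof (rule field_le_epsilon)
      fix e :: real assume "0 < e"
      then have "0 < e / 7" by simp
      from game_value_le_stopped[OF assms(6) P \<gamma> this]
      show "game_value T g L U \<P> n t w \<le> (SUP \<tau>\<in>stopping_times_n T t n. \<integral>v. ?F \<tau> \<gamma> v \<partial>P) + e"
        unfolding F by simp
    qed
  next
    \<comment> \<open>With \<open>s = t\<close> nobody stops before \<open>s\<close>, the integral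
      over one point vanishes, and the spliced path agrees with \<open>w\<close> up to
      \<open>t\<close>, so continuity of the value at distance zero makes the integrand the constant
      \<open>game_value T g L U \<P> n t w\<close>.\<close>
    case False
    then have st: "s = t" using assms by simp
    have PP: "P \<in> path_probs T t"
      using class_integrable[OF t assms(12) P] by (simp add: integrable_probs_def)
    interpret prob_space P by (rule path_probsD(1)[OF PP])
    have "(\<integral>v. ?F \<tau> \<gamma> v \<partial>P) = game_value T g L U \<P> n t w" if \<tau>: "\<tau> \<in> stopping_times_n T t n" for \<tau>
    proof -
      have "(\<integral>v. ?F \<tau> \<gamma> v \<partial>P) = (\<integral>v. game_value T g L U \<P> n t w \<partial>P)"
      proof (rule Bochner_Integration.integral_cong[OF refl])
        fix v assume "v \<in> space P"
        then have v: "v \<in> paths T t" using path_probsD(2)[OF PP] by simp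
        have "\<not> min (\<tau> v) (\<gamma> v) < s"
          using stopping_times_in[OF \<gamma> v] stopping_times_in[OF stopping_times_n_subset[OF \<tau>] v] st by auto
        moreover have "shift_process T 0 t w (game_value T g L U \<P> n) s v = game_value T g L U \<P> n t w"
        proof -
          have x: "splice T 0 t w v \<in> paths T 0" by (rule splice_paths0[OF t assms(12) v])
          have le: "norm (splice T 0 t w v r - w r) \<le> 0" if "r \<in> {0..t}" for r
            using that t v by (auto simp: splice_apply paths_def)
          have "sup_norm 0 t (\<lambda>r. splice T 0 t w v r - w r) = 0"
            using assms(9) by (intro antisym sup_norm_le[OF _ le] sup_norm_nonneg[OF _ le]) auto
          then have "\<bar>game_value T g L U \<P> n t (splice T 0 t w v) - game_value T g L U \<P> n t w\<bar> \<le> \<rho>1 0"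
            using cont[THEN spec[where x = n], THEN mp, OF assms(8), THEN bspec, OF t,
                THEN bspec, OF x, THEN bspec, OF assms(12)] by simp
          then show ?thesis by (simp add: shift_process_def st modulus_zero[OF mod1])
        qed
        moreover have "(LINT r:{t..s}|lborel. shift_process T 0 t w g r v) = 0"
          using running_gain_start[of t w v] by (simp add: running_gain_def shift_process_def st)
        ultimately show "?F \<tau> \<gamma> v = game_value T g L U \<P> n t w" by simp
      qed
      then show ?thesis by (simp add: prob_space)
    qed
    moreover have "stopping_times_n T t n \<noteq> ({} :: ('d path \<Rightarrow> real) set)"
      using stopping_times_n_start[of t T n] t by fastforce
    ultimately show ?thesis by (simp cong: SUP_cong)
  qed
  have "stopping_times T t \<noteq> ({} :: ('d path \<Rightarrow> real) set)"
    using stopping_times_const[of t t T] t by fastforce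
  then show ?thesis
    by (intro cINF_greatest class_nonempty[OF t assms(12)] main)
qed

end
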